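(* For each fixed integer $k\ge 1$, as $n\to\infty$ the $k$th largest eigenvalue (counted with multiplicity) of $M_n$ equals $$1-\frac{\mu_k}{n}+o\left(\frac1n\right),$$ where $\mu_k=\frac{(2k-1)\pi}{2}$ is the $k$th smallest eigenvalue of the operator $L=-\frac14\frac{d^2}{dx^2}+\pi^2x^2$ on $L^2(\mathbb{R})$.
   Context: $M_n$ is the real symmetric $n\times n$ matrix with rows and columns indexed by $\mathbb{Z}/n\mathbb{Z}$ and entries $$(M_n)_{j,k}=\frac14\left[\delta(j-k-1)+\delta(j-k+1)\right]+\frac12\cos\left(\frac{2\pi k}{n}\right)\delta(j-k),\qquad j,k\in\mathbb{Z}/n\mathbb{Z},$$ where $\delta(0)=1$ and $\delta(m)=0$ for $m\ne0$ in $\mathbb{Z}/n\mathbb{Z}$. $L$ is the usual self-adjoint harmonic oscillator on $L^2(\mathbb{R})$. *)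

theory Defs
  imports
    "HOL-Analysis.Analysis"
    "HOL-Library.Landau_Symbols"
    "Jordan_Normal_Form.Char_Poly"
begin

text \<open>The indices \<open>0, \<dots>, n - 1\<close> represent \<open>\<int>/n\<int>\<close>. For \<open>n = 1, 2\<close> the two shifted deltas
  can be nonzero at the same entry, and then both contribute.\<close>

definition delta_mod :: "nat \<Rightarrow> int \<Rightarrow> real" where
  "delta_mod n m = (if int n dvd m then 1 else 0)"

definition M :: "nat \<Rightarrow> real mat" where
  "M n = mat n n (\<lambda>(j, k).
     1/4 * (delta_mod n (int j - int k - 1) + delta_mod n (int j - int k + 1))
     + 1/2 * cos (2 * pi * real k / real n) * delta_mod n (int j - int k))"

text \<open>Multiplicities are algebraic; for the real symmetric matrices considered here they agree
  with the geometric ones, and the multiset below has size \<open>n\<close>.\<close>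

definition eigenvalue_mset :: "real mat \<Rightarrow> real multiset" where
  "eigenvalue_mset A =
     (\<Sum>e\<in>{e. eigenvalue A e}. replicate_mset (Polynomial.order e (char_poly A)) e)"

text \<open>Counting starts at \<open>k = 1\<close>; the value is meaningful for \<open>1 \<le> k \<le> size (eigenvalue_mset A)\<close>.\<close>

definition kth_largest_eigenvalue :: "real mat \<Rightarrow> nat \<Rightarrow> real" where
  "kth_largest_eigenvalue A k = rev (sorted_list_of_multiset (eigenvalue_mset A)) ! (k - 1)"


text \<open>Elements of \<open>L\<^sup>2(\<real>)\<close> are represented by complex-valued functions, to be read modulo equality
  almost everywhere; (unbounded) operators are given by their graphs.\<close>

definition square_integrable :: "(real \<Rightarrow> complex) \<Rightarrow> bool" where
  "square_integrable f \<longleftrightarrow>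
     f \<in> borel_measurable lborel \<and> integrable lborel (\<lambda>x. (cmod (f x))\<^sup>2)"

definition L2_tendsto :: "(nat \<Rightarrow> real \<Rightarrow> complex) \<Rightarrow> (real \<Rightarrow> complex) \<Rightarrow> bool" where
  "L2_tendsto F f \<longleftrightarrow> (\<lambda>n. LINT x|lborel. (cmod (F n x - f x))\<^sup>2) \<longlonglongrightarrow> 0"

definition D :: "(real \<Rightarrow> complex) \<Rightarrow> real \<Rightarrow> complex" where
  "D f = (\<lambda>x. vector_derivative f (at x))"

definition schwartz :: "(real \<Rightarrow> complex) \<Rightarrow> bool" where
  "schwartz f \<longleftrightarrow>
     (\<forall>n x. (D ^^ n) f differentiable (at x)) \<and>
     (\<forall>m n. bounded (range (\<lambda>x. complex_of_real (x ^ m) * (D ^^ n) f x)))"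

definition oscillator_expr :: "(real \<Rightarrow> complex) \<Rightarrow> real \<Rightarrow> complex" where
  "oscillator_expr f = (\<lambda>x. - (1/4) * D (D f) x + complex_of_real (pi\<^sup>2 * x\<^sup>2) * f x)"

text \<open>The differential expression \<open>-1/4 d\<^sup>2/dx\<^sup>2 + \<pi>\<^sup>2 x\<^sup>2\<close> is essentially self-adjoint on the Schwartz
  space; the harmonic oscillator is its unique self-adjoint extension, i.e. its closure. The set
  below is the graph of that closure.\<close>

definition harmonic_oscillator :: "((real \<Rightarrow> complex) \<times> (real \<Rightarrow> complex)) set" where
  "harmonic_oscillator =
     {(f, g). square_integrable f \<and> square_integrable g \<and>
        (\<exists>\<phi>. (\<forall>n. schwartz (\<phi> n)) \<and> L2_tendsto \<phi> f \<and>
             L2_tendsto (\<lambda>n. oscillator_expr (\<phi> n)) g)}"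

definition L2_independent :: "nat \<Rightarrow> (nat \<Rightarrow> real \<Rightarrow> complex) \<Rightarrow> bool" where
  "L2_independent m f \<longleftrightarrow>
     (\<forall>c :: nat \<Rightarrow> complex. (AE x in lborel. (\<Sum>i<m. c i * f i x) = 0) \<longrightarrow> (\<forall>i<m. c i = 0))"

definition op_eigenvalue :: "((real \<Rightarrow> complex) \<times> (real \<Rightarrow> complex)) set \<Rightarrow> real \<Rightarrow> bool" where
  "op_eigenvalue T e \<longleftrightarrow>
     (\<exists>f. (f, \<lambda>x. complex_of_real e * f x) \<in> T \<and> \<not> (AE x in lborel. f x = 0))"

text \<open>The dimension in \<open>L\<^sup>2(\<real>)\<close> of the eigenspace, possibly infinite.\<close>

definition op_multiplicity :: "((real \<Rightarrow> complex) \<times> (real \<Rightarrow> complex)) set \<Rightarrow> real \<Rightarrow> enat" where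
  "op_multiplicity T e =
     Sup {enat m | m. \<exists>f. (\<forall>i<m. (f i, \<lambda>x. complex_of_real e * f i x) \<in> T) \<and> L2_independent m f}"

text \<open>For an operator with real spectrum: \<open>e\<close> is in position \<open>k\<close> (counted from 1) when the
  eigenvalues are listed in nondecreasing order, each repeated according to its multiplicity.\<close>

definition kth_smallest_op_eigenvalue ::
    "((real \<Rightarrow> complex) \<times> (real \<Rightarrow> complex)) set \<Rightarrow> nat \<Rightarrow> real \<Rightarrow> bool" where
  "kth_smallest_op_eigenvalue T k e \<longleftrightarrow>
     op_eigenvalue T e \<and>
     finite {e'. op_eigenvalue T e' \<and> e' < e} \<and>
     (\<Sum>e'\<in>{e'. op_eigenvalue T e' \<and> e' < e}. op_multiplicity T e') < enat k \<and>
     enat k \<le> (\<Sum>e'\<in>{e'. op_eigenvalue T e' \<and> e' \<le> e}. op_multiplicity T e')"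

end

theory Submission
  imports Defs "HOL-Probability.Probability" "HOL-Real_Asymp.Real_Asymp"
begin

text \<open>Operator part: testing an eigenfunction of the closure against the Hermite functions, which are
  Schwartz eigenfunctions for \<open>(2j + 1)\<pi>/2\<close>, shows that it is orthogonal to all but at most one of them;
  and a function orthogonal to all of them has vanishing moments against \<open>exp (-\<pi> x\<^sup>2)\<close>, so it vanishes.

  Matrix part: instead of passing to the continuum, compare \<open>M n\<close> with the matrix of \<open>J\<^sub>x\<close> in the representation
  of spin \<open>S \<approx> n/(2\<pi>)\<close>, whose eigenvalues \<open>S, S - 1, \<dots>, -S\<close> are explicit. The quadratic forms \<open>n (1 - M n)\<close> and
  \<open>\<pi> (S + 1/2 - J\<^sub>x)\<close> are discrete Schroedinger forms on a circle and on an interval; near the bottom of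
  the well their coefficients agree up to a factor \<open>1 + o(1)\<close>, and away from it both potentials are of
  order \<open>n\<close>. Cutting off trial vectors there and applying the min-max principle in both directions shows that
  the low eigenvalues of the two forms have the same limits, namely \<open>\<pi> (k - 1/2)\<close>.\<close>

unbundle no vec_syntax

section \<open>Spectral theorem and min-max comparison\<close>

text \<open>The spin matrix is a useful reference because its spectrum is known at every finite
  size: \<pi> (S + 1/2 - J) has the k-th smallest eigenvalue \<pi> (k - 1/2) exactly, so no limit
  operator, no compactness and no convergence of eigenvectors enters the matrix part. The single
  choice S = n / (2 \<pi>) matches both coefficients at the bottom of the well: the coupling \<pi> S
  / 2 becomes n / 4, and the potential \<pi> m^2 / (2 S) becomes \<pi>^2 m^2 / n, the quadratic term
  of n sin^2 (\<pi> m / n). A cutoff at distance \<delta> n is affordable on both counts: its slope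
  1 / (\<delta> n) costs an energy of order n (1 / (\<delta> n))^2, which tends to 0, and beyond it
  a vector of bounded energy has only mass of order 1 / n. The tolerance e is fixed at the start,
  \<delta> depends on e alone, and n is taken large last. The operator part and the matrix part
  share nothing but the number \<pi> (k - 1/2).\<close>

lemma mset_eq_sum_replicate: "(\<Sum>e\<in>set es. replicate_mset (count (mset es) e) e) = mset es"
proof (rule multiset_eqI)
  fix x
  have "count (\<Sum>e\<in>set es. replicate_mset (count (mset es) e) e) x
      = (\<Sum>e\<in>set es. if x = e then count (mset es) e else 0)"
    by (simp add: count_sum eq_commute if_distrib cong: if_cong)
  also have "\<dots> = count (mset es) x"
    by (auto simp: count_eq_zero_iff sum.delta')
  finally show "count (\<Sum>e\<in>set es. replicate_mset (count (mset es) e) e) x = count (mset es) x" .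
qed

lemma prod_linear_factors_nonzero: "(\<Prod>a\<leftarrow>es. [:- (a::real), 1:]) \<noteq> 0"
  by (induction es) (simp_all del: mult_pCons_left)

lemma order_prod_linear_factors:
  "Polynomial.order e (\<Prod>a\<leftarrow>es. [:- (a::real), 1:]) = count (mset es) e"
proof (induction es)
  case Nil
  then show ?case by (simp add: order_0I)
next
  case (Cons a es)
  have "[:- a, 1:] * (\<Prod>a\<leftarrow>es. [:- a, 1:]) \<noteq> 0"
    using prod_linear_factors_nonzero[of es] by (simp del: mult_pCons_left)
  from order_mult[OF this] Cons show ?case
    by (auto simp: order_linear' simp del: mult_pCons_left)
qed

lemma eigenvalue_mset_eq:
  assumes A: "A \<in> carrier_mat n n" and p: "char_poly A = (\<Prod>a\<leftarrow>es. [:- a, 1:])"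
  shows "eigenvalue_mset A = mset es"
proof -
  have "poly (\<Prod>a\<leftarrow>es. [:- (a::real), 1:]) e = 0 \<longleftrightarrow> e \<in> set es" for e
    by (induction es) auto
  then have "{e. eigenvalue A e} = set es"
    by (simp add: eigenvalue_root_char_poly[OF A] p)
  then show ?thesis
    unfolding eigenvalue_mset_def p order_prod_linear_factors by (simp add: mset_eq_sum_replicate)
qed

section \<open>Diagonalization of real symmetric matrices\<close>

lemma scalar_prod_mult_mat_vec_symmetric:
  fixes A :: "'a::comm_ring_1 mat"
  assumes A: "A \<in> carrier_mat n n" and s: "A\<^sup>T = A" and u: "u \<in> carrier_vec n" and v: "v \<in> carrier_vec n"
  shows "scalar_prod u (A *\<^sub>v v) = scalar_prod (A *\<^sub>v u) v"
  using transpose_vec_mult_scalar[OF A v u] s by simp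

lemma scalar_prod_self_pos:
  fixes v :: "real vec"
  assumes v: "v \<in> carrier_vec n" "v \<noteq> 0\<^sub>v n"
  shows "0 < scalar_prod v v"
proof -
  have "\<exists>i<n. v $ i \<noteq> 0"
  proof (rule ccontr)
    assume "\<not> ?thesis"
    then have "v = 0\<^sub>v n" using v(1) by (intro eq_vecI) auto
    with v(2) show False by simp
  qed
  then obtain i where "i < n" "v $ i \<noteq> 0" by blast
  then have "0 < (\<Sum>i<n. (v $ i)\<^sup>2)" by (intro sum_pos2[of _ i]) auto
  then show ?thesis using v(1) by (simp add: scalar_prod_def power2_eq_square lessThan_atLeast0)
qed

text \<open>The fundamental theorem of algebra gives an eigenpair c, z of the complexified matrix.
  Pairing z with its conjugate, which is inserted by hand because \<open>scalar_prod\<close> is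
  bilinear, and moving the symmetric matrix across gives c |z|^2 = cnj c |z|^2; so c is real and a
  root of the real characteristic polynomial.\<close>

lemma real_symmetric_has_eigenvalue:
  fixes A :: "real mat"
  assumes A: "A \<in> carrier_mat n n" and s: "A\<^sup>T = A" and n: "0 < n"
  shows "\<exists>e. eigenvalue A e"
proof -
  let ?C = "map_mat complex_of_real A"
  have C: "?C \<in> carrier_mat n n" using A by simp
  have dg: "degree (char_poly ?C) = n" using degree_monic_char_poly[OF C] by simp
  then have "\<not> constant (poly (char_poly ?C))"
    using n by (simp add: constant_degree)
  then obtain c where "poly (char_poly ?C) c = 0"
    using fundamental_theorem_of_algebra by blast
  then have "eigenvalue ?C c" using eigenvalue_root_char_poly[OF C] by simp
  then obtain z where z: "z \<in> carrier_vec n" "z \<noteq> 0\<^sub>v n" "?C *\<^sub>v z = c \<cdot>\<^sub>v z"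
    using C unfolding eigenvalue_def eigenvector_def by auto
  let ?w = "map_vec cnj z"
  have w: "?w \<in> carrier_vec n" using z by simp
  have sC: "?C\<^sup>T = ?C" using s by (metis map_mat_transpose)
  have Cw: "?C *\<^sub>v ?w = cnj c \<cdot>\<^sub>v ?w"
  proof (rule eq_vecI)
    show "dim_vec (?C *\<^sub>v ?w) = dim_vec (cnj c \<cdot>\<^sub>v ?w)" using A z by simp
    fix i assume "i < dim_vec (cnj c \<cdot>\<^sub>v ?w)"
    then have i: "i < n" using z by simp
    have "(?C *\<^sub>v ?w) $ i = cnj ((?C *\<^sub>v z) $ i)"
      using A z(1) i by (simp add: scalar_prod_def)
    also have "\<dots> = (cnj c \<cdot>\<^sub>v ?w) $ i" unfolding z(3) using z(1) i by simp
    finally show "(?C *\<^sub>v ?w) $ i = (cnj c \<cdot>\<^sub>v ?w) $ i" .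
  qed
  have "scalar_prod ?w (?C *\<^sub>v z) = scalar_prod (?C *\<^sub>v ?w) z"
    by (rule scalar_prod_mult_mat_vec_symmetric[OF C sC w z(1)])
  then have "c * scalar_prod ?w z = cnj c * scalar_prod ?w z"
    using z w Cw by simp
  moreover have "scalar_prod ?w z = complex_of_real (\<Sum>i<n. (cmod (z $ i))\<^sup>2)"
  proof -
    have "scalar_prod ?w z = (\<Sum>i<n. cnj (z $ i) * z $ i)"
      using z by (auto simp: scalar_prod_def lessThan_atLeast0)
    also have "\<dots> = (\<Sum>i<n. complex_of_real ((cmod (z $ i))\<^sup>2))"
      by (intro sum.cong refl) (simp add: complex_norm_square mult.commute del: of_real_power)
    finally show ?thesis by simp
  qed
  moreover have "(\<Sum>i<n. (cmod (z $ i))\<^sup>2) \<noteq> 0"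
  proof
    assume "(\<Sum>i<n. (cmod (z $ i))\<^sup>2) = 0"
    then have "\<forall>i<n. z $ i = 0" by (simp add: sum_nonneg_eq_0_iff)
    then have "z = 0\<^sub>v n" using z(1) by (intro eq_vecI) auto
    with z(2) show False by simp
  qed
  ultimately have "c = cnj c" by (metis mult_cancel_right of_real_eq_0_iff)
  then have "c = complex_of_real (Re c)" by (simp add: complex_eq_iff)
  with \<open>poly (char_poly ?C) c = 0\<close> have "poly (char_poly ?C) (complex_of_real (Re c)) = 0" by metis
  then have "poly (char_poly A) (Re c) = 0"
    using of_real_hom.char_poly_hom[OF A, where ?'a = complex]
    by (simp only: of_real_hom.poly_map_poly of_real_eq_0_iff)
  then show ?thesis using eigenvalue_root_char_poly[OF A] by blast
qed

text \<open>The matrix is the Householder reflection that swaps \<open>v\<close> and the first unit vector; for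
  \<open>v\<close> equal to that unit vector the division by \<open>c = 0\<close> makes it the identity.\<close>

lemma orthogonal_matrix_with_first_column:
  fixes v :: "real vec"
  assumes v: "v \<in> carrier_vec n" "scalar_prod v v = 1" and n: "0 < n"
  shows "\<exists>H. H \<in> carrier_mat n n \<and> H\<^sup>T = H \<and> H * H = 1\<^sub>m n \<and> col H 0 = v"
proof -
  define w where "w i = v $ i - (if i = 0 then 1 else 0)" for i
  define c where "c = (\<Sum>k<n. w k * w k)"
  define H where "H = mat n n (\<lambda>(i, j). (if i = j then 1 else 0) - 2 * w i * w j / c)"
  have vv: "(\<Sum>k<n. v $ k * v $ k) = 1"
    using v by (simp add: scalar_prod_def lessThan_atLeast0)
  have c: "c = 2 - 2 * v $ 0"
  proof -
    have "c = (\<Sum>k<n. v $ k * v $ k + (if k = 0 then 1 - 2 * v $ 0 else 0))"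
      unfolding c_def w_def by (intro sum.cong refl) (auto simp: algebra_simps)
    also have "\<dots> = 1 + (1 - 2 * v $ 0)"
      using n vv by (simp add: sum.distrib)
    finally show ?thesis by simp
  qed
  have c0: "w k = 0" if "c = 0" "k < n" for k
    using that unfolding c_def by (simp add: sum_nonneg_eq_0_iff)
  have H: "H \<in> carrier_mat n n" by (simp add: H_def)
  moreover have "H\<^sup>T = H" by (rule eq_matI) (auto simp: H_def)
  moreover have "H * H = 1\<^sub>m n"
  proof (rule eq_matI)
    fix i j assume ij: "i < dim_row (1\<^sub>m n)" "j < dim_col (1\<^sub>m n)"
    then have ij: "i < n" "j < n" by auto
    have "(H * H) $$ (i, j) = (\<Sum>k<n. ((if i = k then 1 else 0) - 2 * w i * w k / c)
        * ((if k = j then 1 else 0) - 2 * w k * w j / c))"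
      using ij by (simp add: H_def scalar_prod_def lessThan_atLeast0)
    also have "\<dots> = (\<Sum>k<n. (if i = k then (if k = j then 1 else 0) else 0)
        - (if k = i then 2 * w k * w j / c else 0) - (if k = j then 2 * w i * w k / c else 0)
        + 4 * w i * w j / c\<^sup>2 * (w k * w k))"
      by (intro sum.cong refl) (auto simp: algebra_simps power2_eq_square)
    also have "\<dots> = (if i = j then 1 else 0) - 4 * w i * w j / c
        + (\<Sum>k<n. 4 * w i * w j / c\<^sup>2 * (w k * w k))"
      using ij by (simp add: sum.distrib sum_subtractf)
    also have "(\<Sum>k<n. 4 * w i * w j / c\<^sup>2 * (w k * w k)) = 4 * w i * w j / c\<^sup>2 * c"
      unfolding c_def sum_distrib_left ..
    also have "(if i = j then 1 else 0) - 4 * w i * w j / c + 4 * w i * w j / c\<^sup>2 * c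
        = (if i = j then 1 else 0)"
      by (cases "c = 0") (auto simp: power2_eq_square)
    finally show "(H * H) $$ (i, j) = 1\<^sub>m n $$ (i, j)" using ij by simp
  qed (auto simp: H_def)
  moreover have "col H 0 = v"
  proof (rule eq_vecI)
    fix i assume "i < dim_vec v"
    then have i: "i < n" using v by simp
    show "col H 0 $ i = v $ i"
    proof (cases "c = 0")
      case True
      then show ?thesis using c0[OF True i] i n by (simp add: H_def w_def split: if_splits)
    next
      case False
      have "2 * w 0 = - c" by (simp add: w_def c)
      then have "2 * w i * w 0 = - w i * c" using mult.left_commute[of 2 "w i" "w 0"] by simp
      then have "2 * w i * w 0 / c = - w i" using False by (simp add: field_simps)
      then show ?thesis using i n by (simp add: H_def) (simp add: w_def)
    qed
  qed (use v in \<open>simp add: H_def\<close>)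
  ultimately show ?thesis by blast
qed

text \<open>Induction on the size. A reflection H with a unit eigenvector as its first column is its
  own inverse, so H A H is symmetric with first column e times the first unit vector. Symmetry
  clears the first row as well, and the induction hypothesis diagonalizes the remaining
  block.\<close>

lemma real_symmetric_diagonalizable:
  fixes A :: "real mat"
  assumes "A \<in> carrier_mat n n" and "A\<^sup>T = A"
  shows "\<exists>P es. P \<in> carrier_mat n n \<and> P\<^sup>T * P = 1\<^sub>m n \<and> length es = n \<and>
    P\<^sup>T * (A * P) = mat n n (\<lambda>(i, j). if i = j then es ! i else 0)"
  using assms
proof (induction n arbitrary: A)
  case 0
  then show ?case by (intro exI[of _ A] exI[of _ "[]"]) (auto intro!: eq_matI)
next
  case (Suc n)
  note A = Suc.prems(1) and s = Suc.prems(2)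
  obtain e z where z: "z \<in> carrier_vec (Suc n)" "z \<noteq> 0\<^sub>v (Suc n)" "A *\<^sub>v z = e \<cdot>\<^sub>v z"
    using real_symmetric_has_eigenvalue[OF A s] A unfolding eigenvalue_def eigenvector_def by auto
  have zz: "scalar_prod z z > 0" by (rule scalar_prod_self_pos[OF z(1,2)])
  define v where "v = (1 / sqrt (scalar_prod z z)) \<cdot>\<^sub>v z"
  have v: "v \<in> carrier_vec (Suc n)" "scalar_prod v v = 1" "A *\<^sub>v v = e \<cdot>\<^sub>v v"
  proof -
    show "v \<in> carrier_vec (Suc n)" using z by (simp add: v_def)
    have "sqrt (scalar_prod z z) * sqrt (scalar_prod z z) = scalar_prod z z" using zz by simp
    then show "scalar_prod v v = 1" using z zz by (simp add: v_def field_simps)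
    show "A *\<^sub>v v = e \<cdot>\<^sub>v v" using z A unfolding v_def
      by (simp add: mult_mat_vec[OF A z(1)] smult_smult_assoc mult.commute)
  qed
  obtain H where H: "H \<in> carrier_mat (Suc n) (Suc n)" "H\<^sup>T = H" "H * H = 1\<^sub>m (Suc n)" "col H 0 = v"
    using orthogonal_matrix_with_first_column[OF v(1,2)] by auto
  define B where "B = H * (A * H)"
  have B: "B \<in> carrier_mat (Suc n) (Suc n)" using A H by (simp add: B_def)
  have BT: "B\<^sup>T = B"
  proof -
    have "B\<^sup>T = (A * H)\<^sup>T * H\<^sup>T" unfolding B_def by (rule transpose_mult) (use A H in auto)
    also have "(A * H)\<^sup>T = H\<^sup>T * A\<^sup>T" by (rule transpose_mult) (use A H in auto)
    finally show ?thesis using A H s unfolding B_def by (simp add: assoc_mult_mat[of _ "Suc n" "Suc n"])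
  qed
  have Hv: "H *\<^sub>v v = unit_vec (Suc n) 0"
  proof -
    have "col (H * H) 0 = H *\<^sub>v col H 0" using H(1) by (intro col_mult2) auto
    then show ?thesis using H by simp
  qed
  have B0: "col B 0 = e \<cdot>\<^sub>v unit_vec (Suc n) 0"
  proof -
    have "col B 0 = H *\<^sub>v (A *\<^sub>v col H 0)"
      unfolding B_def col_mult2[OF H(1) mult_carrier_mat[OF A H(1)] zero_less_Suc]
        col_mult2[OF A H(1) zero_less_Suc] ..
    also have "\<dots> = e \<cdot>\<^sub>v (H *\<^sub>v v)" using H v by (simp add: mult_mat_vec)
    finally show ?thesis using Hv by simp
  qed
  have Bi0: "B $$ (i, 0) = (if i = 0 then e else 0)" if "i < Suc n" for i
    using arg_cong[OF B0, of "\<lambda>u. u $ i"] that B by auto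
  have B0j: "B $$ (0, j) = (if j = 0 then e else 0)" if "j < Suc n" for j
    using arg_cong[OF BT, of "\<lambda>C. C $$ (0, j)"] Bi0[OF that] that B by auto
  define A' where "A' = mat n n (\<lambda>(i, j). B $$ (Suc i, Suc j))"
  have A': "A' \<in> carrier_mat n n" by (simp add: A'_def)
  have A'T: "A'\<^sup>T = A'"
  proof (rule eq_matI)
    fix i j assume "i < dim_row A'" "j < dim_col A'"
    then have "i < n" "j < n" by (auto simp: A'_def)
    then show "A'\<^sup>T $$ (i, j) = A' $$ (i, j)"
      using arg_cong[OF BT, of "\<lambda>C. C $$ (Suc i, Suc j)"] B by (simp add: A'_def)
  qed (auto simp: A'_def)
  have Bblock: "B = four_block_mat (mat 1 1 (\<lambda>_. e)) (0\<^sub>m 1 n) (0\<^sub>m n 1) A'"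
    by (rule eq_matI) (use B in \<open>auto simp: A'_def Bi0 B0j\<close>)
  from Suc.IH[OF A' A'T] obtain P es where P: "P \<in> carrier_mat n n" "P\<^sup>T * P = 1\<^sub>m n" "length es = n"
    "P\<^sup>T * (A' * P) = mat n n (\<lambda>(i, j). if i = j then es ! i else 0)" by blast
  define Q where "Q = four_block_mat (1\<^sub>m 1) (0\<^sub>m 1 n) (0\<^sub>m n 1) P"
  have Q: "Q \<in> carrier_mat (Suc n) (Suc n)"
    using four_block_carrier_mat[of "1\<^sub>m 1" 1 1 P n n] P by (simp add: Q_def)
  have QT: "Q\<^sup>T = four_block_mat (1\<^sub>m 1) (0\<^sub>m 1 n) (0\<^sub>m n 1) P\<^sup>T"
    unfolding Q_def using P by (subst transpose_four_block_mat[of _ 1 1 _ n _ n]) auto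
  have QQ: "Q\<^sup>T * Q = 1\<^sub>m (Suc n)"
    unfolding QT unfolding Q_def using P
    by (subst mult_four_block_mat[of _ 1 1 _ n _ n _ _ 1 _ n]) (auto simp: P(2) intro!: eq_matI)
  have BQ: "B * Q = four_block_mat (mat 1 1 (\<lambda>_. e)) (0\<^sub>m 1 n) (0\<^sub>m n 1) (A' * P)"
    unfolding Bblock unfolding Q_def using P A'
    by (subst mult_four_block_mat[of _ 1 1 _ n _ n _ _ 1 _ n]) auto
  have QBQ: "Q\<^sup>T * (B * Q) = four_block_mat (mat 1 1 (\<lambda>_. e)) (0\<^sub>m 1 n) (0\<^sub>m n 1) (P\<^sup>T * (A' * P))"
    unfolding QT BQ using P A'
    by (subst mult_four_block_mat[of _ 1 1 _ n _ n _ _ 1 _ n]) auto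
  have diag: "Q\<^sup>T * (B * Q) = mat (Suc n) (Suc n) (\<lambda>(i, j). if i = j then (e # es) ! i else 0)"
    unfolding QBQ P(4) by (rule eq_matI) (auto simp: nth_Cons')
  have HQT: "(H * Q)\<^sup>T = Q\<^sup>T * H"
    using transpose_mult[OF H(1) Q] H(2) by simp
  have QTc: "Q\<^sup>T \<in> carrier_mat (Suc n) (Suc n)" using Q by simp
  have "(H * Q)\<^sup>T * (H * Q) = Q\<^sup>T * ((H * H) * Q)"
    unfolding HQT using H(1) Q QTc by (simp add: assoc_mult_mat[of _ "Suc n" "Suc n" _ "Suc n" _ "Suc n"])
  then have "(H * Q)\<^sup>T * (H * Q) = 1\<^sub>m (Suc n)" using H Q QQ by simp
  moreover have "(H * Q)\<^sup>T * (A * (H * Q)) = Q\<^sup>T * (B * Q)"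
    unfolding HQT B_def using H(1) Q QTc A by (simp add: assoc_mult_mat[of _ "Suc n" "Suc n" _ "Suc n" _ "Suc n"])
  ultimately show ?case
    using H(1) Q P(3) diag by (intro exI[of _ "H * Q"] exI[of _ "e # es"]) simp
qed

text \<open>A diagonalization determines the characteristic polynomial and hence the eigenvalue
  multiset, but lists the eigenvalues in arbitrary order; permuting the columns of P sorts them.
  Column i belongs to position \<open>Suc i\<close>, since columns count from 0 and eigenvalues from
  1.\<close>

lemma sorted_spectral_decomposition:
  fixes A :: "real mat"
  assumes A: "A \<in> carrier_mat n n" and s: "A\<^sup>T = A"
  shows "\<exists>P. P \<in> carrier_mat n n \<and> P\<^sup>T * P = 1\<^sub>m n \<and>
    P\<^sup>T * (A * P) = mat n n (\<lambda>(i, j). if i = j then kth_largest_eigenvalue A (Suc i) else 0)"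
    and "size (eigenvalue_mset A) = n"
    and "\<And>i j. i \<le> j \<Longrightarrow> j < n \<Longrightarrow> kth_largest_eigenvalue A (Suc j) \<le> kth_largest_eigenvalue A (Suc i)"
proof -
  obtain P es where P: "P \<in> carrier_mat n n" "P\<^sup>T * P = 1\<^sub>m n" "length es = n"
    "P\<^sup>T * (A * P) = mat n n (\<lambda>(i, j). if i = j then es ! i else 0)"
    using real_symmetric_diagonalizable[OF A s] by blast
  let ?E = "mat n n (\<lambda>(i, j). if i = j then es ! i else 0)"
  have PT: "P\<^sup>T \<in> carrier_mat n n" using P by simp
  have PP: "P * P\<^sup>T = 1\<^sub>m n" using mat_mult_left_right_inverse[OF PT P(1) P(2)] .
  have "P * ?E * P\<^sup>T = (P * P\<^sup>T) * A * (P * P\<^sup>T)"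
    unfolding P(4)[symmetric] using A P(1) PT by (simp add: assoc_mult_mat[of _ n n _ n _ n])
  then have "A = P * ?E * P\<^sup>T" unfolding PP using A by simp
  then have "similar_mat A ?E"
    using A P(1,2) PT PP by (intro similar_matI[of _ _ P "P\<^sup>T" n]) auto
  then have "char_poly A = char_poly ?E" by (rule char_poly_similar)
  also have "\<dots> = (\<Prod>a\<leftarrow>diag_mat ?E. [:- a, 1:])"
    by (rule char_poly_upper_triangular[of _ n]) auto
  also have "diag_mat ?E = es" unfolding diag_mat_def using P(3) by (intro nth_equalityI) auto
  finally have ms: "eigenvalue_mset A = mset es" by (rule eigenvalue_mset_eq[OF A])
  then show "size (eigenvalue_mset A) = n" using P(3) by simp
  define ds where "ds = rev (sorted_list_of_multiset (eigenvalue_mset A))"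
  have kth: "kth_largest_eigenvalue A (Suc i) = ds ! i" for i
    by (simp add: kth_largest_eigenvalue_def ds_def)
  have len: "length ds = n" using P(3) by (simp add: ds_def ms)
  have "sorted (rev ds)" by (simp add: ds_def)
  then show "kth_largest_eigenvalue A (Suc j) \<le> kth_largest_eigenvalue A (Suc i)"
    if "i \<le> j" "j < n" for i j
    unfolding kth using that len by (auto simp: sorted_rev_iff_nth_mono)
  have "mset ds = mset es" by (simp add: ds_def ms)
  then obtain f where f: "f permutes {..<length es}" "permute_list f es = ds"
    by (rule mset_eq_permutation)
  have fn: "f i < n" if "i < n" for i using permutes_in_image[OF f(1), of i] that P(3) by simp
  have fi: "f i = f j \<longleftrightarrow> i = j" for i j
    using permutes_inj[OF f(1)] by (auto simp: inj_def)
  have fs: "ds ! i = es ! f i" if "i < n" for i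
    using permute_list_nth[OF f(1), of i] that P(3) f(2) by simp
  define Q where "Q = mat n n (\<lambda>(i, j). P $$ (i, f j))"
  have Q: "Q \<in> carrier_mat n n" by (simp add: Q_def)
  have colQ: "col Q j = col P (f j)" if "j < n" for j
    using that P(1) fn[OF that] by (intro eq_vecI) (auto simp: Q_def)
  have "Q\<^sup>T * Q = 1\<^sub>m n"
  proof (rule eq_matI)
    fix i j assume "i < dim_row (1\<^sub>m n)" "j < dim_col (1\<^sub>m n)"
    then have ij: "i < n" "j < n" by auto
    have "(Q\<^sup>T * Q) $$ (i, j) = (P\<^sup>T * P) $$ (f i, f j)"
      using ij Q P(1) fn by (simp add: colQ)
    then show "(Q\<^sup>T * Q) $$ (i, j) = 1\<^sub>m n $$ (i, j)" using ij fn fi by (simp add: P(2))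
  qed (use Q in auto)
  moreover have "Q\<^sup>T * (A * Q) = mat n n (\<lambda>(i, j). if i = j then kth_largest_eigenvalue A (Suc i) else 0)"
  proof (rule eq_matI)
    fix i j assume "i < dim_row (mat n n (\<lambda>(i, j). if i = j then kth_largest_eigenvalue A (Suc i) else 0))"
      "j < dim_col (mat n n (\<lambda>(i, j). if i = j then kth_largest_eigenvalue A (Suc i) else 0))"
    then have ij: "i < n" "j < n" by auto
    have "(Q\<^sup>T * (A * Q)) $$ (i, j) = (P\<^sup>T * (A * P)) $$ (f i, f j)"
      using ij Q P(1) A fn by (simp add: colQ col_mult2[of _ n n _ n])
    then show "(Q\<^sup>T * (A * Q)) $$ (i, j)
        = mat n n (\<lambda>(i, j). if i = j then kth_largest_eigenvalue A (Suc i) else 0) $$ (i, j)"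
      using ij fn fi fs by (simp add: P(4) kth)
  qed (use Q in auto)
  ultimately show "\<exists>P. P \<in> carrier_mat n n \<and> P\<^sup>T * P = 1\<^sub>m n \<and>
    P\<^sup>T * (A * P) = mat n n (\<lambda>(i, j). if i = j then kth_largest_eigenvalue A (Suc i) else 0)"
    using Q by blast
qed

section \<open>Rayleigh quotients and transfer of eigenvalue bounds\<close>

lemma quadratic_form_orthogonal_change:
  fixes A :: "real mat"
  assumes A: "A \<in> carrier_mat n n" and P: "P \<in> carrier_mat n n" "P\<^sup>T * P = 1\<^sub>m n"
    and d: "P\<^sup>T * (A * P) = mat n n (\<lambda>(i, j). if i = j then d i else 0)" and y: "y \<in> carrier_vec n"
  shows "scalar_prod (P *\<^sub>v y) (A *\<^sub>v (P *\<^sub>v y)) = (\<Sum>i<n. d i * (y $ i)\<^sup>2)"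
    and "scalar_prod (P *\<^sub>v y) (P *\<^sub>v y) = (\<Sum>i<n. (y $ i)\<^sup>2)"
proof -
  have PT: "P\<^sup>T \<in> carrier_mat n n" using P by simp
  have *: "scalar_prod (P *\<^sub>v y) z = scalar_prod y (P\<^sup>T *\<^sub>v z)" if "z \<in> carrier_vec n" for z
    using transpose_vec_mult_scalar[OF PT that y] by simp
  have "scalar_prod (P *\<^sub>v y) (A *\<^sub>v (P *\<^sub>v y)) = scalar_prod y (P\<^sup>T *\<^sub>v (A *\<^sub>v (P *\<^sub>v y)))"
    using A P(1) y by (intro *) simp
  also have "P\<^sup>T *\<^sub>v (A *\<^sub>v (P *\<^sub>v y)) = (P\<^sup>T * (A * P)) *\<^sub>v y"
    using A P(1) PT y by (simp add: assoc_mult_mat_vec[of _ n n _ n])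
  also have "\<dots> = vec n (\<lambda>i. d i * y $ i)"
    unfolding d using y by (intro eq_vecI) (auto simp: scalar_prod_def if_distrib if_distribR cong: if_cong)
  also have "scalar_prod y \<dots> = (\<Sum>i<n. d i * (y $ i)\<^sup>2)"
    using y by (simp add: scalar_prod_def lessThan_atLeast0 power2_eq_square algebra_simps)
  finally show "scalar_prod (P *\<^sub>v y) (A *\<^sub>v (P *\<^sub>v y)) = (\<Sum>i<n. d i * (y $ i)\<^sup>2)" .
  have "scalar_prod (P *\<^sub>v y) (P *\<^sub>v y) = scalar_prod y (P\<^sup>T *\<^sub>v (P *\<^sub>v y))"
    using P(1) y by (intro *) simp
  also have "P\<^sup>T *\<^sub>v (P *\<^sub>v y) = y"
    using P PT y by (simp add: assoc_mult_mat_vec[of _ n n _ n, symmetric])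
  finally show "scalar_prod (P *\<^sub>v y) (P *\<^sub>v y) = (\<Sum>i<n. (y $ i)\<^sup>2)"
    using y by (simp add: scalar_prod_def lessThan_atLeast0 power2_eq_square)
qed

text \<open>A zero row added to the k x (k + 1) system makes it square and singular; a kernel vector
  is the solution.\<close>

lemma underdetermined_homogeneous_system:
  fixes a :: "nat \<Rightarrow> nat \<Rightarrow> 'a::field"
  shows "\<exists>c. (\<exists>j\<le>k. c j \<noteq> 0) \<and> (\<forall>i<k. (\<Sum>j\<le>k. a i j * c j) = 0)"
proof -
  define X where "X = mat (Suc k) (Suc k) (\<lambda>(i, j). if i < k then a i j else 0)"
  have X: "X \<in> carrier_mat (Suc k) (Suc k)" by (simp add: X_def)
  have "X = mat\<^sub>r (Suc k) (Suc k) (\<lambda>i. if i = k then 0\<^sub>v (Suc k) else row X i)"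
    by (rule eq_matI) (auto simp: X_def)
  moreover have "det \<dots> = 0" by (rule det_row_0) (auto simp: X_def)
  ultimately have "det X = 0" by simp
  then obtain v where v: "v \<in> carrier_vec (Suc k)" "v \<noteq> 0\<^sub>v (Suc k)" "X *\<^sub>v v = 0\<^sub>v (Suc k)"
    using det_0_iff_vec_prod_zero_field[OF X] by auto
  have "\<exists>j\<le>k. v $ j \<noteq> 0"
  proof (rule ccontr)
    assume "\<not> ?thesis"
    then have "v = 0\<^sub>v (Suc k)" using v(1) by (intro eq_vecI) auto
    with v(2) show False by simp
  qed
  moreover have "(\<Sum>j\<le>k. a i j * v $ j) = 0" if "i < k" for i
  proof -
    have "(X *\<^sub>v v) $ i = (\<Sum>j\<in>{0..<Suc k}. a i j * v $ j)"
      using that v(1) by (simp add: X_def scalar_prod_def del: sum.op_ivl_Suc)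
    then show ?thesis using v(3) that by (simp add: lessThan_atLeast0[symmetric] lessThan_Suc_atMost del: sum.op_ivl_Suc sum.lessThan_Suc)
  qed
  ultimately show ?thesis by blast
qed

text \<open>A trial vector in the span of the \<open>k\<close> top eigenvectors of \<open>B\<close> is chosen such that its image is
  orthogonal to the \<open>k - 1\<close> top eigenvectors of \<open>A\<close>.\<close>

lemma kth_largest_eigenvalue_transfer:
  fixes A B G :: "real mat"
  assumes A: "A \<in> carrier_mat m m" "A\<^sup>T = A" and B: "B \<in> carrier_mat n n" "B\<^sup>T = B"
    and G: "G \<in> carrier_mat m n" and k: "1 \<le> k" "k \<le> m" "k \<le> n"
    and trial: "\<And>u. u \<in> carrier_vec n \<Longrightarrow> u \<noteq> 0\<^sub>v n \<Longrightarrow>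
      kth_largest_eigenvalue B k * scalar_prod u u \<le> scalar_prod u (B *\<^sub>v u) \<Longrightarrow>
      0 < scalar_prod (G *\<^sub>v u) (G *\<^sub>v u) \<and>
      c * scalar_prod (G *\<^sub>v u) (G *\<^sub>v u) \<le> scalar_prod (G *\<^sub>v u) (A *\<^sub>v (G *\<^sub>v u))"
  shows "c \<le> kth_largest_eigenvalue A k"
proof -
  let ?\<alpha> = "\<lambda>i. kth_largest_eigenvalue A (Suc i)" and ?\<beta> = "\<lambda>i. kth_largest_eigenvalue B (Suc i)"
  obtain l where l: "k = Suc l" using k by (cases k) auto
  obtain P where P: "P \<in> carrier_mat m m" "P\<^sup>T * P = 1\<^sub>m m"
    "P\<^sup>T * (A * P) = mat m m (\<lambda>(i, j). if i = j then ?\<alpha> i else 0)"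
    using sorted_spectral_decomposition(1)[OF A] by blast
  obtain Q where Q: "Q \<in> carrier_mat n n" "Q\<^sup>T * Q = 1\<^sub>m n"
    "Q\<^sup>T * (B * Q) = mat n n (\<lambda>(i, j). if i = j then ?\<beta> i else 0)"
    using sorted_spectral_decomposition(1)[OF B] by blast
  have PT: "P\<^sup>T \<in> carrier_mat m m" using P by simp
  have PP: "P * P\<^sup>T = 1\<^sub>m m" using mat_mult_left_right_inverse[OF PT P(1) P(2)] .
  define R where "R = P\<^sup>T * (G * Q)"
  have R: "R \<in> carrier_mat m n" using PT G Q by (simp add: R_def)
  \<comment> \<open>There are l + 1 = k free coefficients against l conditions, which annihilate the
    components of the transplanted vector along the top l eigenvectors of \<open>A\<close>.\<close>
  obtain x where x: "\<exists>j\<le>l. x j \<noteq> 0" "\<forall>i<l. (\<Sum>j\<le>l. R $$ (i, j) * x j) = 0"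
    using underdetermined_homogeneous_system[of l "\<lambda>i j. R $$ (i, j)"] by blast
  define y where "y = vec n (\<lambda>j. if j \<le> l then x j else 0)"
  have y: "y \<in> carrier_vec n" by (simp add: y_def)
  define u where "u = Q *\<^sub>v y"
  have u: "u \<in> carrier_vec n" using Q y by (simp add: u_def)
  note Qf = quadratic_form_orthogonal_change[OF B(1) Q y, folded u_def]
  have "0 < scalar_prod u u"
  proof -
    obtain j where j: "j \<le> l" "x j \<noteq> 0" using x(1) by blast
    then have "j < n" "y $ j \<noteq> 0" using l k by (auto simp: y_def)
    then show ?thesis unfolding Qf(2) by (intro sum_pos2[of _ j]) auto
  qed
  then have u0: "u \<noteq> 0\<^sub>v n" by auto
  have "kth_largest_eigenvalue B k * scalar_prod u u \<le> scalar_prod u (B *\<^sub>v u)"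
    unfolding Qf sum_distrib_left
  proof (rule sum_mono)
    fix i assume "i \<in> {..<n}"
    then have i: "i < n" by simp
    show "kth_largest_eigenvalue B k * (y $ i)\<^sup>2 \<le> ?\<beta> i * (y $ i)\<^sup>2"
    proof (cases "i \<le> l")
      case True
      then show ?thesis using sorted_spectral_decomposition(3)[OF B True] l k
        by (intro mult_right_mono) auto
    qed (use i in \<open>simp add: y_def\<close>)
  qed
  note tr = trial[OF u u0 this]
  define v where "v = G *\<^sub>v u"
  have v: "v \<in> carrier_vec m" using G u by (simp add: v_def)
  define z where "z = P\<^sup>T *\<^sub>v v"
  have z: "z \<in> carrier_vec m" using PT v by (simp add: z_def)
  have vz: "v = P *\<^sub>v z"
    unfolding z_def using P(1) PT v PP by (simp add: assoc_mult_mat_vec[of _ m m _ m, symmetric])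
  have zR: "z = R *\<^sub>v y"
    unfolding z_def v_def u_def R_def using PT G Q(1) y
    by (simp add: assoc_mult_mat_vec[of _ m m _ n] assoc_mult_mat_vec[of _ m n _ n])
  have z0: "z $ i = 0" if "i < l" for i
  proof -
    have "z $ i = (\<Sum>j\<in>{..<n}. R $$ (i, j) * (if j \<le> l then x j else 0))"
      unfolding zR using R that k l by (simp add: scalar_prod_def y_def lessThan_atLeast0)
    also have "\<dots> = (\<Sum>j\<le>l. R $$ (i, j) * x j)"
      using k l by (intro sum.mono_neutral_cong_right) auto
    finally show ?thesis using x(2) that by simp
  qed
  note Pf = quadratic_form_orthogonal_change[OF A(1) P z, folded vz]
  have "scalar_prod v (A *\<^sub>v v) \<le> kth_largest_eigenvalue A k * scalar_prod v v"
    unfolding Pf sum_distrib_left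
  proof (rule sum_mono)
    fix i assume "i \<in> {..<m}"
    then have i: "i < m" by simp
    show "?\<alpha> i * (z $ i)\<^sup>2 \<le> kth_largest_eigenvalue A k * (z $ i)\<^sup>2"
    proof (cases "i < l")
      case False
      then show ?thesis using sorted_spectral_decomposition(3)[OF A, of l i] l i
        by (intro mult_right_mono) auto
    qed (simp add: z0)
  qed
  moreover have "0 < scalar_prod v v" "c * scalar_prod v v \<le> scalar_prod v (A *\<^sub>v v)"
    using tr unfolding v_def by auto
  ultimately have "c * scalar_prod v v \<le> kth_largest_eigenvalue A k * scalar_prod v v"
    by (meson order_trans)
  then show ?thesis using \<open>0 < scalar_prod v v\<close> by (rule mult_right_le_imp_le)
qed

section \<open>The spin matrix\<close>

text \<open>The spin-\<open>N/2\<close> representation of \<open>J\<^sub>x\<close>.\<close>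

definition spin_matrix :: "nat \<Rightarrow> real mat" where
  "spin_matrix N = mat (Suc N) (Suc N) (\<lambda>(i, j).
     if j = Suc i then sqrt (real (Suc i) * real (N - i)) / 2
     else if i = Suc j then sqrt (real (Suc j) * real (N - j)) / 2 else 0)"

lemma spin_matrix_carrier: "spin_matrix N \<in> carrier_mat (Suc N) (Suc N)"
  by (simp add: spin_matrix_def)

lemma spin_matrix_symmetric: "(spin_matrix N)\<^sup>T = spin_matrix N"
  by (rule eq_matI) (auto simp: spin_matrix_def)

text \<open>On polynomials of degree at most \<open>N\<close>, the operator \<open>p \<mapsto> N t p + (1 - t\<^sup>2) p'\<close> has the eigenvectors
  \<open>(1 + t)\<^sup>N\<^sup>-\<^sup>j (1 - t)\<^sup>j\<close>; in the basis \<open>t\<^sup>i\<close>, rescaled by \<open>sqrt (N choose i)\<close>, it is twice the spin matrix.\<close>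

definition kravchuk_poly :: "nat \<Rightarrow> nat \<Rightarrow> real poly" where
  "kravchuk_poly N j = [:1, 1:] ^ (N - j) * [:1, -1:] ^ j"

text \<open>Logarithmic differentiation: (1 - t^2) p' / p = (N - j) (1 - t) - j (1 + t), and adding
  N t removes the dependence on t. The auxiliary rule \<open>d\<close>, r (r^m)' = m r' r^m, avoids
  the exponent m - 1 at m = 0.\<close>

lemma kravchuk_poly_ode:
  assumes "j \<le> N"
  shows "Polynomial.smult (real N) ([:0, 1:] * kravchuk_poly N j) + [:1, 0, -1:] * pderiv (kravchuk_poly N j)
    = Polynomial.smult (real N - 2 * real j) (kravchuk_poly N j)"
proof -
  let ?p = "[:1, 1:] :: real poly" and ?q = "[:1, -1:] :: real poly"
  have factor: "[:1, 0, -1:] = ?p * ?q" by simp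
  have d: "r * pderiv (r ^ m) = Polynomial.smult (real m) (pderiv r * r ^ m)" for r :: "real poly" and m
    by (cases m) (simp_all add: pderiv_power_Suc algebra_simps del: power_Suc, simp add: algebra_simps)
  have *: "P * Polynomial.smult m (- 1 * b) * a + Q * Polynomial.smult l (1 * a) * b
      = (Polynomial.smult (- m) P + Polynomial.smult l Q) * (a * b)" for P Q a b :: "real poly" and m l
    by (simp add: algebra_simps)
  have dp: "pderiv ?p = 1" and dq: "pderiv ?q = -1" by (simp_all add: pderiv_pCons one_pCons)
  have "[:1, 0, -1:] * pderiv (kravchuk_poly N j)
      = ?p * (?q * pderiv (?q ^ j)) * ?p ^ (N - j) + ?q * (?p * pderiv (?p ^ (N - j))) * ?q ^ j"
    unfolding kravchuk_poly_def factor pderiv_mult by (simp add: algebra_simps)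
  also have "\<dots> = (Polynomial.smult (- real j) ?p + Polynomial.smult (real (N - j)) ?q) * kravchuk_poly N j"
    unfolding d dp dq kravchuk_poly_def by (rule *)
  also have "Polynomial.smult (- real j) ?p + Polynomial.smult (real (N - j)) ?q = [:real N - 2 * real j, - real N:]"
    using assms by (simp add: of_nat_diff)
  finally have *: "[:1, 0, -1:] * pderiv (kravchuk_poly N j) = [:real N - 2 * real j, - real N:] * kravchuk_poly N j" .
  have "Polynomial.smult (real N) ([:0, 1:] * kravchuk_poly N j) + [:1, 0, -1:] * pderiv (kravchuk_poly N j)
      = ([:0, real N:] + [:real N - 2 * real j, - real N:]) * kravchuk_poly N j"
    unfolding * distrib_right by simp
  also have "\<dots> = Polynomial.smult (real N - 2 * real j) (kravchuk_poly N j)" by simp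
  finally show ?thesis .
qed

lemma kravchuk_poly_nonzero: "kravchuk_poly N j \<noteq> 0"
  by (simp add: kravchuk_poly_def)

lemma degree_kravchuk_poly: "j \<le> N \<Longrightarrow> degree (kravchuk_poly N j) \<le> N"
  unfolding kravchuk_poly_def
  by (rule order_trans[OF degree_mult_le]) (simp add: degree_linear_power degree_power_eq)

text \<open>Comparison of the coefficients of t^i. The couplings i + 1 and N - i between i and i + 1
  in the two directions differ, so this tridiagonal system still has to be symmetrized.\<close>

lemma kravchuk_coeff_recurrence:
  assumes "j \<le> N"
  shows "real (Suc i) * coeff (kravchuk_poly N j) (Suc i)
      + (case i of 0 \<Rightarrow> 0 | Suc l \<Rightarrow> (real N - real l) * coeff (kravchuk_poly N j) l)
    = (real N - 2 * real j) * coeff (kravchuk_poly N j) i"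
proof -
  have q: "[:1, 0, -1:] * r = r - pCons 0 (pCons 0 r)" for r :: "real poly"
    by (rule poly_eqI) (simp add: coeff_pCons split: nat.split)
  from arg_cong[OF kravchuk_poly_ode[OF assms], of "\<lambda>p. coeff p i"]
  show ?thesis
    unfolding q by (auto simp: coeff_pderiv coeff_pCons algebra_simps split: nat.splits)
qed

lemma eigenvalue_spin_matrix:
  assumes j: "j \<le> N"
  shows "eigenvalue (spin_matrix N) (real N / 2 - real j)"
proof -
  let ?c = "coeff (kravchuk_poly N j)"
  define g where "g i = sqrt (real (N choose i))" for i
  have g0: "g i > 0" if "i \<le> N" for i using that by (simp add: g_def)
  \<comment> \<open>The ratio of g (i + 1) to g i is sqrt ((N - i) / (i + 1)), which is what
    replaces the couplings i + 1 and N - i by their geometric mean. It comes from (i + 1) (N choose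
    i + 1) = (N - i) (N choose i).\<close>
  have gS: "sqrt (real (Suc i)) * g (Suc i) = sqrt (real (N - i)) * g i" if "i < N" for i
  proof -
    have "Suc i * (N choose Suc i) = (N - i) * (N choose i)"
      using that by (metis binomial_absorb_comp binomial_absorption)
    then show ?thesis
      unfolding g_def real_sqrt_mult[symmetric] of_nat_mult[symmetric] by simp
  qed
  define v where "v = vec (Suc N) (\<lambda>i. ?c i / g i)"
  have v: "v \<in> carrier_vec (Suc N)" by (simp add: v_def)
  have v0: "v \<noteq> 0\<^sub>v (Suc N)"
  proof
    assume v0: "v = 0\<^sub>v (Suc N)"
    have "?c i = 0" for i
    proof (cases "i \<le> N")
      case True
      then show ?thesis using arg_cong[OF v0, of "\<lambda>v. v $ i"] g0[OF True] by (simp add: v_def)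
    next
      case False
      then show ?thesis using degree_kravchuk_poly[OF j] by (intro coeff_eq_0) simp
    qed
    then show False using kravchuk_poly_nonzero by (metis leading_coeff_0_iff)
  qed
  have swap: "s * (c / b) = m * c / a" if "s * a = m * b" "a > 0" "b > 0" for s a b c m :: real
  proof -
    have "s = m * b / a" using that by (simp add: field_simps)
    then show ?thesis using that by simp
  qed
  have up: "sqrt (real (Suc i) * real (N - i)) * (?c (Suc i) / g (Suc i)) = real (Suc i) * ?c (Suc i) / g i"
    if "i < N" for i
  proof -
    have "sqrt (real (Suc i) * real (N - i)) * g i = real (Suc i) * g (Suc i)"
      unfolding real_sqrt_mult using gS[OF that] by (metis mult.assoc mult.commute of_nat_0_le_iff real_sqrt_mult_self abs_of_nonneg)
    then show ?thesis using g0[of i] g0[of "Suc i"] that by (intro swap) auto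
  qed
  have down: "sqrt (real (Suc i) * real (N - i)) * (?c i / g i) = real (N - i) * ?c i / g (Suc i)"
    if "i < N" for i
  proof -
    have "sqrt (real (Suc i) * real (N - i)) * g (Suc i) = real (N - i) * g i"
      unfolding real_sqrt_mult using gS[OF that] by (metis mult.assoc mult.commute of_nat_0_le_iff real_sqrt_mult_self abs_of_nonneg)
    then show ?thesis using g0[of i] g0[of "Suc i"] that by (intro swap) auto
  qed
  have "spin_matrix N *\<^sub>v v = (real N / 2 - real j) \<cdot>\<^sub>v v"
  proof (rule eq_vecI)
    show "dim_vec (spin_matrix N *\<^sub>v v) = dim_vec ((real N / 2 - real j) \<cdot>\<^sub>v v)"
      by (simp add: spin_matrix_def v_def)
    fix i assume "i < dim_vec ((real N / 2 - real j) \<cdot>\<^sub>v v)"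
    then have i: "i \<le> N" by (simp add: v_def)
    let ?U = "if i < N then sqrt (real (Suc i) * real (N - i)) / 2 * (?c (Suc i) / g (Suc i)) else 0"
    let ?L = "case i of 0 \<Rightarrow> 0 | Suc l \<Rightarrow> sqrt (real (Suc l) * real (N - l)) / 2 * (?c l / g l)"
    have "(spin_matrix N *\<^sub>v v) $ i = (\<Sum>m\<in>{0..<Suc N}. spin_matrix N $$ (i, m) * (?c m / g m))"
      using i by (simp add: spin_matrix_def v_def scalar_prod_def del: sum.op_ivl_Suc)
    also have "\<dots> = (\<Sum>m\<in>{0..<Suc N}. (if m = Suc i then ?U else 0) + (if Suc m = i then ?L else 0))"
      using i by (intro sum.cong refl) (auto simp: spin_matrix_def split: nat.splits)
    also have "\<dots> = ?U + ?L"
      using i by (cases i) (auto simp: sum.distrib simp del: sum.op_ivl_Suc)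
    also have "?U = real (Suc i) * ?c (Suc i) / (2 * g i)"
    proof (cases "i < N")
      case True
      then have "?U = sqrt (real (Suc i) * real (N - i)) * (?c (Suc i) / g (Suc i)) / 2" by simp
      also have "\<dots> = real (Suc i) * ?c (Suc i) / (2 * g i)" unfolding up[OF True] by simp
      finally show ?thesis .
    next
      case False
      then have "?c (Suc i) = 0" using degree_kravchuk_poly[OF j] i by (intro coeff_eq_0) simp
      then show ?thesis using False by simp
    qed
    also have "?L = (case i of 0 \<Rightarrow> 0 | Suc l \<Rightarrow> (real N - real l) * ?c l) / (2 * g i)"
    proof (cases i)
      case (Suc l)
      then have l: "l < N" using i by simp
      have "?L = sqrt (real (Suc l) * real (N - l)) * (?c l / g l) / 2" using Suc by simp
      also have "\<dots> = real (N - l) * ?c l / (2 * g i)" unfolding down[OF l] Suc by simp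
      finally show ?thesis using Suc l by (simp add: of_nat_diff)
    qed simp
    also have "real (Suc i) * ?c (Suc i) / (2 * g i)
        + (case i of 0 \<Rightarrow> 0 | Suc l \<Rightarrow> (real N - real l) * ?c l) / (2 * g i)
        = (real N - 2 * real j) * ?c i / (2 * g i)"
      unfolding kravchuk_coeff_recurrence[OF j, symmetric] add_divide_distrib ..
    also have "\<dots> = (real N / 2 - real j) * (?c i / g i)" by (simp add: field_simps)
    finally show "(spin_matrix N *\<^sub>v v) $ i = ((real N / 2 - real j) \<cdot>\<^sub>v v) $ i"
      using i by (simp add: v_def)
  qed
  then show ?thesis
    using v v0 unfolding eigenvalue_def eigenvector_def by (auto simp: spin_matrix_def)
qed

text \<open>The N + 1 numbers N / 2 - j are distinct eigenvalues, and the eigenvalue multiset has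
  only N + 1 elements; so they exhaust it, each with multiplicity one.\<close>

lemma kth_largest_eigenvalue_spin_matrix:
  assumes k: "1 \<le> k" "k \<le> Suc N"
  shows "kth_largest_eigenvalue (spin_matrix N) k = real N / 2 - (real k - 1)"
proof -
  define f where "f j = real N / 2 - real j" for j
  define ms where "ms = eigenvalue_mset (spin_matrix N)"
  have size: "size ms = Suc N"
    unfolding ms_def by (rule sorted_spectral_decomposition(2)[OF spin_matrix_carrier spin_matrix_symmetric])
  have inj: "inj_on f {..N}" by (auto simp: inj_on_def f_def)
  have set: "f ` {..N} \<subseteq> set_mset ms"
  proof
    fix e assume "e \<in> f ` {..N}"
    then have e: "eigenvalue (spin_matrix N) e" using eigenvalue_spin_matrix by (auto simp: f_def)
    have p0: "char_poly (spin_matrix N) \<noteq> 0"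
      using degree_monic_char_poly[OF spin_matrix_carrier[of N]] by auto
    have fin: "finite {e. eigenvalue (spin_matrix N) e}"
      unfolding eigenvalue_root_char_poly[OF spin_matrix_carrier] by (rule poly_roots_finite[OF p0])
    have "Polynomial.order e (char_poly (spin_matrix N)) \<noteq> 0"
      using e p0 unfolding eigenvalue_root_char_poly[OF spin_matrix_carrier] by (simp add: order_root)
    then show "e \<in> set_mset ms"
      using e fin unfolding ms_def eigenvalue_mset_def by (auto simp: set_mset_sum)
  qed
  have "mset_set (f ` {..N}) \<subseteq># ms"
    using subset_imp_msubset_mset_set[OF set finite_set_mset] mset_set_set_mset_msubset[of ms]
    by (rule subset_mset.order_trans)
  then have "ms = mset_set (f ` {..N})"
    using size inj by (metis card_image card_atMost size_mset_set mset_subset_size subset_mset.le_less nat_less_le)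
  then have "ms = mset (map f [0..<Suc N])"
    using inj by (simp add: image_mset_mset_set atMost_upto lessThan_Suc_atMost atLeast0_lessThan_Suc mset_set_upto_eq_mset_upto)
  also have "\<dots> = mset (rev (map f [0..<Suc N]))" by simp
  finally have "sorted_list_of_multiset ms = sort (rev (map f [0..<Suc N]))"
    by (metis sorted_list_of_multiset_mset)
  moreover have "sorted (rev (map f [0..<Suc N]))"
    by (auto simp: sorted_rev_iff_nth_mono f_def simp del: upt_Suc)
  ultimately have "rev (sorted_list_of_multiset ms) = map f [0..<Suc N]"
    by (simp add: sorted_sort_id del: upt_Suc)
  then show ?thesis
    unfolding kth_largest_eigenvalue_def ms_def[symmetric] using k by (simp add: f_def of_nat_diff del: upt_Suc)
qed

section \<open>Comparison of the quadratic forms\<close>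

text \<open>The n-periodic extension to the integers, so that neighbours and windows of one period
  need no case distinction at the seam.\<close>

definition circ :: "nat \<Rightarrow> real vec \<Rightarrow> int \<Rightarrow> real" where
  "circ n x m = x $ nat (m mod int n)"

text \<open>Extension by zero, with index i placed at m = i - S: the centre of the interval sits
  where the circle form has its well.\<close>

definition line :: "nat \<Rightarrow> real vec \<Rightarrow> int \<Rightarrow> real" where
  "line S v m = (if \<bar>m\<bar> \<le> int S then v $ nat (m + int S) else 0)"

text \<open>Twice the entry of the spin matrix between m and m + 1, because (S + 1/2)^2 - (m +
  1/2)^2 = (S - m) (S + m + 1). It vanishes at m = S and m = - S - 1, the two edges that leave the
  interval.\<close>

definition spin_weight :: "nat \<Rightarrow> int \<Rightarrow> real" where
  "spin_weight S m = sqrt ((real S + 1/2)\<^sup>2 - (real_of_int m + 1/2)\<^sup>2)"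

lemma sum_shift_int:
  fixes f :: "int \<Rightarrow> real"
  assumes "a \<le> b" "f a = f b"
  shows "(\<Sum>m\<in>{a..<b}. f (m + 1)) = (\<Sum>m\<in>{a..<b}. f m)"
proof (cases "a = b")
  case False
  have "(\<Sum>m\<in>{a..<b}. f (m + 1)) = (\<Sum>m\<in>{a + 1..<b + 1}. f m)"
    by (rule sum.reindex_bij_witness[of _ "\<lambda>m. m - 1" "\<lambda>m. m + 1"]) auto
  also have "{a + 1..<b + 1} = insert b {a + 1..<b}" using False assms by auto
  also have "sum f (insert b {a + 1..<b}) = sum f (insert a {a + 1..<b})" using assms by simp
  also have "insert a {a + 1..<b} = {a..<b}" using False assms by auto
  finally show ?thesis .
qed simp

lemma sum_periodic_int:
  fixes f :: "int \<Rightarrow> real"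
  assumes "0 < n" "\<And>m. f (m mod n) = f m"
  shows "(\<Sum>m\<in>{a..<a + n}. f m) = (\<Sum>m\<in>{0..<n}. f m)"
proof (rule sum.reindex_bij_witness[of _ "\<lambda>m. a + (m - a) mod n" "\<lambda>m. m mod n"])
  fix m assume "m \<in> {a..<a + n}"
  then have "(m - a) mod n = m - a" by auto
  then show "a + (m mod n - a) mod n = m" by (simp add: mod_diff_left_eq)
next
  fix m assume "m \<in> {0..<n}"
  then show "(a + (m - a) mod n) mod n = m" by (simp add: mod_add_right_eq)
qed (use assms in auto)

lemma sum_int_atLeast0: "(\<Sum>m\<in>{0..<int n}. f m) = (\<Sum>j<n. f (int j))"
  by (rule sum.reindex_bij_witness[of _ int nat]) auto

lemma sum_delta_mod:
  assumes "0 < n"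
  shows "(\<Sum>j<n. f j * delta_mod n (int j - t)) = f (nat (t mod int n))"
proof -
  have "delta_mod n (int j - t) = (if j = nat (t mod int n) then 1 else 0)" if "j < n" for j
  proof -
    have "int n dvd int j - t \<longleftrightarrow> int j mod int n = t mod int n"
      by (simp add: mod_eq_dvd_iff)
    also have "int j mod int n = int j" using that by simp
    also have "int j = t mod int n \<longleftrightarrow> j = nat (t mod int n)" using assms by auto
    finally show ?thesis by (simp add: delta_mod_def)
  qed
  then have "(\<Sum>j<n. f j * delta_mod n (int j - t)) = (\<Sum>j<n. if j = nat (t mod int n) then f j else 0)"
    by (intro sum.cong) auto
  also have "\<dots> = f (nat (t mod int n))"
  proof -
    have "nat (t mod int n) < n" using assms by (simp add: nat_less_iff)
    then show ?thesis by simp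
  qed
  finally show ?thesis .
qed

lemma circ_norm:
  assumes n: "0 < n" and x: "x \<in> carrier_vec n"
  shows "scalar_prod x x = (\<Sum>m\<in>{a..<a + int n}. (circ n x m)\<^sup>2)"
proof -
  have "(\<Sum>m\<in>{a..<a + int n}. (circ n x m)\<^sup>2) = (\<Sum>m\<in>{0..<int n}. (circ n x m)\<^sup>2)"
    using n by (intro sum_periodic_int) (auto simp: circ_def)
  then show ?thesis
    using x by (simp add: sum_int_atLeast0 circ_def scalar_prod_def power2_eq_square lessThan_atLeast0)
qed

text \<open>The terms (u (m + 1) - u m)^2 / 4 sum to half of |u|^2 minus half of the sum of u m u (m
  + 1); the other half of |u|^2 combines with the cosine to (1 - cos) / 2 = sin^2. The starting
  point \<open>a\<close> of the period is free, so that the window can be aligned with the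
  interval.\<close>

lemma circ_form:
  assumes n: "0 < n" and x: "x \<in> carrier_vec n"
  shows "scalar_prod x x - scalar_prod x (M n *\<^sub>v x)
    = (\<Sum>m\<in>{a..<a + int n}. (circ n x (m + 1) - circ n x m)\<^sup>2 / 4
        + (sin (pi * real_of_int m / real n))\<^sup>2 * (circ n x m)\<^sup>2)"
proof -
  let ?U = "circ n x" and ?c = "\<lambda>m. cos (2 * pi * real_of_int m / real n)"
  have U: "?U (m mod int n) = ?U m" "?U (m mod int n + 1) = ?U (m + 1)" for m
    by (simp_all add: circ_def mod_add_left_eq)
  have c: "?c (m mod int n) = ?c m" for m
  proof -
    have "real_of_int m = real_of_int (m mod int n) + real_of_int (m div int n) * real n"
      by (metis add.commute mult.commute mod_mult_div_eq of_int_add of_int_mult of_int_of_nat_eq)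
    then have "2 * pi * real_of_int m / real n
        = 2 * pi * real_of_int (m mod int n) / real n + 2 * pi * real_of_int (m div int n)"
      using n by (simp add: field_simps)
    then show ?thesis by (simp only: cos_add cos_int_2pin sin_int_2pin mult_1_right mult_zero_right diff_zero)
  qed
  have sc: "(sin (pi * real_of_int m / real n))\<^sup>2 = (1 - ?c m) / 2" for m
    using cos_double_sin[of "pi * real_of_int m / real n"] by (simp add: mult.assoc)
  have Uj: "?U (int j) = x $ j" if "j < n" for j using that by (simp add: circ_def)
  have "scalar_prod x (M n *\<^sub>v x) = (\<Sum>j<n. \<Sum>k<n. x $ j * (M n $$ (j, k) * x $ k))"
    using x by (simp add: scalar_prod_def M_def lessThan_atLeast0 sum_distrib_left)
  also have "\<dots> = (\<Sum>k<n. \<Sum>j<n. x $ j * (M n $$ (j, k) * x $ k))" by (rule sum.swap)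
  \<comment> \<open>The two shifted deltas are summed separately, so their coincidence modulo n for
    n = 1, 2 needs no special treatment.\<close>
  also have "\<dots> = (\<Sum>k<n. ?U (int k) * (?U (int k + 1) / 4 + ?U (int k - 1) / 4 + ?c (int k) / 2 * ?U (int k)))"
  proof (intro sum.cong refl)
    fix k assume k: "k \<in> {..<n}"
    have "(\<Sum>j<n. x $ j * (M n $$ (j, k) * x $ k))
        = (\<Sum>j<n. (x $ j * delta_mod n (int j - (int k + 1)) / 4 + x $ j * delta_mod n (int j - (int k - 1)) / 4
            + ?c (int k) / 2 * (x $ j * delta_mod n (int j - int k))) * x $ k)"
      using k by (intro sum.cong refl) (simp add: M_def algebra_simps)
    also have "\<dots> = ((\<Sum>j<n. x $ j * delta_mod n (int j - (int k + 1))) / 4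
        + (\<Sum>j<n. x $ j * delta_mod n (int j - (int k - 1))) / 4
        + ?c (int k) / 2 * (\<Sum>j<n. x $ j * delta_mod n (int j - int k))) * x $ k"
      by (simp add: sum_distrib_right[symmetric] sum_distrib_left[symmetric] sum.distrib sum_divide_distrib[symmetric])
    also have "\<dots> = ?U (int k) * (?U (int k + 1) / 4 + ?U (int k - 1) / 4 + ?c (int k) / 2 * ?U (int k))"
      unfolding sum_delta_mod[OF n] using Uj k by (simp add: circ_def)
    finally show "(\<Sum>j<n. x $ j * (M n $$ (j, k) * x $ k)) = \<dots>" .
  qed
  also have "\<dots> = (\<Sum>m\<in>{0..<int n}. ?U m * ?U (m + 1) / 4 + ?U m * ?U (m - 1) / 4 + ?c m / 2 * (?U m)\<^sup>2)"
    unfolding sum_int_atLeast0 by (intro sum.cong refl) (simp add: algebra_simps power2_eq_square)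
  finally have M: "scalar_prod x (M n *\<^sub>v x) = \<dots>" .
  have per: "?U (int n) = ?U 0" "?U (int n - 1) = ?U (- 1)" "?U (int n + 1) = ?U 1"
    by (simp_all add: circ_def mod_add_left_eq[of "int n", symmetric] mod_diff_left_eq[of "int n", symmetric])
  have s1: "(\<Sum>m\<in>{0..<int n}. ?U m * ?U (m - 1)) = (\<Sum>m\<in>{0..<int n}. ?U m * ?U (m + 1))"
    using sum_shift_int[of 0 "int n" "\<lambda>m. ?U m * ?U (m - 1)"] per by (simp add: mult.commute)
  have s2: "(\<Sum>m\<in>{0..<int n}. (?U (m + 1))\<^sup>2) = (\<Sum>m\<in>{0..<int n}. (?U m)\<^sup>2)"
    using sum_shift_int[of 0 "int n" "\<lambda>m. (?U m)\<^sup>2"] per by simp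
  have "(\<Sum>m\<in>{a..<a + int n}. (?U (m + 1) - ?U m)\<^sup>2 / 4 + (sin (pi * real_of_int m / real n))\<^sup>2 * (?U m)\<^sup>2)
      = (\<Sum>m\<in>{0..<int n}. (?U (m + 1) - ?U m)\<^sup>2 / 4 + (sin (pi * real_of_int m / real n))\<^sup>2 * (?U m)\<^sup>2)"
    unfolding sc by (rule sum_periodic_int) (use n in simp, simp only: U c)
  also have "\<dots> = (\<Sum>m\<in>{0..<int n}. (?U (m + 1))\<^sup>2 / 4 + (3/4) * (?U m)\<^sup>2 - (1/2) * (?U m * ?U (m + 1))
      - ?c m / 2 * (?U m)\<^sup>2)"
    unfolding sc by (intro sum.cong refl) (simp add: power2_eq_square field_simps)
  also have "\<dots> = (\<Sum>m\<in>{0..<int n}. (?U m)\<^sup>2) - scalar_prod x (M n *\<^sub>v x)"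
    unfolding M using s1 s2
    by (simp add: sum.distrib sum_subtractf sum_distrib_left[symmetric] sum_divide_distrib[symmetric])
  also have "(\<Sum>m\<in>{0..<int n}. (?U m)\<^sup>2) = scalar_prod x x"
    using circ_norm[OF n x, of 0] by simp
  finally show ?thesis by simp
qed

lemma spin_weight_nat:
  assumes "i < 2 * S"
  shows "spin_weight S (int i - int S) = sqrt (real (Suc i) * real (2 * S - i))"
proof -
  have "(real S + 1/2)\<^sup>2 - (real_of_int (int i - int S) + 1/2)\<^sup>2 = real (Suc i) * real (2 * S - i)"
    using assms by (simp add: of_nat_diff power2_eq_square algebra_simps)
  then show ?thesis by (simp add: spin_weight_def)
qed

lemma line_norm:
  assumes v: "v \<in> carrier_vec (Suc (2 * S))"
  shows "scalar_prod v v = (\<Sum>m\<in>{- int S - 1..<int S + 1}. (line S v m)\<^sup>2)"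
proof -
  have "{- int S - 1..<int S + 1} = insert (- int S - 1) {- int S..<int S + 1}" by auto
  then have "(\<Sum>m\<in>{- int S - 1..<int S + 1}. (line S v m)\<^sup>2) = (\<Sum>m\<in>{- int S..<int S + 1}. (line S v m)\<^sup>2)"
    by (simp add: line_def)
  also have "\<dots> = (\<Sum>i<Suc (2 * S). (v $ i)\<^sup>2)"
    by (rule sum.reindex_bij_witness[of _ "\<lambda>i. int i - int S" "\<lambda>m. nat (m + int S)"]) (auto simp: line_def)
  finally show ?thesis using v by (simp add: scalar_prod_def power2_eq_square lessThan_atLeast0 del: sum.op_ivl_Suc sum.lessThan_Suc)
qed

text \<open>From b v v' = b (v^2 + v'^2 - (v' - v)^2) / 2: shifting the index in the terms v'^2
  leaves the mean of the two adjacent weights as potential. The sum starts at - S - 1 so that both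
  boundary differences occur, each with weight zero.\<close>

lemma line_form:
  assumes v: "v \<in> carrier_vec (Suc (2 * S))"
  shows "(real S + 1/2) * scalar_prod v v - scalar_prod v (spin_matrix (2 * S) *\<^sub>v v)
    = (\<Sum>m\<in>{- int S - 1..<int S + 1}. spin_weight S m / 2 * (line S v (m + 1) - line S v m)\<^sup>2
        + (real S + 1/2 - (spin_weight S m + spin_weight S (m - 1)) / 2) * (line S v m)\<^sup>2)"
proof -
  let ?V = "line S v" and ?b = "spin_weight S" and ?N = "2 * S" and ?I = "{- int S - 1..<int S + 1}"
  let ?g = "\<lambda>i. sqrt (real (Suc i) * real (?N - i))"
  have out: "?V (- int S - 1) = 0" "?V (int S + 1) = 0" by (simp_all add: line_def)
  have "scalar_prod v (spin_matrix ?N *\<^sub>v v) = (\<Sum>i\<le>?N. \<Sum>j\<le>?N. v $ i * (spin_matrix ?N $$ (i, j) * v $ j))"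
    using v by (simp add: scalar_prod_def spin_matrix_def lessThan_atLeast0[symmetric] lessThan_Suc_atMost sum_distrib_left
        del: sum.op_ivl_Suc sum.lessThan_Suc sum.atMost_Suc)
  also have "\<dots> = (\<Sum>i\<le>?N. \<Sum>j\<le>?N. (if j = Suc i then ?g i / 2 * (v $ i * v $ Suc i) else 0)
      + (if i = Suc j then ?g j / 2 * (v $ j * v $ Suc j) else 0))"
    by (intro sum.cong refl) (auto simp: spin_matrix_def)
  also have "\<dots> = (\<Sum>i\<le>?N. \<Sum>j\<le>?N. (if j = Suc i then ?g i / 2 * (v $ i * v $ Suc i) else 0))
      + (\<Sum>j\<le>?N. \<Sum>i\<le>?N. (if i = Suc j then ?g j / 2 * (v $ j * v $ Suc j) else 0))"
    unfolding sum.distrib by (subst (3) sum.swap) simp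
  also have "\<dots> = (\<Sum>i\<le>?N. if Suc i \<le> ?N then ?g i * (v $ i * v $ Suc i) else 0)"
    by (simp add: sum.distrib[symmetric] del: sum.atMost_Suc) (intro sum.cong refl, auto)
  also have "\<dots> = (\<Sum>i<?N. ?g i * (v $ i * v $ Suc i))"
    by (intro sum.mono_neutral_cong_right) auto
  also have "\<dots> = (\<Sum>m\<in>{- int S..<int S}. ?b m * (?V m * ?V (m + 1)))"
    by (rule sum.reindex_bij_witness[of _ "\<lambda>m. nat (m + int S)" "\<lambda>i. int i - int S"])
      (auto simp: line_def spin_weight_nat nat_add_distrib Suc_nat_eq_nat_zadd1 add.commute)
  also have "\<dots> = (\<Sum>m\<in>?I. ?b m * (?V m * ?V (m + 1)))"
  proof (rule sum.mono_neutral_left)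
    show "\<forall>m\<in>?I - {- int S..<int S}. ?b m * (?V m * ?V (m + 1)) = 0"
    proof
      fix m assume "m \<in> ?I - {- int S..<int S}"
      then have "m = - int S - 1 \<or> m = int S" by auto
      then show "?b m * (?V m * ?V (m + 1)) = 0" using out by auto
    qed
  qed auto
  finally have J: "scalar_prod v (spin_matrix ?N *\<^sub>v v) = (\<Sum>m\<in>?I. ?b m * (?V m * ?V (m + 1)))" .
  have sh: "(\<Sum>m\<in>?I. ?b m * (?V (m + 1))\<^sup>2) = (\<Sum>m\<in>?I. ?b (m - 1) * (?V m)\<^sup>2)"
    using sum_shift_int[of "- int S - 1" "int S + 1" "\<lambda>m. ?b (m - 1) * (?V m)\<^sup>2"] out by simp
  have "(\<Sum>m\<in>?I. ?b m / 2 * (?V (m + 1) - ?V m)\<^sup>2 + (real S + 1/2 - (?b m + ?b (m - 1)) / 2) * (?V m)\<^sup>2)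
      = (\<Sum>m\<in>?I. (1/2) * (?b m * (?V (m + 1))\<^sup>2) - (1/2) * (?b (m - 1) * (?V m)\<^sup>2)
          - ?b m * (?V m * ?V (m + 1)) + (real S + 1/2) * (?V m)\<^sup>2)"
    by (intro sum.cong refl) (simp add: power2_eq_square field_simps)
  also have "\<dots> = (real S + 1/2) * (\<Sum>m\<in>?I. (?V m)\<^sup>2) - (\<Sum>m\<in>?I. ?b m * (?V m * ?V (m + 1)))"
    unfolding sum.distrib sum_subtractf sum_distrib_left[symmetric] sh by simp
  finally show ?thesis unfolding J line_norm[OF v] by simp
qed

text \<open>The first bound is \<open>(p + q)\<^sup>2 \<le> (1 + e) p\<^sup>2 + (1 + 1/e) q\<^sup>2\<close> with \<open>p = \<chi>' (u' - u)\<close>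
  and \<open>q = (\<chi>' - \<chi>) u\<close>.\<close>

lemma cutoff_energy:
  fixes u \<chi> a b V W :: "int \<Rightarrow> real"
  assumes e: "0 < e"
    and chi: "\<And>m. 0 \<le> \<chi> m" "\<And>m. \<chi> m \<le> 1" "\<And>m. \<bar>\<chi> (m + 1) - \<chi> m\<bar> \<le> L"
    and a: "\<And>m. m \<in> T \<Longrightarrow> a m \<le> (1 + e) * b m" and b: "\<And>m. m \<in> T \<Longrightarrow> 0 \<le> b m" "\<And>m. m \<in> T \<Longrightarrow> b m \<le> B"
    and V: "\<And>m. m \<in> T \<Longrightarrow> V m \<le> (1 + e) * W m + e" "\<And>m. m \<in> T \<Longrightarrow> 0 \<le> W m"
    and small: "(1 + e) * (1 + 1 / e) * (B * L\<^sup>2) \<le> e"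
  shows "(\<Sum>m\<in>T. a m * (\<chi> (m + 1) * u (m + 1) - \<chi> m * u m)\<^sup>2 + V m * (\<chi> m * u m)\<^sup>2)
    \<le> (1 + e)\<^sup>2 * (\<Sum>m\<in>T. b m * (u (m + 1) - u m)\<^sup>2 + W m * (u m)\<^sup>2) + 2 * e * (\<Sum>m\<in>T. (u m)\<^sup>2)"
proof -
  have "a m * (\<chi> (m + 1) * u (m + 1) - \<chi> m * u m)\<^sup>2 + V m * (\<chi> m * u m)\<^sup>2
      \<le> (1 + e)\<^sup>2 * (b m * (u (m + 1) - u m)\<^sup>2 + W m * (u m)\<^sup>2) + 2 * e * (u m)\<^sup>2" if m: "m \<in> T" for m
  proof -
    define p where "p = \<chi> (m + 1) * (u (m + 1) - u m)"
    define q where "q = (\<chi> (m + 1) - \<chi> m) * u m"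
    have chi2: "(\<chi> m)\<^sup>2 \<le> 1" for m using chi(1,2) by (simp add: power_le_one)
    have p: "p\<^sup>2 \<le> (u (m + 1) - u m)\<^sup>2"
      unfolding p_def power_mult_distrib using mult_right_mono[OF chi2[of "m + 1"], of "(u (m + 1) - u m)\<^sup>2"] by simp
    have q: "q\<^sup>2 \<le> L\<^sup>2 * (u m)\<^sup>2"
      unfolding q_def power_mult_distrib
      using power_mono[OF chi(3)[of m] abs_ge_zero, of 2] by (intro mult_right_mono) auto
    have "(p + q)\<^sup>2 \<le> (1 + e) * p\<^sup>2 + (1 + 1 / e) * q\<^sup>2"
    proof -
      have "(1 + e) * p\<^sup>2 + (1 + 1 / e) * q\<^sup>2 - (p + q)\<^sup>2 = (e * p - q)\<^sup>2 / e"
        using e by (simp add: power2_eq_square field_simps)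
      moreover have "(e * p - q)\<^sup>2 / e \<ge> 0" using e by simp
      ultimately show ?thesis by linarith
    qed
    also have "\<dots> \<le> (1 + e) * (u (m + 1) - u m)\<^sup>2 + (1 + 1 / e) * (L\<^sup>2 * (u m)\<^sup>2)"
      using e p q by (intro add_mono mult_left_mono) auto
    also have "p + q = \<chi> (m + 1) * u (m + 1) - \<chi> m * u m"
      by (simp add: p_def q_def algebra_simps)
    finally have pq: "(\<chi> (m + 1) * u (m + 1) - \<chi> m * u m)\<^sup>2
        \<le> (1 + e) * (u (m + 1) - u m)\<^sup>2 + (1 + 1 / e) * (L\<^sup>2 * (u m)\<^sup>2)" .
    have "a m * (\<chi> (m + 1) * u (m + 1) - \<chi> m * u m)\<^sup>2
        \<le> (1 + e) * b m * (\<chi> (m + 1) * u (m + 1) - \<chi> m * u m)\<^sup>2"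
      using a[OF m] by (intro mult_right_mono) auto
    also have "\<dots> \<le> (1 + e) * b m * ((1 + e) * (u (m + 1) - u m)\<^sup>2 + (1 + 1 / e) * (L\<^sup>2 * (u m)\<^sup>2))"
      using pq b(1)[OF m] e by (intro mult_left_mono) auto
    also have "\<dots> = (1 + e)\<^sup>2 * (b m * (u (m + 1) - u m)\<^sup>2) + (1 + e) * (1 + 1 / e) * (b m * L\<^sup>2) * (u m)\<^sup>2"
      by (simp add: power2_eq_square algebra_simps)
    \<comment> \<open>Here the slope of the cutoff is paid for: \<open>small\<close> makes the
      contribution of \<chi> (m + 1) - \<chi> m at most e times the mass.\<close>
    also have "(1 + e) * (1 + 1 / e) * (b m * L\<^sup>2) * (u m)\<^sup>2 \<le> e * (u m)\<^sup>2"
    proof (rule mult_right_mono)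
      have "(1 + e) * (1 + 1 / e) * (b m * L\<^sup>2) \<le> (1 + e) * (1 + 1 / e) * (B * L\<^sup>2)"
        using e b(2)[OF m] by (intro mult_left_mono mult_right_mono) auto
      with small show "(1 + e) * (1 + 1 / e) * (b m * L\<^sup>2) \<le> e" by linarith
    qed simp
    finally have 1: "a m * (\<chi> (m + 1) * u (m + 1) - \<chi> m * u m)\<^sup>2
        \<le> (1 + e)\<^sup>2 * (b m * (u (m + 1) - u m)\<^sup>2) + e * (u m)\<^sup>2" by simp
    have W: "0 \<le> W m" by (rule V(2)[OF m])
    have "V m * (\<chi> m * u m)\<^sup>2 \<le> ((1 + e) * W m + e) * (\<chi> m * u m)\<^sup>2"
      using V(1)[OF m] by (intro mult_right_mono) auto
    also have "\<dots> \<le> ((1 + e) * W m + e) * (u m)\<^sup>2"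
      unfolding power_mult_distrib using mult_right_mono[OF chi2[of m], of "(u m)\<^sup>2"] W e
      by (intro mult_left_mono) auto
    also have "\<dots> \<le> ((1 + e)\<^sup>2 * W m + e) * (u m)\<^sup>2"
      using W e by (intro mult_right_mono add_mono) (auto simp: power2_eq_square mult_right_mono)
    finally have 2: "V m * (\<chi> m * u m)\<^sup>2 \<le> (1 + e)\<^sup>2 * (W m * (u m)\<^sup>2) + e * (u m)\<^sup>2"
      by (simp add: algebra_simps)
    from 1 2 show ?thesis by (simp add: algebra_simps)
  qed
  then have "(\<Sum>m\<in>T. a m * (\<chi> (m + 1) * u (m + 1) - \<chi> m * u m)\<^sup>2 + V m * (\<chi> m * u m)\<^sup>2)
    \<le> (\<Sum>m\<in>T. (1 + e)\<^sup>2 * (b m * (u (m + 1) - u m)\<^sup>2 + W m * (u m)\<^sup>2) + 2 * e * (u m)\<^sup>2)"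
    by (rule sum_mono)
  then show ?thesis unfolding sum_distrib_left sum.distrib[symmetric] .
qed

text \<open>Mass is lost only where \<chi> is not 1, and there u^2 \<le> e V u^2; so the loss is at
  most e times the potential energy.\<close>

lemma cutoff_mass:
  fixes u \<chi> V :: "int \<Rightarrow> real"
  assumes e: "0 < e" and chi: "\<And>m. 0 \<le> \<chi> m" "\<And>m. \<chi> m \<le> 1"
    and V: "\<And>m. m \<in> T \<Longrightarrow> 0 \<le> V m" "\<And>m. m \<in> T \<Longrightarrow> \<chi> m \<noteq> 1 \<Longrightarrow> 1 \<le> e * V m"
  shows "(\<Sum>m\<in>T. (u m)\<^sup>2) - e * (\<Sum>m\<in>T. V m * (u m)\<^sup>2) \<le> (\<Sum>m\<in>T. (\<chi> m * u m)\<^sup>2)"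
proof -
  have "(u m)\<^sup>2 - e * (V m * (u m)\<^sup>2) \<le> (\<chi> m * u m)\<^sup>2" if "m \<in> T" for m
  proof (cases "\<chi> m = 1")
    case True
    then show ?thesis using e V(1)[OF that] by simp
  next
    case False
    then have "(u m)\<^sup>2 * 1 \<le> (u m)\<^sup>2 * (e * V m)" using V(2)[OF that] by (intro mult_left_mono) auto
    then have "(u m)\<^sup>2 - e * (V m * (u m)\<^sup>2) \<le> 0" by (simp add: algebra_simps)
    then show ?thesis by (meson order_trans zero_le_power2)
  qed
  then have "(\<Sum>m\<in>T. (u m)\<^sup>2 - e * (V m * (u m)\<^sup>2)) \<le> (\<Sum>m\<in>T. (\<chi> m * u m)\<^sup>2)" by (rule sum_mono)
  then show ?thesis by (simp add: sum_subtractf sum_distrib_left)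
qed

definition circ_energy :: "nat \<Rightarrow> real vec \<Rightarrow> real" where
  "circ_energy n x = real n * (scalar_prod x x - scalar_prod x (M n *\<^sub>v x))"

text \<open>The k-th largest eigenvalue of the spin matrix is S - (k - 1); the constant S + 1/2 and
  the factor \<pi> turn it into the level \<pi> (k - 1/2), independent of S.\<close>

definition spin_energy :: "nat \<Rightarrow> real vec \<Rightarrow> real" where
  "spin_energy S v = pi * ((real S + 1/2) * scalar_prod v v - scalar_prod v (spin_matrix (2 * S) *\<^sub>v v))"

definition circ_potential :: "nat \<Rightarrow> int \<Rightarrow> real" where
  "circ_potential n m = real n * (sin (pi * real_of_int m / real n))\<^sup>2"

text \<open>About \<pi> m^2 / (2 S + 1) near the centre, since s - sqrt (s^2 - x^2) is about x^2 /
  (2 s) for s = S + 1/2.\<close>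

definition spin_potential :: "nat \<Rightarrow> int \<Rightarrow> real" where
  "spin_potential S m = pi * (real S + 1/2 - (spin_weight S m + spin_weight S (m - 1)) / 2)"

lemma circ_energy_eq:
  assumes "0 < n" "x \<in> carrier_vec n"
  shows "circ_energy n x = (\<Sum>m\<in>{a..<a + int n}. real n / 4 * (circ n x (m + 1) - circ n x m)\<^sup>2
    + circ_potential n m * (circ n x m)\<^sup>2)"
  unfolding circ_energy_def circ_form[OF assms, of a] circ_potential_def sum_distrib_left
  by (intro sum.cong refl) (simp add: algebra_simps)

lemma spin_energy_eq:
  assumes "v \<in> carrier_vec (Suc (2 * S))"
  shows "spin_energy S v = (\<Sum>m\<in>{- int S - 1..<int S + 1}.
    pi / 2 * spin_weight S m * (line S v (m + 1) - line S v m)\<^sup>2 + spin_potential S m * (line S v m)\<^sup>2)"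
  unfolding spin_energy_def line_form[OF assms] spin_potential_def sum_distrib_left
  by (intro sum.cong refl) (simp add: algebra_simps)

lemma spin_weight_le: "spin_weight S m \<le> real S + 1/2"
  unfolding spin_weight_def by (rule real_le_lsqrt) auto

lemma spin_weight_nonneg:
  assumes "- int S - 1 \<le> m" "m \<le> int S"
  shows "0 \<le> spin_weight S m"
proof -
  have "\<bar>real_of_int m + 1/2\<bar> \<le> \<bar>real S + 1/2\<bar>" using assms by (auto simp: abs_le_iff)
  then have "(real_of_int m + 1/2)\<^sup>2 \<le> (real S + 1/2)\<^sup>2" by (simp only: abs_le_square_iff)
  then show ?thesis by (simp add: spin_weight_def)
qed

lemma spin_potential_nonneg: "0 \<le> spin_potential S m"
  unfolding spin_potential_def using spin_weight_le[of S m] spin_weight_le[of S "m - 1"] by simp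

lemma circ_potential_nonneg: "0 \<le> circ_potential n m"
  by (simp add: circ_potential_def)

text \<open>The cosine is written with the column index alone, but for indices below n its delta is
  nonzero only on the diagonal. Transposition exchanges the two shifted deltas.\<close>

lemma M_symmetric: "(M n)\<^sup>T = M n"
proof (rule eq_matI)
  fix i j assume "i < dim_row (M n)" "j < dim_col (M n)"
  then have ij: "i < n" "j < n" by (auto simp: M_def)
  have neg: "delta_mod n (- m) = delta_mod n m" for m by (simp add: delta_mod_def)
  have "\<not> int n dvd int j - int i" if "i \<noteq> j"
  proof
    assume "int n dvd int j - int i"
    then have "int n \<le> \<bar>int j - int i\<bar>" using that by (intro zdvd_imp_le) auto
    then show False using ij by linarith
  qed
  then have "delta_mod n (int j - int i) = (if i = j then 1 else 0)"
    by (simp add: delta_mod_def)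
  moreover have "delta_mod n (int i - int j) = (if i = j then 1 else 0)"
    using calculation neg[of "int i - int j"] by simp
  moreover have "delta_mod n (int j - int i - 1) = delta_mod n (int i - int j + 1)"
    using neg[of "int j - int i - 1"] by (simp add: algebra_simps)
  moreover have "delta_mod n (int j - int i + 1) = delta_mod n (int i - int j - 1)"
    using neg[of "int j - int i + 1"] by (simp add: algebra_simps)
  ultimately show "(M n)\<^sup>T $$ (i, j) = M n $$ (i, j)" using ij by (simp add: M_def)
qed (auto simp: M_def)

lemma M_carrier: "M n \<in> carrier_mat n n" by (simp add: M_def)

section \<open>Transplanting trial vectors between the circle and the interval\<close>

text \<open>The analytic input of the comparison, with a single tolerance e. Edge m joins m and m +
  1, so {- t - 1..t} are the edges that meet [- t, t], outside of which \<chi> vanishes; weights and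
  potentials are compared only there. Wherever \<chi> is not 1, both potentials are at least 1 / e.
  By \<open>size\<close>, the interval fits on the circle with at least one site to spare.\<close>

locale spin_comparison =
  fixes n S :: nat and t :: int and e L :: real and \<chi> :: "int \<Rightarrow> real"
  assumes size: "2 * S + 2 \<le> n" and t: "0 \<le> t" "t \<le> int S" and e: "0 < e"
    and chi: "\<And>m. 0 \<le> \<chi> m" "\<And>m. \<chi> m \<le> 1" "\<And>m. \<bar>\<chi> (m + 1) - \<chi> m\<bar> \<le> L" "\<And>m. t < \<bar>m\<bar> \<Longrightarrow> \<chi> m = 0"
    and L: "(1 + e) * (1 + 1 / e) * (real n * L\<^sup>2) \<le> e"
    and weights: "\<And>m. m \<in> {- t - 1..t} \<Longrightarrow> real n / 4 \<le> (1 + e) * (pi / 2 * spin_weight S m)"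
      "\<And>m. m \<in> {- t - 1..t} \<Longrightarrow> pi / 2 * spin_weight S m \<le> (1 + e) * (real n / 4)"
      "\<And>m. m \<in> {- t - 1..t} \<Longrightarrow> pi / 2 * spin_weight S m \<le> real n"
    and potentials: "\<And>m. m \<in> {- t - 1..t} \<Longrightarrow> circ_potential n m \<le> (1 + e) * spin_potential S m + e"
      "\<And>m. m \<in> {- t - 1..t} \<Longrightarrow> spin_potential S m \<le> (1 + e) * circ_potential n m + e"
    and confining: "\<And>m. m \<in> {- int S - 1..<int n - int S - 1} \<Longrightarrow> \<chi> m \<noteq> 1 \<Longrightarrow> 1 \<le> e * circ_potential n m"
      "\<And>m. m \<in> {- int S - 1..<int S + 1} \<Longrightarrow> \<chi> m \<noteq> 1 \<Longrightarrow> 1 \<le> e * spin_potential S m"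
begin

lemma n_pos: "0 < n" using size by simp

abbreviation window where "window \<equiv> {- int S - 1..<- int S - 1 + int n}"

lemma edges_subset_window: "{- t - 1..t} \<subseteq> window"
  using t size by auto

lemma edges_subset_line: "{- t - 1..t} \<subseteq> {- int S - 1..<int S + 1}"
  using t by auto

lemma window_mod_eq_iff:
  assumes "m \<in> window" "m' \<in> window"
  shows "m mod int n = m' mod int n \<longleftrightarrow> m = m'"
proof
  assume "m mod int n = m' mod int n"
  then have "(m + int S + 1) mod int n = (m' + int S + 1) mod int n" by (metis mod_add_left_eq)
  then show "m = m'" using assms by simp
qed simp

text \<open>Multiplication by \<chi>, then placement of the interval on the circle;
  \<open>to_line\<close> is the transpose. With the cutoff built into the map, values at distance
  more than t from the centre are discarded.\<close>

definition from_line :: "real mat" where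
  "from_line = mat n (Suc (2 * S)) (\<lambda>(j, i). if (int i - int S) mod int n = int j then \<chi> (int i - int S) else 0)"

lemma from_line_carrier: "from_line \<in> carrier_mat n (Suc (2 * S))"
  by (simp add: from_line_def)

definition to_line :: "real mat" where
  "to_line = mat (Suc (2 * S)) n (\<lambda>(i, j). if (int i - int S) mod int n = int j then \<chi> (int i - int S) else 0)"

lemma to_line_carrier: "to_line \<in> carrier_mat (Suc (2 * S)) n"
  by (simp add: to_line_def)

lemma circ_from_line:
  assumes v: "v \<in> carrier_vec (Suc (2 * S))" and m: "m \<in> {- int S - 1..int n - int S - 1}"
  shows "circ n (from_line *\<^sub>v v) m = \<chi> m * line S v m"
proof -
  have *: "circ n (from_line *\<^sub>v v) m = \<chi> m * line S v m" if m: "m \<in> window" for m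
  proof -
    have lt: "nat (m mod int n) < n" using n_pos by (simp add: nat_less_iff)
    have "circ n (from_line *\<^sub>v v) m
        = (\<Sum>i\<in>{0..<Suc (2 * S)}. (if (int i - int S) mod int n = m mod int n then \<chi> (int i - int S) else 0) * v $ i)"
      using v lt n_pos by (simp add: circ_def from_line_def scalar_prod_def del: sum.op_ivl_Suc)
    also have "\<dots> = (\<Sum>i\<in>{0..<Suc (2 * S)}. (if int i - int S = m then \<chi> (int i - int S) else 0) * v $ i)"
    proof (intro sum.cong refl)
      fix i assume "i \<in> {0..<Suc (2 * S)}"
      then have "int i - int S \<in> window" using size by auto
      then show "(if (int i - int S) mod int n = m mod int n then \<chi> (int i - int S) else 0) * v $ i
          = (if int i - int S = m then \<chi> (int i - int S) else 0) * v $ i"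
        using window_mod_eq_iff[OF _ m] by simp
    qed
    also have "\<dots> = (\<Sum>i\<in>{0..<Suc (2 * S)}. if i = nat (m + int S) then \<chi> m * line S v m else 0)"
      using m by (intro sum.cong refl) (auto simp: line_def)
    also have "\<dots> = \<chi> m * line S v m"
      by (auto simp: line_def simp del: sum.op_ivl_Suc)
    finally show ?thesis .
  qed
  \<comment> \<open>The point n - S - 1 lies one step beyond the window and occurs as the right
    neighbour of its last point. Modulo n it is - S - 1, where the extended vector is zero, and
    \<chi> vanishes there too.\<close>
  show ?thesis
  proof (cases "m = int n - int S - 1")
    case True
    then have "m mod int n = (- int S - 1) mod int n"
      by (metis add.commute diff_add_eq diff_conv_add_uminus mod_add_self2 uminus_add_conv_diff)
    then have "circ n (from_line *\<^sub>v v) m = circ n (from_line *\<^sub>v v) (- int S - 1)"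
      by (simp add: circ_def)
    also have "\<dots> = 0" using n_pos by (subst *) (auto simp: line_def)
    finally show ?thesis using True chi(4)[of m] t size by simp
  qed (use * m in auto)
qed

lemma line_to_line:
  assumes v: "v \<in> carrier_vec n"
  shows "line S (to_line *\<^sub>v v) m = \<chi> m * circ n v m"
proof (cases "\<bar>m\<bar> \<le> int S")
  case True
  define i where "i = nat (m + int S)"
  have lt: "i < Suc (2 * S)" and m: "int i - int S = m" using True by (auto simp: i_def)
  have "line S (to_line *\<^sub>v v) m
      = (\<Sum>j\<in>{0..<n}. (if (int i - int S) mod int n = int j then \<chi> (int i - int S) else 0) * v $ j)"
    using v lt True by (simp add: line_def to_line_def scalar_prod_def i_def[symmetric])
  also have "\<dots> = (\<Sum>j\<in>{0..<n}. (if m mod int n = int j then \<chi> m else 0) * v $ j)"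
    unfolding m ..
  also have "\<dots> = (\<Sum>j\<in>{0..<n}. if j = nat (m mod int n) then \<chi> m * v $ j else 0)"
    using n_pos by (intro sum.cong refl) auto
  also have "\<dots> = \<chi> m * circ n v m"
    using n_pos by (simp add: circ_def nat_less_iff)
  finally show ?thesis .
next
  case False
  then show ?thesis using chi(4)[of m] t by (simp add: line_def)
qed

text \<open>Only edges that meet the support of \<chi> contribute to the energy of the image, and on
  them the coefficients are comparable. After \<open>cutoff_energy\<close> the sum for
  \<open>v\<close> is enlarged to the whole interval, all its terms being nonnegative. The second
  bound drops the kinetic energy and applies \<open>cutoff_mass\<close>.\<close>

lemma from_line_bounds:
  assumes v: "v \<in> carrier_vec (Suc (2 * S))"
  shows "circ_energy n (from_line *\<^sub>v v) \<le> (1 + e)\<^sup>2 * spin_energy S v + 2 * e * scalar_prod v v"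
    and "scalar_prod v v - e * spin_energy S v \<le> scalar_prod (from_line *\<^sub>v v) (from_line *\<^sub>v v)"
proof -
  let ?x = "from_line *\<^sub>v v" and ?u = "line S v" and ?T = "{- t - 1..t}" and ?I = "{- int S - 1..<int S + 1}"
  have x: "?x \<in> carrier_vec n" by (rule mult_mat_vec_carrier[OF from_line_carrier v])
  note U = circ_from_line[OF v]
  have "circ_energy n ?x = (\<Sum>m\<in>window. real n / 4 * (circ n ?x (m + 1) - circ n ?x m)\<^sup>2
      + circ_potential n m * (circ n ?x m)\<^sup>2)"
    by (rule circ_energy_eq[OF n_pos x])
  also have "\<dots> = (\<Sum>m\<in>window. real n / 4 * (\<chi> (m + 1) * ?u (m + 1) - \<chi> m * ?u m)\<^sup>2
      + circ_potential n m * (\<chi> m * ?u m)\<^sup>2)"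
    by (intro sum.cong refl) (simp add: U)
  also have "\<dots> = (\<Sum>m\<in>?T. real n / 4 * (\<chi> (m + 1) * ?u (m + 1) - \<chi> m * ?u m)\<^sup>2
      + circ_potential n m * (\<chi> m * ?u m)\<^sup>2)"
    using edges_subset_window by (intro sum.mono_neutral_right) (auto simp: chi(4))
  also have "\<dots> \<le> (1 + e)\<^sup>2 * (\<Sum>m\<in>?T. pi / 2 * spin_weight S m * (?u (m + 1) - ?u m)\<^sup>2 + spin_potential S m * (?u m)\<^sup>2)
      + 2 * e * (\<Sum>m\<in>?T. (?u m)\<^sup>2)"
  proof (rule cutoff_energy[where \<chi> = \<chi>, OF e chi(1-3) _ _ _ _ _ L])
    fix m assume m: "m \<in> ?T"
    show "real n / 4 \<le> (1 + e) * (pi / 2 * spin_weight S m)" by (rule weights(1)[OF m])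
    show "0 \<le> pi / 2 * spin_weight S m" using m edges_subset_line spin_weight_nonneg[of S m] by auto
    show "pi / 2 * spin_weight S m \<le> real n" by (rule weights(3)[OF m])
    show "circ_potential n m \<le> (1 + e) * spin_potential S m + e" by (rule potentials(1)[OF m])
    show "0 \<le> spin_potential S m" by (rule spin_potential_nonneg)
  qed
  also have "\<dots> \<le> (1 + e)\<^sup>2 * spin_energy S v + 2 * e * scalar_prod v v"
    unfolding spin_energy_eq[OF v] line_norm[OF v]
    using e edges_subset_line
    by (intro add_mono mult_left_mono sum_mono2)
      (auto simp: spin_potential_nonneg intro!: spin_weight_nonneg add_nonneg_nonneg mult_nonneg_nonneg)
  finally show "circ_energy n ?x \<le> (1 + e)\<^sup>2 * spin_energy S v + 2 * e * scalar_prod v v" .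
  have "scalar_prod v v - e * spin_energy S v \<le> (\<Sum>m\<in>?I. (?u m)\<^sup>2) - e * (\<Sum>m\<in>?I. spin_potential S m * (?u m)\<^sup>2)"
    unfolding spin_energy_eq[OF v] line_norm[OF v] using e
    by (intro diff_left_mono mult_left_mono sum_mono)
      (auto intro!: spin_weight_nonneg add_nonneg_nonneg mult_nonneg_nonneg)
  also have "\<dots> \<le> (\<Sum>m\<in>?I. (\<chi> m * ?u m)\<^sup>2)"
    by (intro cutoff_mass[OF e]) (auto simp: chi spin_potential_nonneg intro!: confining(2))
  also have "\<dots> = (\<Sum>m\<in>?I. (circ n ?x m)\<^sup>2)"
    using size by (intro sum.cong refl) (simp add: U)
  also have "\<dots> \<le> scalar_prod ?x ?x"
    unfolding circ_norm[OF n_pos x, of "- int S - 1"] using size by (intro sum_mono2) auto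
  finally show "scalar_prod v v - e * spin_energy S v \<le> scalar_prod ?x ?x" .
qed

text \<open>The same in the opposite direction. Mass may now also be lost on the arc outside the
  interval, so the confinement of the circle potential is used on a full period.\<close>

lemma to_line_bounds:
  assumes v: "v \<in> carrier_vec n"
  shows "spin_energy S (to_line *\<^sub>v v) \<le> (1 + e)\<^sup>2 * circ_energy n v + 2 * e * scalar_prod v v"
    and "scalar_prod v v - e * circ_energy n v \<le> scalar_prod (to_line *\<^sub>v v) (to_line *\<^sub>v v)"
proof -
  let ?x = "to_line *\<^sub>v v" and ?u = "circ n v" and ?T = "{- t - 1..t}" and ?I = "{- int S - 1..<int S + 1}"
  have x: "?x \<in> carrier_vec (Suc (2 * S))" by (rule mult_mat_vec_carrier[OF to_line_carrier v])
  note U = line_to_line[OF v]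
  note circ_eqs = circ_energy_eq[OF n_pos v, of "- int S - 1"] circ_norm[OF n_pos v, of "- int S - 1"]
  have "spin_energy S ?x = (\<Sum>m\<in>?I. pi / 2 * spin_weight S m * (\<chi> (m + 1) * ?u (m + 1) - \<chi> m * ?u m)\<^sup>2
      + spin_potential S m * (\<chi> m * ?u m)\<^sup>2)"
    unfolding spin_energy_eq[OF x] U ..
  also have "\<dots> = (\<Sum>m\<in>?T. pi / 2 * spin_weight S m * (\<chi> (m + 1) * ?u (m + 1) - \<chi> m * ?u m)\<^sup>2
      + spin_potential S m * (\<chi> m * ?u m)\<^sup>2)"
    using edges_subset_line by (intro sum.mono_neutral_right) (auto simp: chi(4))
  also have "\<dots> \<le> (1 + e)\<^sup>2 * (\<Sum>m\<in>?T. real n / 4 * (?u (m + 1) - ?u m)\<^sup>2 + circ_potential n m * (?u m)\<^sup>2)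
      + 2 * e * (\<Sum>m\<in>?T. (?u m)\<^sup>2)"
    by (intro cutoff_energy[where \<chi> = \<chi> and u = ?u and a = "\<lambda>m. pi / 2 * spin_weight S m" and b = "\<lambda>_. real n / 4"
          and V = "spin_potential S" and W = "circ_potential n", OF e chi(1-3) _ _ _ _ _ L])
      (auto simp: weights potentials circ_potential_nonneg simp del: times_divide_eq_left times_divide_eq_right)
  also have "\<dots> \<le> (1 + e)\<^sup>2 * circ_energy n v + 2 * e * scalar_prod v v"
    unfolding circ_eqs using e edges_subset_window
    by (intro add_mono mult_left_mono sum_mono2)
      (auto simp: circ_potential_nonneg intro!: add_nonneg_nonneg mult_nonneg_nonneg)
  finally show "spin_energy S ?x \<le> (1 + e)\<^sup>2 * circ_energy n v + 2 * e * scalar_prod v v" .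
  have "scalar_prod v v - e * circ_energy n v
      \<le> (\<Sum>m\<in>window. (?u m)\<^sup>2) - e * (\<Sum>m\<in>window. circ_potential n m * (?u m)\<^sup>2)"
    unfolding circ_eqs using e
    by (intro diff_left_mono mult_left_mono sum_mono) (auto intro!: mult_nonneg_nonneg)
  also have "\<dots> \<le> (\<Sum>m\<in>window. (\<chi> m * ?u m)\<^sup>2)"
    by (intro cutoff_mass[OF e]) (auto simp: chi circ_potential_nonneg intro!: confining(1))
  also have "\<dots> = (\<Sum>m\<in>?I. (\<chi> m * ?u m)\<^sup>2)"
    using size t by (intro sum.mono_neutral_right) (auto simp: chi(4))
  also have "\<dots> = scalar_prod ?x ?x"
    unfolding line_norm[OF x] U ..
  finally show "scalar_prod v v - e * circ_energy n v \<le> scalar_prod ?x ?x" .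
qed

text \<open>Bookkeeping for one trial vector: p and N are energy and squared norm before the
  transplantation, q and N' after it. If p \<le> \<nu> N, the image keeps at least the fraction 1 -
  e \<nu> of the mass, which is the denominator of the new bound for the Rayleigh quotient.\<close>

lemma cutoff_trial:
  fixes q p N N' \<nu> :: real
  assumes "q \<le> (1 + e)\<^sup>2 * p + 2 * e * N" "N - e * p \<le> N'" "p \<le> \<nu> * N" "0 < N" "0 \<le> \<nu>" "e * \<nu> < 1"
  shows "0 < N'" "q \<le> ((1 + e)\<^sup>2 * \<nu> + 2 * e) / (1 - e * \<nu>) * N'"
proof -
  have "e * p \<le> e * (\<nu> * N)" using assms(3) e by simp
  then have N': "(1 - e * \<nu>) * N \<le> N'" using assms(2) by (simp add: algebra_simps)
  then show "0 < N'" using assms(4,6) by (meson diff_gt_0_iff_gt less_le_trans mult_pos_pos)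
  have "(1 + e)\<^sup>2 * p \<le> (1 + e)\<^sup>2 * (\<nu> * N)" using assms(3) by (intro mult_left_mono) auto
  then have "q \<le> ((1 + e)\<^sup>2 * \<nu> + 2 * e) * N" using assms(1) by (simp add: algebra_simps)
  also have "\<dots> = ((1 + e)\<^sup>2 * \<nu> + 2 * e) / (1 - e * \<nu>) * ((1 - e * \<nu>) * N)"
    using assms(6) by simp
  also have "\<dots> \<le> ((1 + e)\<^sup>2 * \<nu> + 2 * e) / (1 - e * \<nu>) * N'"
    using N' assms(5,6) e by (intro mult_left_mono) auto
  finally show "q \<le> ((1 + e)\<^sup>2 * \<nu> + 2 * e) / (1 - e * \<nu>) * N'" .
qed

text \<open>The trial vectors come from the top k eigenvectors of the spin matrix, with energy at
  most \<pi> (k - 1/2) per unit mass. An upper bound for the energy level is a lower bound for the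
  eigenvalue of \<open>M n\<close>.\<close>

lemma kth_largest_eigenvalue_M_lower:
  assumes k: "1 \<le> k" "k \<le> Suc (2 * S)" and \<nu>: "(2 * real k - 1) * pi / 2 \<le> \<nu>" "0 \<le> \<nu>" "e * \<nu> < 1"
  shows "real n * (1 - kth_largest_eigenvalue (M n) k) \<le> ((1 + e)\<^sup>2 * \<nu> + 2 * e) / (1 - e * \<nu>)"
proof -
  define C where "C = ((1 + e)\<^sup>2 * \<nu> + 2 * e) / (1 - e * \<nu>)"
  have "1 - C / real n \<le> kth_largest_eigenvalue (M n) k"
  proof (rule kth_largest_eigenvalue_transfer[OF M_carrier M_symmetric spin_matrix_carrier spin_matrix_symmetric])
    show "from_line \<in> carrier_mat n (Suc (2 * S))" by (rule from_line_carrier)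
    show "1 \<le> k" "k \<le> Suc (2 * S)" "k \<le> n" using k size by auto
    fix u :: "real vec" assume u: "u \<in> carrier_vec (Suc (2 * S))" "u \<noteq> 0\<^sub>v (Suc (2 * S))"
      and low: "kth_largest_eigenvalue (spin_matrix (2 * S)) k * scalar_prod u u
        \<le> scalar_prod u (spin_matrix (2 * S) *\<^sub>v u)"
    have N: "0 < scalar_prod u u" by (rule scalar_prod_self_pos[OF u])
    have "spin_energy S u \<le> pi * ((real S + 1/2) * scalar_prod u u - (real S - (real k - 1)) * scalar_prod u u)"
      unfolding spin_energy_def using low k by (simp add: kth_largest_eigenvalue_spin_matrix)
    also have "\<dots> = (2 * real k - 1) * pi / 2 * scalar_prod u u" by (simp add: field_simps)
    also have "\<dots> \<le> \<nu> * scalar_prod u u" using \<nu>(1) N by (intro mult_right_mono) auto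
    finally have en: "spin_energy S u \<le> \<nu> * scalar_prod u u" .
    note tr = cutoff_trial[OF from_line_bounds[OF u(1)] en N \<nu>(2,3), folded C_def]
    show "0 < scalar_prod (from_line *\<^sub>v u) (from_line *\<^sub>v u) \<and>
      (1 - C / real n) * scalar_prod (from_line *\<^sub>v u) (from_line *\<^sub>v u)
        \<le> scalar_prod (from_line *\<^sub>v u) (M n *\<^sub>v (from_line *\<^sub>v u))"
      using tr n_pos unfolding circ_energy_def by (simp add: field_simps)
  qed
  then show ?thesis using n_pos unfolding C_def[symmetric] by (simp add: field_simps)
qed

text \<open>Now the trial vectors come from the circle, and \<nu> is an assumed bound for the energy
  level of \<open>M n\<close>. The conclusion involves explicit numbers only; by contraposition it
  bounds the level from below.\<close>

lemma kth_largest_eigenvalue_M_upper: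
  assumes k: "1 \<le> k" "k \<le> Suc (2 * S)"
    and \<nu>: "real n * (1 - kth_largest_eigenvalue (M n) k) \<le> \<nu>" "0 \<le> \<nu>" "e * \<nu> < 1"
  shows "(2 * real k - 1) * pi / 2 \<le> ((1 + e)\<^sup>2 * \<nu> + 2 * e) / (1 - e * \<nu>)"
proof -
  define C where "C = ((1 + e)\<^sup>2 * \<nu> + 2 * e) / (1 - e * \<nu>)"
  have "real S + 1/2 - C / pi \<le> kth_largest_eigenvalue (spin_matrix (2 * S)) k"
  proof (rule kth_largest_eigenvalue_transfer[OF spin_matrix_carrier spin_matrix_symmetric M_carrier M_symmetric])
    show "to_line \<in> carrier_mat (Suc (2 * S)) n" by (rule to_line_carrier)
    show "1 \<le> k" "k \<le> Suc (2 * S)" "k \<le> n" using k size by auto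
    fix u :: "real vec" assume u: "u \<in> carrier_vec n" "u \<noteq> 0\<^sub>v n"
      and low: "kth_largest_eigenvalue (M n) k * scalar_prod u u \<le> scalar_prod u (M n *\<^sub>v u)"
    have N: "0 < scalar_prod u u" by (rule scalar_prod_self_pos[OF u])
    have "circ_energy n u \<le> real n * (scalar_prod u u - kth_largest_eigenvalue (M n) k * scalar_prod u u)"
      unfolding circ_energy_def using low by (intro mult_left_mono) auto
    also have "\<dots> = real n * (1 - kth_largest_eigenvalue (M n) k) * scalar_prod u u" by (simp add: algebra_simps)
    also have "\<dots> \<le> \<nu> * scalar_prod u u" using \<nu>(1) N by (intro mult_right_mono) auto
    finally have en: "circ_energy n u \<le> \<nu> * scalar_prod u u" .
    note tr = cutoff_trial[OF to_line_bounds[OF u(1)] en N \<nu>(2,3), folded C_def]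
    show "0 < scalar_prod (to_line *\<^sub>v u) (to_line *\<^sub>v u) \<and>
      (real S + 1/2 - C / pi) * scalar_prod (to_line *\<^sub>v u) (to_line *\<^sub>v u)
        \<le> scalar_prod (to_line *\<^sub>v u) (spin_matrix (2 * S) *\<^sub>v (to_line *\<^sub>v u))"
      using tr unfolding spin_energy_def by (simp add: field_simps)
  qed
  then show ?thesis using k unfolding C_def[symmetric] by (simp add: kth_largest_eigenvalue_spin_matrix field_simps)
qed

end

section \<open>Asymptotics of the eigenvalues\<close>

text \<open>Keeps the circle potential large on both sides: the next copy of the well sits at y =
  \<pi>.\<close>

lemma sin_ge_sin_between:
  assumes "0 \<le> a" "a \<le> pi / 2" "a \<le> y" "y \<le> pi - a"
  shows "sin a \<le> sin y"
proof (cases "y \<le> pi / 2")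
  case True
  then show ?thesis using assms by (intro sin_monotone_2pi_le) auto
next
  case False
  then have "sin a \<le> sin (pi - y)" using assms by (intro sin_monotone_2pi_le) auto
  then show ?thesis by simp
qed

text \<open>Squaring gives sqrt (s^2 - x^2) \<le> s - x^2 / (2 s) as long as the right side is
  nonnegative, and the mean of (m + 1/2)^2 and (m - 1/2)^2 is m^2 + 1/4. The bound holds on the
  whole interval, so it also yields the confinement.\<close>

lemma spin_potential_lower:
  assumes S: "3 \<le> S" and m: "\<bar>m\<bar> \<le> int S + 1"
  shows "pi * (real_of_int m)\<^sup>2 / (2 * (real S + 1/2)) \<le> spin_potential S m"
proof -
  define s where "s = real S + 1/2"
  have s: "3 \<le> s" using S by (simp add: s_def)
  have b: "sqrt (s\<^sup>2 - x\<^sup>2) \<le> s - x\<^sup>2 / (2 * s)" if x: "\<bar>x\<bar> \<le> s + 1" for x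
  proof (rule real_le_lsqrt)
    \<comment> \<open>The right side is nonnegative if x^2 \<le> 2 s^2; with |x| up to s + 1 this is
      where s \<ge> 3 enters.\<close>
    have "x\<^sup>2 \<le> (s + 1)\<^sup>2" using power_mono[OF x abs_ge_zero, of 2] by simp
    also have "\<dots> \<le> 2 * s\<^sup>2"
    proof -
      have "3 * s \<le> s * s" using s by (intro mult_right_mono) auto
      moreover have "(s + 1)\<^sup>2 = s * s + 2 * s + 1" "2 * s\<^sup>2 = 2 * (s * s)" by (simp_all add: power2_eq_square algebra_simps)
      ultimately show ?thesis using s by linarith
    qed
    finally have "x\<^sup>2 / (2 * s) \<le> s" using s by (simp add: divide_le_eq power2_eq_square)
    then show "0 \<le> s - x\<^sup>2 / (2 * s)" by simp
    have "(s - x\<^sup>2 / (2 * s))\<^sup>2 = s\<^sup>2 - x\<^sup>2 + (x\<^sup>2 / (2 * s))\<^sup>2"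
      using s by (simp add: power2_diff)
    then show "s\<^sup>2 - x\<^sup>2 \<le> (s - x\<^sup>2 / (2 * s))\<^sup>2" by simp
  qed
  have avg: "(p + q) / 2 \<le> s - (a + b) / 2" if "a \<le> s - p" "b \<le> s - q" for a b p q :: real
    using that by (simp add: field_simps)
  have mr: "\<bar>real_of_int m\<bar> \<le> s + 1/2" using m unfolding s_def by linarith
  have "sqrt (s\<^sup>2 - (real_of_int m + 1/2)\<^sup>2) \<le> s - (real_of_int m + 1/2)\<^sup>2 / (2 * s)"
    by (rule b) (use mr in linarith)
  moreover have "sqrt (s\<^sup>2 - (real_of_int (m - 1) + 1/2)\<^sup>2) \<le> s - (real_of_int (m - 1) + 1/2)\<^sup>2 / (2 * s)"
  proof (rule b)
    have "real_of_int (m - 1) = real_of_int m - 1" by simp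
    then show "\<bar>real_of_int (m - 1) + 1/2\<bar> \<le> s + 1" using mr by linarith
  qed
  ultimately have "((real_of_int m + 1/2)\<^sup>2 / (2 * s) + (real_of_int (m - 1) + 1/2)\<^sup>2 / (2 * s)) / 2
      \<le> s - (spin_weight S m + spin_weight S (m - 1)) / 2"
    unfolding spin_weight_def s_def[symmetric] by (rule avg)
  moreover have "(real_of_int m)\<^sup>2 / (2 * s) \<le> ((real_of_int m + 1/2)\<^sup>2 / (2 * s) + (real_of_int (m - 1) + 1/2)\<^sup>2 / (2 * s)) / 2"
  proof -
    have "((real_of_int m + 1/2)\<^sup>2 / (2 * s) + (real_of_int (m - 1) + 1/2)\<^sup>2 / (2 * s)) / 2
        = ((real_of_int m + 1/2)\<^sup>2 + (real_of_int (m - 1) + 1/2)\<^sup>2) / 2 / (2 * s)"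
      by (simp add: add_divide_distrib)
    also have "((real_of_int m + 1/2)\<^sup>2 + (real_of_int (m - 1) + 1/2)\<^sup>2) / 2 = (real_of_int m)\<^sup>2 + 1/4"
      by (simp add: power2_eq_square field_simps)
    also have "((real_of_int m)\<^sup>2 + 1/4) / (2 * s) \<ge> (real_of_int m)\<^sup>2 / (2 * s)"
      using s by (intro divide_right_mono) auto
    finally show ?thesis .
  qed
  ultimately have "(real_of_int m)\<^sup>2 / (2 * s) \<le> s - (spin_weight S m + spin_weight S (m - 1)) / 2"
    by (rule order_trans[rotated])
  then have "pi * ((real_of_int m)\<^sup>2 / (2 * s)) \<le> pi * (s - (spin_weight S m + spin_weight S (m - 1)) / 2)"
    by (intro mult_left_mono) auto
  then show ?thesis unfolding spin_potential_def s_def by simp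
qed

text \<open>\<theta> is the accuracy of each local approximation, and (1 + e) \<theta>^3 \<ge> 1
  lets e absorb three of them: for the weight, for the rounding in S, and for sin y against y. The
  cutoff is a trapezoid, 1 up to \<delta> n and 0 beyond 2 \<delta> n. In their order, the
  thresholds for n give room for index shifts, bring 2 \<pi> (S + 1/2) / n close to 1, pay for the
  slope, absorb the 1/4 in the spin potential, confine on the circle, confine on the interval, and
  exclude small sizes.\<close>

lemma spin_comparison_large:
  fixes n :: nat and e \<theta> \<delta> y0 :: real
  defines "S \<equiv> nat \<lfloor>real n / (2 * pi)\<rfloor>"
    and "\<chi> \<equiv> (\<lambda>m::int. max 0 (min 1 (2 - \<bar>real_of_int m\<bar> / (\<delta> * real n))))"
  assumes e: "0 < e" and \<theta>: "1/2 \<le> \<theta>" "\<theta> < 1" "1 \<le> (1 + e) * \<theta> ^ 3"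
    and y0: "\<And>y. \<bar>y\<bar> \<le> y0 \<Longrightarrow> \<theta> * y\<^sup>2 \<le> (sin y)\<^sup>2"
    and \<delta>: "0 < \<delta>" "3 * pi * \<delta> \<le> y0" "(6 * pi * \<delta> / \<theta>)\<^sup>2 \<le> 1 - \<theta>\<^sup>2" "\<delta> \<le> 1/2"
    and n: "2 / \<delta> \<le> real n" "pi / (1 - \<theta>) \<le> real n" "(1 + e) * (1 + 1 / e) / (e * \<delta>\<^sup>2) \<le> real n"
      "pi\<^sup>2 / (4 * \<theta>\<^sup>2 * e) \<le> real n" "1 / (e * (sin (pi * \<delta>))\<^sup>2) \<le> real n" "1 / (e * \<theta> * pi\<^sup>2 * \<delta>\<^sup>2) \<le> real n" "32 \<le> n"
  shows "spin_comparison n S \<lfloor>2 * \<delta> * real n\<rfloor> e (1 / (\<delta> * real n)) \<chi>"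
proof -
  define s where "s = real S + 1/2"
  define t where "t = \<lfloor>2 * \<delta> * real n\<rfloor>"
  \<comment> \<open>The ratio of \<pi> s / 2 to n / 4, that is, the error made by rounding n / (2
    \<pi>).\<close>
  define \<sigma> where "\<sigma> = 2 * pi * s / real n"
  \<comment> \<open>Chosen so that 3 \<delta> n \<le> \<tau> s: it bounds the relative distance from
    the centre, and \<tau>^2 \<le> 1 - \<theta>^2 then gives sqrt (s^2 - x^2) \<ge> \<theta>
    s.\<close>
  define \<tau> where "\<tau> = 6 * pi * \<delta> / \<theta>"
  have n0: "0 < real n" using n(7) by simp
  have \<delta>n: "2 \<le> \<delta> * real n" using n(1) \<delta>(1) by (simp add: divide_le_eq mult.commute)
  have Sb: "real n / (2 * pi) - 1 < real S" "real S \<le> real n / (2 * pi)"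
  proof -
    have "real S = real_of_int \<lfloor>real n / (2 * pi)\<rfloor>" by (simp add: S_def)
    then show "real n / (2 * pi) - 1 < real S" "real S \<le> real n / (2 * pi)" by linarith+
  qed
  have \<sigma>: "\<theta> \<le> \<sigma>" "\<sigma> * \<theta> \<le> 1"
  proof -
    have pn: "pi / real n \<le> 1 - \<theta>" using n(2) \<theta>(2) n0 by (simp add: field_simps)
    have "real n / (2 * pi) - 1/2 \<le> s" "s \<le> real n / (2 * pi) + 1/2" using Sb unfolding s_def by linarith+
    then have "real n - pi \<le> 2 * pi * s" "2 * pi * s \<le> real n + pi"
      by (simp_all add: field_simps)
    then have "(real n - pi) / real n \<le> \<sigma>" "\<sigma> \<le> (real n + pi) / real n"
      unfolding \<sigma>_def by (intro divide_right_mono; simp)+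
    then have "1 - pi / real n \<le> \<sigma>" "\<sigma> \<le> 1 + pi / real n"
      using n0 by (simp_all add: diff_divide_distrib add_divide_distrib)
    with pn show "\<theta> \<le> \<sigma>" by linarith
    have "\<sigma> \<le> 2 - \<theta>" using pn \<open>\<sigma> \<le> 1 + pi / real n\<close> by linarith
    then have "\<sigma> * \<theta> \<le> (2 - \<theta>) * \<theta>" using \<theta>(1) by (intro mult_right_mono) auto
    also have "\<dots> \<le> 1" using zero_le_power2[of "1 - \<theta>"] by (simp add: power2_eq_square algebra_simps)
    finally show "\<sigma> * \<theta> \<le> 1" .
  qed
  have s_eq: "2 * pi * s = \<sigma> * real n" using n0 by (simp add: \<sigma>_def)
  have S3: "3 \<le> S"
  proof -
    have "4 < real n / (2 * pi)" using n(7) pi_less_4 by (simp add: field_simps)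
    then show ?thesis using Sb(1) by linarith
  qed
  have s0: "3 \<le> s" using S3 by (simp add: s_def)
  have \<tau>: "0 \<le> \<tau>" "\<tau>\<^sup>2 \<le> 1 - \<theta>\<^sup>2" "\<tau> \<le> 1" "3 * \<delta> * real n \<le> \<tau> * s"
  proof -
    show "0 \<le> \<tau>" using \<delta>(1) \<theta>(1) by (simp add: \<tau>_def)
    show *: "\<tau>\<^sup>2 \<le> 1 - \<theta>\<^sup>2" using \<delta>(3) by (simp add: \<tau>_def)
    then have "\<tau>\<^sup>2 \<le> 1" by (smt (verit) zero_le_power2)
    then show "\<tau> \<le> 1" using power2_le_imp_le[of \<tau> 1] by simp
    have "\<theta> * (3 * \<delta> * real n) \<le> \<sigma> * (3 * \<delta> * real n)" using \<sigma>(1) \<delta>(1) by (intro mult_right_mono) auto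
    also have "\<dots> = 3 * \<delta> * (2 * pi * s)" unfolding s_eq by simp
    finally show "3 * \<delta> * real n \<le> \<tau> * s" using \<theta>(1) unfolding \<tau>_def by (simp add: field_simps)
  qed
  have small_s: "3 * \<delta> * real n \<le> s"
    using \<tau>(3,4) s0 mult_right_mono[of \<tau> 1 s] by linarith
  have t: "0 \<le> t" "t \<le> int S" "real_of_int t \<le> 2 * \<delta> * real n"
  proof -
    show "0 \<le> t" using \<delta>(1) by (simp add: t_def)
    show tt: "real_of_int t \<le> 2 * \<delta> * real n" by (simp add: t_def)
    then have "real_of_int t + 2 \<le> s" using small_s \<delta>n by linarith
    then show "t \<le> int S" unfolding s_def by linarith
  qed
  have size: "2 * S + 2 \<le> n"
  proof -
    have "real n / (2 * pi) \<le> real n / 4" using pi_ge_two n0 by (simp add: field_simps)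
    then have "real (2 * S + 2) \<le> real n" using Sb(2) n(7) by simp
    then show ?thesis by linarith
  qed
  have wl: "\<theta> * s \<le> spin_weight S m" if "\<bar>real_of_int m + 1/2\<bar> \<le> 3 * \<delta> * real n" for m
  proof -
    have "\<bar>real_of_int m + 1/2\<bar> \<le> \<tau> * s" using that \<tau>(4) by linarith
    then have "(real_of_int m + 1/2)\<^sup>2 \<le> \<tau>\<^sup>2 * s\<^sup>2"
      using power_mono[of "\<bar>real_of_int m + 1/2\<bar>" "\<tau> * s" 2] by (simp add: power_mult_distrib)
    also have "\<dots> \<le> (1 - \<theta>\<^sup>2) * s\<^sup>2" using \<tau>(2) by (intro mult_right_mono) auto
    finally have "(\<theta> * s)\<^sup>2 \<le> s\<^sup>2 - (real_of_int m + 1/2)\<^sup>2" by (simp add: power_mult_distrib algebra_simps)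
    then show ?thesis unfolding spin_weight_def s_def[symmetric] by (rule real_le_rsqrt)
  qed
  \<comment> \<open>Edges reach out to 2 \<delta> n + 1 and the half-integer shifts add at most 1/2;
    the margin up to 3 \<delta> n covers this because \<delta> n \<ge> 2.\<close>
  have edge: "\<bar>real_of_int m + 1/2\<bar> \<le> 3 * \<delta> * real n" "\<bar>real_of_int (m - 1) + 1/2\<bar> \<le> 3 * \<delta> * real n"
    "\<bar>real_of_int m\<bar> \<le> 3 * \<delta> * real n" "\<bar>m\<bar> \<le> int S + 1"
    if m: "m \<in> {- t - 1..t}" for m
  proof -
    have "- real_of_int t - 1 \<le> real_of_int m" "real_of_int m \<le> real_of_int t"
      using m by (metis (mono_tags) atLeastAtMost_iff of_int_1 of_int_diff of_int_le_iff of_int_minus)+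
    then have *: "- (2 * \<delta> * real n) - 1 \<le> real_of_int m" "real_of_int m \<le> 2 * \<delta> * real n"
      "real_of_int (m - 1) = real_of_int m - 1"
      using t(3) by auto
    show "\<bar>real_of_int m + 1/2\<bar> \<le> 3 * \<delta> * real n" using * \<delta>n by linarith
    show "\<bar>real_of_int (m - 1) + 1/2\<bar> \<le> 3 * \<delta> * real n" using * \<delta>n by linarith
    show "\<bar>real_of_int m\<bar> \<le> 3 * \<delta> * real n" using * \<delta>n by linarith
    show "\<bar>m\<bar> \<le> int S + 1" using m t by auto
  qed
  have e\<theta>: "1 \<le> (1 + e) * \<theta>" "1 \<le> (1 + e) * \<theta>\<^sup>2"
  proof -
    have "\<theta> ^ 3 \<le> \<theta> ^ 2" "\<theta> ^ 3 \<le> \<theta> ^ 1" using \<theta> by (intro power_decreasing; simp)+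
    then have "(1 + e) * \<theta> ^ 3 \<le> (1 + e) * \<theta>\<^sup>2" "(1 + e) * \<theta> ^ 3 \<le> (1 + e) * \<theta>"
      using e by (auto intro!: mult_left_mono)
    with \<theta>(3) show "1 \<le> (1 + e) * \<theta>" "1 \<le> (1 + e) * \<theta>\<^sup>2" by linarith+
  qed
  have pot_lower: "\<theta> * (pi\<^sup>2 * (real_of_int m)\<^sup>2 / real n) \<le> spin_potential S m" if "\<bar>m\<bar> \<le> int S + 1" for m
  proof -
    have "\<theta> * (pi\<^sup>2 * (real_of_int m)\<^sup>2 / real n) \<le> pi * (real_of_int m)\<^sup>2 / (2 * s)"
    proof -
      have "\<theta> * (2 * pi * s) \<le> real n" unfolding s_eq using \<sigma>(2) n0 mult_right_mono[of "\<sigma> * \<theta>" 1 "real n"]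
        by (simp add: algebra_simps)
      then have "\<theta> * (2 * pi * s) * (pi * (real_of_int m)\<^sup>2) \<le> real n * (pi * (real_of_int m)\<^sup>2)"
        by (intro mult_right_mono) auto
      then show ?thesis using n0 s0 by (simp add: divide_le_eq le_divide_eq power2_eq_square algebra_simps)
    qed
    also have "\<dots> \<le> spin_potential S m" unfolding s_def by (rule spin_potential_lower[OF S3 that])
    finally show ?thesis .
  qed
  have pot_upper: "\<theta>\<^sup>2 * spin_potential S m \<le> pi\<^sup>2 * ((real_of_int m)\<^sup>2 + 1/4) / real n" if m: "m \<in> {- t - 1..t}" for m
  proof -
    \<comment> \<open>With w the weight and x = l + 1/2, s - w = x^2 / (s + w), and s + w \<ge> 2
      \<theta> s.\<close>
    have gap: "2 * \<theta> * s * (s - spin_weight S l) \<le> (real_of_int l + 1/2)\<^sup>2"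
      if l: "\<bar>real_of_int l + 1/2\<bar> \<le> 3 * \<delta> * real n" for l
    proof -
      have w: "\<theta> * s \<le> spin_weight S l" "spin_weight S l \<le> s"
        using wl[OF l] spin_weight_le[of S l] by (simp_all add: s_def)
      have "\<bar>real_of_int l + 1/2\<bar> \<le> \<bar>s\<bar>" using l small_s by linarith
      then have "(real_of_int l + 1/2)\<^sup>2 \<le> s\<^sup>2" by (simp only: abs_le_square_iff)
      then have "(spin_weight S l)\<^sup>2 = s\<^sup>2 - (real_of_int l + 1/2)\<^sup>2"
        unfolding spin_weight_def s_def[symmetric] by simp
      then have sq: "(s + spin_weight S l) * (s - spin_weight S l) = (real_of_int l + 1/2)\<^sup>2"
        by (simp add: power2_eq_square algebra_simps)
      have "\<theta> * s \<le> s" using \<theta>(2) s0 mult_right_mono[of \<theta> 1 s] by simp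
      then have "2 * \<theta> * s \<le> s + spin_weight S l" using w(1) by linarith
      then have "2 * \<theta> * s * (s - spin_weight S l) \<le> (s + spin_weight S l) * (s - spin_weight S l)"
        using w(2) by (intro mult_right_mono) auto
      then show ?thesis unfolding sq .
    qed
    define w where "w = s - (spin_weight S m + spin_weight S (m - 1)) / 2"
    have W: "spin_potential S m = pi * w" by (simp add: spin_potential_def s_def w_def)
    have "2 * \<theta> * s * w = (2 * \<theta> * s * (s - spin_weight S m) + 2 * \<theta> * s * (s - spin_weight S (m - 1))) / 2"
      by (simp add: w_def field_simps)
    also have "\<dots> \<le> ((real_of_int m + 1/2)\<^sup>2 + (real_of_int (m - 1) + 1/2)\<^sup>2) / 2"
      by (intro divide_right_mono add_mono gap edge(1,2)[OF m]) simp
    also have "\<dots> = (real_of_int m)\<^sup>2 + 1/4" by (simp add: power2_eq_square field_simps)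
    finally have 1: "2 * \<theta> * s * w \<le> (real_of_int m)\<^sup>2 + 1/4" .
    have w0: "0 \<le> w" using spin_weight_le[of S m] spin_weight_le[of S "m - 1"] by (simp add: w_def s_def)
    have "\<theta>\<^sup>2 * w * real n \<le> \<theta> * \<sigma> * w * real n"
      using \<sigma>(1) \<theta>(1) w0 n0 by (simp add: power2_eq_square mult_right_mono mult_left_mono)
    also have "\<dots> = \<theta> * w * (2 * pi * s)" unfolding s_eq by simp
    also have "\<dots> = pi * (2 * \<theta> * s * w)" by simp
    also have "\<dots> \<le> pi * ((real_of_int m)\<^sup>2 + 1/4)" using 1 by (intro mult_left_mono) auto
    finally have "pi * (\<theta>\<^sup>2 * w * real n) \<le> pi * (pi * ((real_of_int m)\<^sup>2 + 1/4))" by (intro mult_left_mono) auto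
    then show ?thesis unfolding W using n0 by (simp add: le_divide_eq power2_eq_square algebra_simps)
  qed
  have V_upper: "circ_potential n m \<le> pi\<^sup>2 * (real_of_int m)\<^sup>2 / real n" for m
  proof -
    have "(sin (pi * real_of_int m / real n))\<^sup>2 \<le> (pi * real_of_int m / real n)\<^sup>2"
      using abs_sin_x_le_abs_x[of "pi * real_of_int m / real n"] by (simp only: abs_le_square_iff)
    then have "circ_potential n m \<le> real n * (pi * real_of_int m / real n)\<^sup>2"
      unfolding circ_potential_def by (intro mult_left_mono) auto
    also have "\<dots> = pi\<^sup>2 * (real_of_int m)\<^sup>2 / real n" using n0 by (simp add: power2_eq_square field_simps)
    finally show ?thesis .
  qed
  have V_lower: "\<theta> * (pi\<^sup>2 * (real_of_int m)\<^sup>2 / real n) \<le> circ_potential n m" if m: "m \<in> {- t - 1..t}" for m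
  proof -
    have "\<bar>pi * real_of_int m / real n\<bar> = pi * \<bar>real_of_int m\<bar> / real n" using n0 by (simp add: abs_mult)
    also have "\<dots> \<le> pi * (3 * \<delta> * real n) / real n" using edge(3)[OF m] n0 by (intro divide_right_mono mult_left_mono) auto
    also have "\<dots> \<le> y0" using \<delta>(2) n0 by (simp add: mult_ac)
    finally have "\<theta> * (pi * real_of_int m / real n)\<^sup>2 \<le> (sin (pi * real_of_int m / real n))\<^sup>2" by (rule y0)
    then have "real n * (\<theta> * (pi * real_of_int m / real n)\<^sup>2) \<le> circ_potential n m"
      unfolding circ_potential_def by (intro mult_left_mono) auto
    then show ?thesis using n0 by (simp add: power2_eq_square field_simps)
  qed
  have far: "\<delta> * real n < \<bar>real_of_int m\<bar>" if "\<chi> m \<noteq> 1" for m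
  proof (rule ccontr)
    assume "\<not> ?thesis"
    then have "\<bar>real_of_int m\<bar> / (\<delta> * real n) \<le> 1" using \<delta>n by (simp add: divide_le_eq)
    then show False using that by (simp add: \<chi>_def)
  qed
  show ?thesis
    unfolding t_def[symmetric]
  proof unfold_locales
    show "2 * S + 2 \<le> n" by (rule size)
    show "0 \<le> t" "t \<le> int S" by (rule t)+
    show "0 < e" by (rule e)
    show "0 \<le> \<chi> m" "\<chi> m \<le> 1" for m by (simp_all add: \<chi>_def)
    show "\<bar>\<chi> (m + 1) - \<chi> m\<bar> \<le> 1 / (\<delta> * real n)" for m
    proof -
      have clip: "\<bar>max 0 (min 1 a) - max 0 (min 1 b)\<bar> \<le> \<bar>a - b\<bar>" for a b :: real by (simp add: max_def min_def)
      have "\<bar>\<bar>real_of_int m\<bar> - \<bar>real_of_int (m + 1)\<bar>\<bar> \<le> 1" by simp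
      then have "\<bar>(2 - \<bar>real_of_int (m + 1)\<bar> / (\<delta> * real n)) - (2 - \<bar>real_of_int m\<bar> / (\<delta> * real n))\<bar> \<le> 1 / (\<delta> * real n)"
        using \<delta>n by (simp add: diff_divide_distrib[symmetric] divide_le_cancel)
      then show ?thesis unfolding \<chi>_def using clip by (meson order_trans)
    qed
    show "\<chi> m = 0" if "t < \<bar>m\<bar>" for m
    proof -
      have "2 * \<delta> * real n < \<bar>real_of_int m\<bar>" using that unfolding t_def by linarith
      then have "2 \<le> \<bar>real_of_int m\<bar> / (\<delta> * real n)" using \<delta>n by (simp add: le_divide_eq algebra_simps)
      then show ?thesis by (simp add: \<chi>_def)
    qed
    show "(1 + e) * (1 + 1 / e) * (real n * (1 / (\<delta> * real n))\<^sup>2) \<le> e"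
    proof -
      have "(1 + e) * (1 + 1 / e) \<le> real n * (e * \<delta>\<^sup>2)" using n(3) e \<delta>(1) by (simp add: divide_le_eq)
      then have "(1 + e) * (1 + 1 / e) / (\<delta>\<^sup>2 * real n) \<le> e" using n0 \<delta>(1) by (simp add: divide_le_eq mult_ac)
      moreover have "real n * (1 / (\<delta> * real n))\<^sup>2 = 1 / (\<delta>\<^sup>2 * real n)" using n0 \<delta>(1) by (simp add: power2_eq_square)
      ultimately show ?thesis by simp
    qed
    fix m assume m: "m \<in> {- t - 1..t}"
    have w: "\<theta> * s \<le> spin_weight S m" "spin_weight S m \<le> s"
      using wl[OF edge(1)[OF m]] spin_weight_le[of S m] by (simp_all add: s_def)
    have ps: "pi / 2 * s = \<sigma> * (real n / 4)" using s_eq by simp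
    show "real n / 4 \<le> (1 + e) * (pi / 2 * spin_weight S m)"
    proof -
      have "1 * (real n / 4) \<le> ((1 + e) * \<theta>\<^sup>2) * (real n / 4)" using e\<theta>(2) by (intro mult_right_mono) auto
      also have "\<dots> \<le> (1 + e) * (\<theta> * \<sigma>) * (real n / 4)"
        using e \<sigma>(1) \<theta>(1) by (intro mult_right_mono mult_left_mono) (auto simp: power2_eq_square)
      also have "\<dots> = (1 + e) * (\<theta> * (pi / 2 * s))" unfolding ps by simp
      also have "\<dots> = (1 + e) * (pi / 2 * (\<theta> * s))" by simp
      also have "\<dots> \<le> (1 + e) * (pi / 2 * spin_weight S m)" using e w(1) by (intro mult_left_mono) auto
      finally show ?thesis by simp
    qed
    have up: "pi / 2 * spin_weight S m \<le> \<sigma> * (real n / 4)"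
      unfolding ps[symmetric] using w(2) by (intro mult_left_mono) auto
    have \<sigma>2: "\<sigma> \<le> 2"
      using \<sigma> \<theta>(1) mult_left_mono[of "1/2" \<theta> \<sigma>] by linarith
    show "pi / 2 * spin_weight S m \<le> (1 + e) * (real n / 4)"
    proof -
      have "\<sigma> \<le> \<sigma> * ((1 + e) * \<theta>)" using e\<theta>(1) \<sigma>(1) \<theta>(1) mult_left_mono[of 1 "(1 + e) * \<theta>" \<sigma>] by simp
      also have "\<dots> = (1 + e) * (\<sigma> * \<theta>)" by simp
      also have "\<dots> \<le> (1 + e) * 1" using \<sigma>(2) e by (intro mult_left_mono) auto
      finally have "\<sigma> * (real n / 4) \<le> (1 + e) * (real n / 4)" by (intro mult_right_mono) auto
      with up show ?thesis by linarith
    qed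
    show "pi / 2 * spin_weight S m \<le> real n"
      using up \<sigma>2 mult_right_mono[of \<sigma> 2 "real n / 4"] by simp
    show "circ_potential n m \<le> (1 + e) * spin_potential S m + e"
    proof -
      have "pi\<^sup>2 * (real_of_int m)\<^sup>2 / real n \<le> (1 + e) * \<theta> * (pi\<^sup>2 * (real_of_int m)\<^sup>2 / real n)"
        using e\<theta>(1) mult_right_mono[of 1 "(1 + e) * \<theta>" "pi\<^sup>2 * (real_of_int m)\<^sup>2 / real n"] by simp
      also have "\<dots> = (1 + e) * (\<theta> * (pi\<^sup>2 * (real_of_int m)\<^sup>2 / real n))" by simp
      also have "\<dots> \<le> (1 + e) * spin_potential S m" using pot_lower[OF edge(4)[OF m]] e by (intro mult_left_mono) auto
      finally show ?thesis using V_upper[of m] e by linarith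
    qed
    show "spin_potential S m \<le> (1 + e) * circ_potential n m + e"
    proof -
      let ?v = "pi\<^sup>2 * (real_of_int m)\<^sup>2 / real n"
      have "\<theta>\<^sup>2 * spin_potential S m \<le> ?v + pi\<^sup>2 / 4 / real n"
        using pot_upper[OF m] by (simp add: distrib_left add_divide_distrib)
      also have "pi\<^sup>2 / 4 / real n \<le> \<theta>\<^sup>2 * e"
        using n(4) \<theta>(1) e n0 by (simp add: field_simps)
      also have "?v \<le> ((1 + e) * \<theta> ^ 3) * ?v" using \<theta>(3) mult_right_mono[of 1 "(1 + e) * \<theta> ^ 3" ?v] by simp
      also have "\<dots> = \<theta>\<^sup>2 * ((1 + e) * (\<theta> * ?v))" by (simp add: power3_eq_cube power2_eq_square)
      also have "\<dots> \<le> \<theta>\<^sup>2 * ((1 + e) * circ_potential n m)"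
        using V_lower[OF m] e by (intro mult_left_mono) auto
      finally have "\<theta>\<^sup>2 * spin_potential S m \<le> \<theta>\<^sup>2 * ((1 + e) * circ_potential n m + e)" by (simp add: distrib_left)
      moreover have "0 < \<theta>\<^sup>2" using \<theta>(1) by simp
      ultimately show ?thesis by (rule mult_left_le_imp_le)
    qed
  next
    fix m assume m: "m \<in> {- int S - 1..<int n - int S - 1}" and "\<chi> m \<noteq> 1"
    then have f: "\<delta> * real n < \<bar>real_of_int m\<bar>" using far by blast
    \<comment> \<open>Keeps m at distance at least \<delta> n from the copies of the well at n and -
      n as well.\<close>
    have "\<bar>real_of_int m\<bar> \<le> real n - \<delta> * real n"
    proof (cases "0 \<le> m")
      case True
      have "real_of_int m \<le> real n - real S - 2" using m by auto
      moreover have "\<delta> * real n \<le> real S + 2" using small_s s_def \<delta>n by linarith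
      ultimately show ?thesis using True by linarith
    next
      case False
      have "- real_of_int m \<le> real S + 1" using m by auto
      moreover have "real S + 1 \<le> real n / 2" using size by linarith
      moreover have "\<delta> * real n \<le> 1/2 * real n" using \<delta>(4) by (intro mult_right_mono) auto
      ultimately show ?thesis using False by linarith
    qed
    then have "pi * \<bar>real_of_int m\<bar> / real n \<le> pi * (real n - \<delta> * real n) / real n"
      by (intro divide_right_mono mult_left_mono) auto
    also have "\<dots> = pi - pi * \<delta>" using n0 by (simp add: field_simps)
    finally have "sin (pi * \<delta>) \<le> sin (pi * \<bar>real_of_int m\<bar> / real n)"
      using f \<delta>(1,4) n0 by (intro sin_ge_sin_between) (auto simp: field_simps)
    moreover have "0 < sin (pi * \<delta>)" using \<delta>(1,4) by (intro sin_gt_zero) (auto simp: algebra_simps)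
    ultimately have "(sin (pi * \<delta>))\<^sup>2 \<le> (sin (pi * \<bar>real_of_int m\<bar> / real n))\<^sup>2" by (intro power_mono) auto
    also have "\<dots> = (sin (pi * real_of_int m / real n))\<^sup>2" by (cases "0 \<le> m") auto
    finally have "real n * (sin (pi * \<delta>))\<^sup>2 \<le> circ_potential n m"
      unfolding circ_potential_def by (intro mult_left_mono) auto
    then have "e * (real n * (sin (pi * \<delta>))\<^sup>2) \<le> e * circ_potential n m" using e by (intro mult_left_mono) auto
    moreover have "1 \<le> e * (real n * (sin (pi * \<delta>))\<^sup>2)"
      using n(5) e \<open>0 < sin (pi * \<delta>)\<close> by (simp add: divide_le_eq mult_ac)
    ultimately show "1 \<le> e * circ_potential n m" by linarith
  next
    fix m assume m: "m \<in> {- int S - 1..<int S + 1}" and "\<chi> m \<noteq> 1"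
    then have f: "\<delta> * real n < \<bar>real_of_int m\<bar>" using far by blast
    then have "(\<delta> * real n)\<^sup>2 \<le> (real_of_int m)\<^sup>2"
      using power_mono[of "\<delta> * real n" "\<bar>real_of_int m\<bar>" 2] \<delta>n by simp
    then have "e * (\<theta> * (pi\<^sup>2 * (\<delta> * real n)\<^sup>2 / real n)) \<le> e * (\<theta> * (pi\<^sup>2 * (real_of_int m)\<^sup>2 / real n))"
      using e \<theta>(1) by (intro mult_left_mono divide_right_mono) auto
    also have "\<dots> \<le> e * spin_potential S m"
      using pot_lower[of m] m e by (intro mult_left_mono) auto
    finally have "e * (\<theta> * (pi\<^sup>2 * (\<delta> * real n)\<^sup>2 / real n)) \<le> e * spin_potential S m" .
    moreover have "1 \<le> e * (\<theta> * (pi\<^sup>2 * (\<delta> * real n)\<^sup>2 / real n))"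
    proof -
      have "1 \<le> real n * (e * \<theta> * pi\<^sup>2 * \<delta>\<^sup>2)" using n(6) e \<theta>(1) \<delta>(1) by (simp add: divide_le_eq)
      also have "\<dots> = e * (\<theta> * (pi\<^sup>2 * (\<delta> * real n)\<^sup>2 / real n))" using n0 by (simp add: power2_eq_square)
      finally show ?thesis .
    qed
    ultimately show "1 \<le> e * spin_potential S m" by linarith
  qed
qed

lemma eventually_spin_comparison:
  assumes e: "0 < e" "e \<le> 1"
  shows "\<forall>\<^sub>F n in sequentially. \<exists>t L \<chi>. spin_comparison n (nat \<lfloor>real n / (2 * pi)\<rfloor>) t e L \<chi>"
proof -
  \<comment> \<open>Bernoulli gives \<theta>^3 \<ge> 1 - 3 e / 8, and (1 + e) (1 - 3 e / 8) = 1 + e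
    (5 - 3 e) / 8 \<ge> 1 for e \<le> 1.\<close>
  define \<theta> where "\<theta> = 1 - e / 8"
  have \<theta>: "1/2 \<le> \<theta>" "\<theta> < 1" using e by (simp_all add: \<theta>_def)
  have \<theta>3: "1 \<le> (1 + e) * \<theta> ^ 3"
  proof -
    have "1 - 3 * e / 8 \<le> \<theta> ^ 3"
      using Bernoulli_inequality[of "- e / 8" 3] e by (simp add: \<theta>_def)
    then have "(1 + e) * (1 - 3 * e / 8) \<le> (1 + e) * \<theta> ^ 3" using e by (intro mult_left_mono) auto
    moreover have "(1 + e) * (1 - 3 * e / 8) = 1 + e * (5 - 3 * e) / 8" by (simp add: field_simps)
    moreover have "0 \<le> e * (5 - 3 * e) / 8" using e by simp
    ultimately show ?thesis by linarith
  qed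
  have "((\<lambda>y. (sin y / y)\<^sup>2) \<longlongrightarrow> 1) (at (0::real))" by real_asymp
  then have "\<forall>\<^sub>F y in at (0::real). \<theta> < (sin y / y)\<^sup>2" using \<theta>(2) by (rule order_tendstoD)
  then obtain d where d: "0 < d" "\<And>y::real. y \<noteq> 0 \<Longrightarrow> \<bar>y\<bar> < d \<Longrightarrow> \<theta> < (sin y / y)\<^sup>2"
    unfolding eventually_at by auto
  have y0: "\<theta> * y\<^sup>2 \<le> (sin y)\<^sup>2" if "\<bar>y\<bar> \<le> d / 2" for y
  proof (cases "y = 0")
    case False
    then have "\<theta> < (sin y)\<^sup>2 / y\<^sup>2" using d(2)[of y] d(1) that by (simp add: power_divide)
    then show ?thesis using False by (simp add: less_divide_eq)
  qed simp
  \<comment> \<open>One bound per requirement: half of the circle, validity of sin^2 y \<ge>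
    \<theta> y^2 up to d / 2, and closeness of the weights to their central value. None of them
    depends on n.\<close>
  define \<delta> where "\<delta> = min (1/2) (min (d / (6 * pi)) (\<theta> * sqrt (1 - \<theta>\<^sup>2) / (6 * pi)))"
  have \<theta>2: "\<theta>\<^sup>2 < 1" using \<theta> by (simp add: power_less_one_iff)
  have \<delta>: "0 < \<delta>" "3 * pi * \<delta> \<le> d / 2" "(6 * pi * \<delta> / \<theta>)\<^sup>2 \<le> 1 - \<theta>\<^sup>2" "\<delta> \<le> 1/2"
  proof -
    show "0 < \<delta>" unfolding \<delta>_def using d(1) \<theta> \<theta>2 by simp
    have 1: "\<delta> \<le> d / (6 * pi)" and 2: "\<delta> \<le> \<theta> * sqrt (1 - \<theta>\<^sup>2) / (6 * pi)" and "\<delta> \<le> 1/2"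
      by (simp_all add: \<delta>_def)
    then show "\<delta> \<le> 1/2" by simp
    show "3 * pi * \<delta> \<le> d / 2" using 1 by (simp add: field_simps)
    have "6 * pi * \<delta> / \<theta> \<le> sqrt (1 - \<theta>\<^sup>2)" using 2 \<theta>(1) by (simp add: field_simps)
    moreover have "0 \<le> 6 * pi * \<delta> / \<theta>" using \<open>0 < \<delta>\<close> \<theta>(1) by simp
    ultimately have "(6 * pi * \<delta> / \<theta>)\<^sup>2 \<le> (sqrt (1 - \<theta>\<^sup>2))\<^sup>2" by (rule power_mono)
    then show "(6 * pi * \<delta> / \<theta>)\<^sup>2 \<le> 1 - \<theta>\<^sup>2" using \<theta>2 by simp
  qed
  have ev: "\<forall>\<^sub>F n in sequentially. c \<le> real n" for c
    using filterlim_real_sequentially unfolding filterlim_at_top by blast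
  have "\<forall>\<^sub>F n in sequentially. 2 / \<delta> \<le> real n \<and> pi / (1 - \<theta>) \<le> real n \<and> (1 + e) * (1 + 1 / e) / (e * \<delta>\<^sup>2) \<le> real n \<and>
      pi\<^sup>2 / (4 * \<theta>\<^sup>2 * e) \<le> real n \<and> 1 / (e * (sin (pi * \<delta>))\<^sup>2) \<le> real n \<and> 1 / (e * \<theta> * pi\<^sup>2 * \<delta>\<^sup>2) \<le> real n \<and> 32 \<le> n"
    by (intro eventually_conj ev eventually_ge_at_top)
  then show ?thesis
  proof eventually_elim
    case (elim n)
    then have "spin_comparison n (nat \<lfloor>real n / (2 * pi)\<rfloor>) \<lfloor>2 * \<delta> * real n\<rfloor> e (1 / (\<delta> * real n))
      (\<lambda>m::int. max 0 (min 1 (2 - \<bar>real_of_int m\<bar> / (\<delta> * real n))))"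
      by (intro spin_comparison_large[OF e(1) \<theta> \<theta>3 y0 \<delta>]) auto
    then show ?case by blast
  qed
qed

text \<open>Each transfer loses only the passage from \<nu> to \<open>C e \<nu>\<close>, which tends
  to \<nu> as e tends to 0. From above, \<nu> = \<mu> bounds the level directly; from below, a level
  at most \<nu> < \<mu> would give \<mu> \<le> \<open>C e \<nu>\<close> < \<mu>.\<close>

lemma kth_largest_eigenvalue_M_limit:
  assumes k: "1 \<le> k"
  shows "(\<lambda>n. real n * (1 - kth_largest_eigenvalue (M n) k)) \<longlonglongrightarrow> (2 * real k - 1) * pi / 2"
proof -
  define \<mu> where "\<mu> = (2 * real k - 1) * pi / 2"
  define C where "C e \<nu> = ((1 + e)\<^sup>2 * \<nu> + 2 * e) / (1 - e * \<nu>)" for e \<nu> :: real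
  let ?\<Lambda> = "\<lambda>n. real n * (1 - kth_largest_eigenvalue (M n) k)"
  have \<mu>: "0 < \<mu>" using k by (simp add: \<mu>_def)
  have C: "((\<lambda>e. C e \<nu>) \<longlongrightarrow> \<nu>) (at_right 0)" for \<nu>
    unfolding C_def by (auto intro!: tendsto_eq_intros)
  have C1: "((\<lambda>e. e * \<nu>) \<longlongrightarrow> 0) (at_right 0)" for \<nu> :: real
    by (auto intro!: tendsto_eq_intros)
  have dim: "\<forall>\<^sub>F n in sequentially. k \<le> Suc (2 * nat \<lfloor>real n / (2 * pi)\<rfloor>)"
  proof -
    have "filterlim (\<lambda>n. nat \<lfloor>real n / (2 * pi)\<rfloor>) at_top sequentially" by real_asymp
    then have "\<forall>\<^sub>F n in sequentially. k \<le> nat \<lfloor>real n / (2 * pi)\<rfloor>" unfolding filterlim_at_top by blast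
    then show ?thesis by eventually_elim simp
  qed
  have e1: "\<forall>\<^sub>F e in at_right (0::real). 0 < e \<and> e \<le> 1"
    unfolding eventually_at_right_field by (intro exI[of _ 1]) auto
  show ?thesis
    unfolding \<mu>_def[symmetric]
  proof (rule order_tendstoI)
    fix b assume b: "\<mu> < b"
    have "\<forall>\<^sub>F e in at_right 0. C e \<mu> < b \<and> e * \<mu> < 1 \<and> 0 < e \<and> e \<le> 1"
      using order_tendstoD(2)[OF C b] order_tendstoD(2)[OF C1[of \<mu>], of 1] e1 by (auto elim: eventually_elim2 intro: eventually_conj)
    then obtain e where e: "C e \<mu> < b" "e * \<mu> < 1" "0 < e" "e \<le> 1"
      using eventually_happens'[OF trivial_limit_at_right_real] by blast
    from eventually_spin_comparison[OF e(3,4)] dim show "\<forall>\<^sub>F n in sequentially. ?\<Lambda> n < b"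
    proof eventually_elim
      case (elim n)
      then obtain t L \<chi> where "spin_comparison n (nat \<lfloor>real n / (2 * pi)\<rfloor>) t e L \<chi>" by blast
      from spin_comparison.kth_largest_eigenvalue_M_lower[OF this k elim(2), of \<mu>]
      show ?case using e \<mu> unfolding C_def \<mu>_def by simp
    qed
  next
    fix a assume a: "a < \<mu>"
    \<comment> \<open>The transfer requires \<nu> \<ge> 0, so a negative \<open>a\<close> is
      replaced by 0.\<close>
    define \<nu> where "\<nu> = max 0 a"
    have \<nu>: "0 \<le> \<nu>" "\<nu> < \<mu>" "a \<le> \<nu>" using a \<mu> by (auto simp: \<nu>_def)
    have "\<forall>\<^sub>F e in at_right 0. C e \<nu> < \<mu> \<and> e * \<nu> < 1 \<and> 0 < e \<and> e \<le> 1"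
      using order_tendstoD(2)[OF C \<nu>(2)] order_tendstoD(2)[OF C1[of \<nu>], of 1] e1 by (auto elim: eventually_elim2 intro: eventually_conj)
    then obtain e where e: "C e \<nu> < \<mu>" "e * \<nu> < 1" "0 < e" "e \<le> 1"
      using eventually_happens'[OF trivial_limit_at_right_real] by blast
    from eventually_spin_comparison[OF e(3,4)] dim show "\<forall>\<^sub>F n in sequentially. a < ?\<Lambda> n"
    proof eventually_elim
      case (elim n)
      then obtain t L \<chi> where sc: "spin_comparison n (nat \<lfloor>real n / (2 * pi)\<rfloor>) t e L \<chi>" by blast
      show ?case
      proof (rule ccontr)
        assume "\<not> ?case"
        then have "?\<Lambda> n \<le> \<nu>" using \<nu>(3) by linarith
        from spin_comparison.kth_largest_eigenvalue_M_upper[OF sc k elim(2) this \<nu>(1) e(2)]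
        show False using e(1) unfolding C_def \<mu>_def by simp
      qed
    qed
  qed
qed

lemma kth_largest_eigenvalue_M_asymptotics:
  assumes k: "1 \<le> k"
  shows "(\<lambda>n. kth_largest_eigenvalue (M n) k - (1 - ((2 * real k - 1) * pi / 2) / real n)) \<in> o(\<lambda>n. 1 / real n)"
proof (rule landau_o.smallI)
  fix c :: real assume c: "0 < c"
  let ?\<mu> = "(2 * real k - 1) * pi / 2" and ?\<Lambda> = "\<lambda>n. real n * (1 - kth_largest_eigenvalue (M n) k)"
  have "\<forall>\<^sub>F n in sequentially. dist (?\<Lambda> n) ?\<mu> < c"
    using kth_largest_eigenvalue_M_limit[OF k] c by (rule tendstoD)
  then show "\<forall>\<^sub>F n in sequentially. norm (kth_largest_eigenvalue (M n) k - (1 - ?\<mu> / real n)) \<le> c * norm (1 / real n)"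
    using eventually_gt_at_top[of 0]
  proof eventually_elim
    case (elim n)
    have "kth_largest_eigenvalue (M n) k - (1 - ?\<mu> / real n) = - (?\<Lambda> n - ?\<mu>) / real n"
      using elim(2) by (simp add: field_simps)
    then have "norm (kth_largest_eigenvalue (M n) k - (1 - ?\<mu> / real n)) = \<bar>?\<Lambda> n - ?\<mu>\<bar> / real n"
      by (simp add: abs_divide abs_minus_commute)
    also have "\<dots> \<le> c / real n" using elim(1) by (intro divide_right_mono) (auto simp: dist_real_def)
    finally show ?case by simp
  qed
qed

section \<open>The spectrum of the harmonic oscillator\<close>

lemma schwartz_differentiable: "schwartz \<phi> \<Longrightarrow> (D ^^ n) \<phi> differentiable (at x)"
  unfolding schwartz_def by blast

lemma schwartz_D: "schwartz \<phi> \<Longrightarrow> schwartz (D \<phi>)"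
proof -
  assume s: "schwartz \<phi>"
  have "(D ^^ n) (D \<phi>) = (D ^^ Suc n) \<phi>" for n by (simp only: funpow_Suc_right o_apply)
  with s show ?thesis unfolding schwartz_def by metis
qed

lemma schwartz_has_vector_derivative: "schwartz \<phi> \<Longrightarrow> (\<phi> has_vector_derivative D \<phi> x) (at x)"
  using schwartz_differentiable[of \<phi> 0 x] unfolding D_def by (simp add: vector_derivative_works)

lemma schwartz_isCont: "schwartz \<phi> \<Longrightarrow> isCont \<phi> x"
  using schwartz_has_vector_derivative has_vector_derivative_continuous by blast

lemma schwartz_measurable: "schwartz \<phi> \<Longrightarrow> \<phi> \<in> borel_measurable lborel"
  using schwartz_isCont by (auto intro!: borel_measurable_continuous_onI continuous_at_imp_continuous_on)

text \<open>Bounds for x^m \<phi> and x^(m + 2) \<phi> add up to a bound for (1 + x^2) x^m \<phi>.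
  The factor 1 / (1 + x^2) serves both integrability and the limits at infinity.\<close>

lemma schwartz_decay:
  assumes "schwartz \<phi>"
  shows "\<exists>C\<ge>0. \<forall>x. cmod (complex_of_real (x ^ m) * \<phi> x) \<le> C / (1 + x\<^sup>2)"
proof -
  have b: "bounded (range (\<lambda>x. complex_of_real (x ^ m) * \<phi> x))" for m
    using assms unfolding schwartz_def by (metis funpow_0)
  obtain A where A: "\<And>x. cmod (complex_of_real (x ^ m) * \<phi> x) \<le> A"
    using b[of m] unfolding bounded_iff by auto
  obtain B where B: "\<And>x. cmod (complex_of_real (x ^ (m + 2)) * \<phi> x) \<le> B"
    using b[of "m + 2"] unfolding bounded_iff by auto
  have "cmod (complex_of_real (x ^ m) * \<phi> x) \<le> (A + B) / (1 + x\<^sup>2)" for x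
  proof -
    have p: "\<bar>x\<bar> ^ (m + 2) = \<bar>x\<bar> ^ m * x\<^sup>2" by (simp add: power_add power2_eq_square)
    have "(1 + x\<^sup>2) * cmod (complex_of_real (x ^ m) * \<phi> x)
        = cmod (complex_of_real (x ^ m) * \<phi> x) + cmod (complex_of_real (x ^ (m + 2)) * \<phi> x)"
      by (simp only: norm_mult norm_of_real power_abs p) (simp add: algebra_simps)
    also have "\<dots> \<le> A + B" using A B by (rule add_mono)
    finally show ?thesis by (simp add: pos_le_divide_eq add_pos_nonneg mult.commute)
  qed
  moreover have "0 \<le> A + B" using A[of 0] B[of 0] by (meson add_nonneg_nonneg norm_ge_zero order_trans)
  ultimately show ?thesis by blast
qed

lemma integrable_inverse_1_plus_x2: "integrable lborel (\<lambda>x::real. C / (1 + x\<^sup>2))"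
proof -
  have "integrable lborel (\<lambda>x::real. inverse (1 + x\<^sup>2))"
    using integrable_inverse_1_plus_square by (simp add: set_integrable_def einterval_eq_UNIV)
  then have "integrable lborel (\<lambda>x::real. C * inverse (1 + x\<^sup>2))" by (rule integrable_mult_right)
  then show ?thesis by (simp add: divide_inverse)
qed

lemma square_integrable_decay:
  assumes "f \<in> borel_measurable lborel" "\<And>x. cmod (f x) \<le> C / (1 + x\<^sup>2)"
  shows "square_integrable f"
  unfolding square_integrable_def
proof
  show "f \<in> borel_measurable lborel" by fact
  have "(cmod (f x))\<^sup>2 \<le> C\<^sup>2 / (1 + x\<^sup>2)" for x
  proof -
    have "(cmod (f x))\<^sup>2 \<le> (C / (1 + x\<^sup>2))\<^sup>2" by (rule power_mono[OF assms(2)]) simp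
    also have "\<dots> = C\<^sup>2 / (1 + x\<^sup>2) * (1 / (1 + x\<^sup>2))" by (simp add: power2_eq_square)
    also have "\<dots> \<le> C\<^sup>2 / (1 + x\<^sup>2) * 1" by (intro mult_left_mono) (auto simp: divide_le_eq add_pos_nonneg)
    finally show ?thesis by simp
  qed
  then show "integrable lborel (\<lambda>x. (cmod (f x))\<^sup>2)"
    using assms(1) by (intro Bochner_Integration.integrable_bound[OF integrable_inverse_1_plus_x2[of "C\<^sup>2"]]) auto
qed

lemma schwartz_square_integrable:
  assumes "schwartz \<phi>"
  shows "square_integrable (\<lambda>x. complex_of_real (x ^ m) * \<phi> x)"
proof -
  obtain C where C: "\<forall>x. cmod (complex_of_real (x ^ m) * \<phi> x) \<le> C / (1 + x\<^sup>2)"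
    using schwartz_decay[OF assms] by blast
  show ?thesis
    by (rule square_integrable_decay[of _ C]) (use C schwartz_measurable[OF assms] in auto)
qed

lemma square_integrable_mult:
  assumes "square_integrable f" "square_integrable g"
  shows "integrable lborel (\<lambda>x. f x * g x)"
proof (rule Bochner_Integration.integrable_bound)
  show "integrable lborel (\<lambda>x. (cmod (f x))\<^sup>2 + (cmod (g x))\<^sup>2)"
    using assms unfolding square_integrable_def by simp
  show "(\<lambda>x. f x * g x) \<in> borel_measurable lborel"
    using assms unfolding square_integrable_def by auto
  have "cmod (f x * g x) \<le> (cmod (f x))\<^sup>2 + (cmod (g x))\<^sup>2" for x
  proof -
    have "2 * (cmod (f x) * cmod (g x)) \<le> (cmod (f x))\<^sup>2 + (cmod (g x))\<^sup>2"
      using sum_squares_bound[of "cmod (f x)" "cmod (g x)"] by (simp add: mult.assoc)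
    moreover have "0 \<le> cmod (f x) * cmod (g x)" by simp
    ultimately show ?thesis unfolding norm_mult by linarith
  qed
  then show "AE x in lborel. cmod (f x * g x) \<le> norm ((cmod (f x))\<^sup>2 + (cmod (g x))\<^sup>2)" by simp
qed

lemma square_integrable_cmult:
  assumes "square_integrable f"
  shows "square_integrable (\<lambda>x. c * f x)"
  using assms unfolding square_integrable_def by (auto simp: norm_mult power_mult_distrib)

lemma square_integrable_add:
  assumes "square_integrable f" "square_integrable g"
  shows "square_integrable (\<lambda>x. f x + g x)"
  unfolding square_integrable_def
proof
  show m: "(\<lambda>x. f x + g x) \<in> borel_measurable lborel"
    using assms unfolding square_integrable_def by auto
  show "integrable lborel (\<lambda>x. (cmod (f x + g x))\<^sup>2)"
  proof (rule Bochner_Integration.integrable_bound)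
    show "integrable lborel (\<lambda>x. 2 * (cmod (f x))\<^sup>2 + 2 * (cmod (g x))\<^sup>2)"
      using assms unfolding square_integrable_def by simp
    show "(\<lambda>x. (cmod (f x + g x))\<^sup>2) \<in> borel_measurable lborel" using m by simp
    have "(cmod (f x + g x))\<^sup>2 \<le> 2 * (cmod (f x))\<^sup>2 + 2 * (cmod (g x))\<^sup>2" for x
    proof -
      have "(cmod (f x + g x))\<^sup>2 \<le> (cmod (f x) + cmod (g x))\<^sup>2"
        by (intro power_mono norm_triangle_ineq) simp
      also have "\<dots> \<le> 2 * (cmod (f x))\<^sup>2 + 2 * (cmod (g x))\<^sup>2"
        using sum_squares_bound[of "cmod (f x)" "cmod (g x)"] by (simp add: power2_sum)
      finally show ?thesis .
    qed
    then show "AE x in lborel. norm ((cmod (f x + g x))\<^sup>2) \<le> norm (2 * (cmod (f x))\<^sup>2 + 2 * (cmod (g x))\<^sup>2)"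
      by simp
  qed
qed

lemma square_integrable_diff:
  assumes "square_integrable f" "square_integrable g"
  shows "square_integrable (\<lambda>x. f x - g x)"
  using square_integrable_add[OF assms(1) square_integrable_cmult[OF assms(2), of "-1"]] by simp

text \<open>In place of Cauchy-Schwarz, a b \<le> c a^2 + b^2 / c with a free c > 0 is integrated.
  The pairing is bilinear, without conjugation; the Hermite functions used as test functions later
  are real-valued.\<close>

lemma L2_tendsto_integral_mult:
  assumes F: "\<And>n. square_integrable (F n)" and f: "square_integrable f" and h: "square_integrable h"
    and lim: "L2_tendsto F f"
  shows "(\<lambda>n. LINT x|lborel. F n x * h x) \<longlonglongrightarrow> (LINT x|lborel. f x * h x)"
proof -
  define d where "d n = (LINT x|lborel. (cmod (F n x - f x))\<^sup>2)" for n
  define H where "H = (LINT x|lborel. (cmod (h x))\<^sup>2)"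
  have H0: "0 \<le> H" unfolding H_def by (rule Bochner_Integration.integral_nonneg) simp
  have d0: "d \<longlonglongrightarrow> 0" using lim unfolding L2_tendsto_def d_def .
  have bound: "cmod ((LINT x|lborel. F n x * h x) - (LINT x|lborel. f x * h x)) \<le> c * d n + H / c"
    if c: "0 < c" for n c
  proof -
    have df: "square_integrable (\<lambda>x. F n x - f x)" by (rule square_integrable_diff[OF F f])
    have i1: "integrable lborel (\<lambda>x. (cmod (F n x - f x))\<^sup>2)" and i2: "integrable lborel (\<lambda>x. (cmod (h x))\<^sup>2)"
      using df h unfolding square_integrable_def by auto
    have "(LINT x|lborel. F n x * h x) - (LINT x|lborel. f x * h x) = (LINT x|lborel. (F n x - f x) * h x)"
      using square_integrable_mult[OF F h] square_integrable_mult[OF f h]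
      by (subst Bochner_Integration.integral_diff[symmetric]) (simp_all add: left_diff_distrib)
    also have "cmod \<dots> \<le> (LINT x|lborel. cmod ((F n x - f x) * h x))" by (rule integral_norm_bound)
    also have "\<dots> \<le> (LINT x|lborel. c * (cmod (F n x - f x))\<^sup>2 + (1 / c) * (cmod (h x))\<^sup>2)"
    proof (rule integral_mono)
      show "integrable lborel (\<lambda>x. cmod ((F n x - f x) * h x))"
        by (intro integrable_norm square_integrable_mult df h)
      show "integrable lborel (\<lambda>x. c * (cmod (F n x - f x))\<^sup>2 + (1 / c) * (cmod (h x))\<^sup>2)"
        using i1 i2 by (intro Bochner_Integration.integrable_add integrable_mult_right)
      fix x :: real
      define a where "a = cmod (F n x - f x)"
      define b where "b = cmod (h x)"
      have ab: "0 \<le> a" "0 \<le> b" by (simp_all add: a_def b_def)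
      have "c * a\<^sup>2 + (1 / c) * b\<^sup>2 - a * b = ((c * a - b)\<^sup>2 + c * (a * b)) / c"
        using c by (simp add: power2_eq_square field_simps)
      moreover have "\<dots> \<ge> 0" using c ab by simp
      ultimately show "cmod ((F n x - f x) * h x) \<le> c * (cmod (F n x - f x))\<^sup>2 + (1 / c) * (cmod (h x))\<^sup>2"
        unfolding norm_mult a_def b_def by linarith
    qed
    also have "\<dots> = c * d n + H / c"
      unfolding d_def H_def
      by (subst Bochner_Integration.integral_add) (use i1 i2 in simp_all)
    finally show ?thesis .
  qed
  show ?thesis
  proof (rule LIMSEQ_I)
    fix r :: real assume r: "0 < r"
    \<comment> \<open>Makes H / c < r / 2, also for H = 0; n is then taken so large that c times
      \<open>d n\<close> is below r / 2.\<close>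
    define c where "c = 2 * (H + 1) / r"
    have c: "0 < c" using r H0 by (simp add: c_def)
    have "H / c < r / 2" using r H0 by (simp add: c_def field_simps add_pos_nonneg)
    moreover obtain N where N: "\<forall>n\<ge>N. \<bar>d n\<bar> < r / (2 * c)"
      using LIMSEQ_D[OF d0, of "r / (2 * c)"] r c by auto
    moreover have "c * d n < r / 2" if "n \<ge> N" for n
    proof -
      have "d n < r / (2 * c)" using N that by fastforce
      then have "c * d n < c * (r / (2 * c))" using c by (rule mult_strict_left_mono)
      then show ?thesis using c by simp
    qed
    ultimately show "\<exists>N. \<forall>n\<ge>N. norm ((LINT x|lborel. F n x * h x) - (LINT x|lborel. f x * h x)) < r"
      using bound[OF c] by (intro exI[of _ N]) (smt (verit, best) field_sum_of_halves)
  qed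
qed

lemma oscillator_square_integrable:
  assumes "schwartz \<phi>"
  shows "square_integrable (oscillator_expr \<phi>)"
proof -
  have "square_integrable (\<lambda>x. - (1/4) * D (D \<phi>) x)"
    using schwartz_square_integrable[OF schwartz_D[OF schwartz_D[OF assms]], of 0]
    by (intro square_integrable_cmult) simp
  moreover have "square_integrable (\<lambda>x. complex_of_real (pi\<^sup>2) * (complex_of_real (x ^ 2) * \<phi> x))"
    by (intro square_integrable_cmult schwartz_square_integrable assms)
  ultimately have "square_integrable (\<lambda>x. - (1/4) * D (D \<phi>) x + complex_of_real (pi\<^sup>2) * (complex_of_real (x ^ 2) * \<phi> x))"
    by (rule square_integrable_add)
  then show ?thesis unfolding oscillator_expr_def by (simp add: mult.assoc)
qed

text \<open>Integration by parts: \<open>\<phi>'' \<psi> - \<phi> \<psi>''\<close> is the derivative of the Wronskian.\<close>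

lemma oscillator_symmetric:
  assumes \<phi>: "schwartz \<phi>" and \<psi>: "schwartz \<psi>"
  shows "(LINT x|lborel. oscillator_expr \<phi> x * \<psi> x) = (LINT x|lborel. \<phi> x * oscillator_expr \<psi> x)"
proof -
  let ?W = "\<lambda>x. D \<phi> x * \<psi> x - \<phi> x * D \<psi> x"
  let ?w = "\<lambda>x. D (D \<phi>) x * \<psi> x - \<phi> x * D (D \<psi>) x"
  have sq: "square_integrable \<phi>" if "schwartz \<phi>" for \<phi>
    using schwartz_square_integrable[OF that, of 0] by simp
  note d\<phi> = schwartz_D[OF \<phi>] and d\<psi> = schwartz_D[OF \<psi>]
  note dd\<phi> = schwartz_D[OF d\<phi>] and dd\<psi> = schwartz_D[OF d\<psi>]
  have der: "(?W has_vector_derivative ?w x) (at x)" for x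
  proof -
    have "(?W has_vector_derivative (D \<phi> x * D \<psi> x + D (D \<phi>) x * \<psi> x) - (\<phi> x * D (D \<psi>) x + D \<phi> x * D \<psi> x)) (at x)"
      by (intro has_vector_derivative_diff has_vector_derivative_mult schwartz_has_vector_derivative \<phi> \<psi> d\<phi> d\<psi>)
    then show ?thesis by simp
  qed
  have int_w: "integrable lborel ?w"
    by (intro Bochner_Integration.integrable_diff square_integrable_mult sq \<phi> \<psi> dd\<phi> dd\<psi>)
  have lim1: "((\<lambda>x. C / (1 + x\<^sup>2)) \<longlongrightarrow> 0) at_top" "((\<lambda>x. C / (1 + x\<^sup>2)) \<longlongrightarrow> 0) at_bot" for C :: real
    by real_asymp+
  have z: "(\<phi> \<longlongrightarrow> 0) at_top" "(\<phi> \<longlongrightarrow> 0) at_bot" if s: "schwartz \<phi>" for \<phi>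
  proof -
    obtain C where C: "\<forall>x. cmod (complex_of_real (x ^ 0) * \<phi> x) \<le> C / (1 + x\<^sup>2)"
      using schwartz_decay[OF s] by blast
    then have "\<forall>x. cmod (\<phi> x) \<le> C / (1 + x\<^sup>2)" by simp
    then show "(\<phi> \<longlongrightarrow> 0) at_top" "(\<phi> \<longlongrightarrow> 0) at_bot"
      by (auto intro!: Lim_null_comparison[OF _ lim1(1)[of C]] Lim_null_comparison[OF _ lim1(2)[of C]])
  qed
  have "(?W \<longlongrightarrow> 0 * 0 - 0 * 0) at_top" "(?W \<longlongrightarrow> 0 * 0 - 0 * 0) at_bot"
    by (intro tendsto_diff tendsto_mult z \<phi> \<psi> d\<phi> d\<psi>)+
  then have lim: "(?W \<longlongrightarrow> 0) at_top" "(?W \<longlongrightarrow> 0) at_bot" by simp_all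
  have "(LBINT x=-\<infinity>..\<infinity>. ?w x) = 0 - 0"
  proof (rule interval_integral_FTC_integrable)
    show "(?W has_vector_derivative ?w x) (at x)" for x by (rule der)
    show "isCont ?w x" for x by (intro continuous_intros schwartz_isCont \<phi> \<psi> dd\<phi> dd\<psi>)
    show "set_integrable lborel (einterval (-\<infinity>) \<infinity>) ?w" using int_w by (simp add: set_integrable_def einterval_eq_UNIV)
    show "((?W \<circ> real_of_ereal) \<longlongrightarrow> 0) (at_right (-\<infinity>))" "((?W \<circ> real_of_ereal) \<longlongrightarrow> 0) (at_left \<infinity>)"
      using lim by (simp_all add: ereal_tendsto_simps1)
  qed simp
  then have w0: "(LINT x|lborel. ?w x) = 0"
    by (simp add: interval_lebesgue_integral_def einterval_eq_UNIV set_lebesgue_integral_def)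
  have "(LINT x|lborel. oscillator_expr \<phi> x * \<psi> x) - (LINT x|lborel. \<phi> x * oscillator_expr \<psi> x)
      = (LINT x|lborel. oscillator_expr \<phi> x * \<psi> x - \<phi> x * oscillator_expr \<psi> x)"
    by (intro Bochner_Integration.integral_diff[symmetric] square_integrable_mult oscillator_square_integrable sq \<phi> \<psi>)
  also have "\<dots> = (LINT x|lborel. - (1/4) * ?w x)"
    by (intro Bochner_Integration.integral_cong refl) (simp add: oscillator_expr_def algebra_simps)
  also have "\<dots> = 0" using w0 by (subst integral_mult_right_zero) simp
  finally show ?thesis by simp
qed

text \<open>Elements \<open>f\<close> of the domain of the closure need not be differentiable in the
  sense of \<open>D\<close>. The symmetry on Schwartz functions passes to the limit along the
  approximating sequence and leaves all derivatives on \<psi>.\<close>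

lemma harmonic_oscillator_weak:
  assumes "(f, g) \<in> harmonic_oscillator" "schwartz \<psi>"
  shows "(LINT x|lborel. g x * \<psi> x) = (LINT x|lborel. f x * oscillator_expr \<psi> x)"
proof -
  from assms(1) obtain \<phi> where sq: "square_integrable f" "square_integrable g" and \<phi>: "\<And>n. schwartz (\<phi> n)"
    and lim: "L2_tendsto \<phi> f" "L2_tendsto (\<lambda>n. oscillator_expr (\<phi> n)) g"
    unfolding harmonic_oscillator_def by auto
  have s: "square_integrable \<phi>" if "schwartz \<phi>" for \<phi>
    using schwartz_square_integrable[OF that, of 0] by simp
  have "(\<lambda>n. LINT x|lborel. oscillator_expr (\<phi> n) x * \<psi> x) \<longlonglongrightarrow> (LINT x|lborel. g x * \<psi> x)"
    by (intro L2_tendsto_integral_mult oscillator_square_integrable \<phi> sq s assms(2) lim)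
  moreover have "(\<lambda>n. LINT x|lborel. \<phi> n x * oscillator_expr \<psi> x) \<longlonglongrightarrow> (LINT x|lborel. f x * oscillator_expr \<psi> x)"
    by (intro L2_tendsto_integral_mult oscillator_square_integrable \<phi> sq s assms(2) lim)
  ultimately show ?thesis
    unfolding oscillator_symmetric[OF \<phi> assms(2)] by (rule LIMSEQ_unique)
qed

section \<open>Polynomials times the Gaussian, and the Hermite functions\<close>

text \<open>Polynomial multiples of the ground state. \<open>D\<close>, multiplication by x and the
  oscillator preserve this class, which turns the analysis into algebra of polynomials.\<close>

definition gauss_poly :: "real poly \<Rightarrow> real \<Rightarrow> complex" where
  "gauss_poly p x = complex_of_real (poly p x * exp (- pi * x\<^sup>2))"

lemma D_gauss_poly: "D (gauss_poly p) = gauss_poly (pderiv p - [:0, 2 * pi:] * p)"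
  and gauss_poly_differentiable: "gauss_poly p differentiable (at x)"
proof -
  have d: "(gauss_poly p has_vector_derivative gauss_poly (pderiv p - [:0, 2 * pi:] * p) x) (at x)" for x
  proof -
    have "((\<lambda>x. poly p x * exp (- pi * x\<^sup>2)) has_field_derivative
        poly (pderiv p) x * exp (- pi * x\<^sup>2) + poly p x * (exp (- pi * x\<^sup>2) * (- pi * (2 * x)))) (at x)"
      by (auto intro!: derivative_eq_intros)
    then have "(gauss_poly p has_vector_derivative complex_of_real
        (poly (pderiv p) x * exp (- pi * x\<^sup>2) + poly p x * (exp (- pi * x\<^sup>2) * (- pi * (2 * x))))) (at x)"
      unfolding gauss_poly_def by (rule has_vector_derivative_of_real)
    moreover have "poly (pderiv p) x * exp (- pi * x\<^sup>2) + poly p x * (exp (- pi * x\<^sup>2) * (- pi * (2 * x)))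
        = poly (pderiv p - [:0, 2 * pi:] * p) x * exp (- pi * x\<^sup>2)"
      by (simp add: algebra_simps)
    ultimately show ?thesis unfolding gauss_poly_def by (simp only:)
  qed
  then show "D (gauss_poly p) = gauss_poly (pderiv p - [:0, 2 * pi:] * p)"
    unfolding D_def by (intro ext vector_derivative_at)
  show "gauss_poly p differentiable (at x)"
    using d[of x] by (rule differentiableI_vector)
qed

text \<open>In a + x p the induction hypothesis is used for p with rate c / 2; the other half of the
  rate absorbs |x| \<le> (2 / c) exp (c |x| / 2).\<close>

lemma poly_exp_bound:
  assumes "0 < c"
  shows "\<exists>C\<ge>0. \<forall>x::real. \<bar>poly p x\<bar> \<le> C * exp (c * \<bar>x\<bar>)"
  using assms
proof (induction p arbitrary: c)
  case 0
  then show ?case by (intro exI[of _ 0]) simp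
next
  case (pCons a p)
  then obtain C where C: "0 \<le> C" "\<And>x. \<bar>poly p x\<bar> \<le> C * exp (c / 2 * \<bar>x\<bar>)" by (meson half_gt_zero)
  have "\<bar>poly (pCons a p) x\<bar> \<le> (\<bar>a\<bar> + 2 / c * C) * exp (c * \<bar>x\<bar>)" for x
  proof -
    have "c / 2 * \<bar>x\<bar> \<le> exp (c / 2 * \<bar>x\<bar>)" using exp_ge_add_one_self[of "c / 2 * \<bar>x\<bar>"] by linarith
    then have x: "\<bar>x\<bar> \<le> 2 / c * exp (c / 2 * \<bar>x\<bar>)" using pCons.prems by (simp add: field_simps)
    have "\<bar>x\<bar> * \<bar>poly p x\<bar> \<le> (2 / c * exp (c / 2 * \<bar>x\<bar>)) * (C * exp (c / 2 * \<bar>x\<bar>))"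
      using x C pCons.prems by (intro mult_mono) auto
    also have "\<dots> = 2 / c * C * exp (c * \<bar>x\<bar>)" by (simp add: exp_add[symmetric])
    finally have 1: "\<bar>x\<bar> * \<bar>poly p x\<bar> \<le> 2 / c * C * exp (c * \<bar>x\<bar>)" .
    have 2: "\<bar>a\<bar> \<le> \<bar>a\<bar> * exp (c * \<bar>x\<bar>)"
      using pCons.prems mult_left_mono[of 1 "exp (c * \<bar>x\<bar>)" "\<bar>a\<bar>"] by simp
    have "\<bar>poly (pCons a p) x\<bar> \<le> \<bar>a\<bar> + \<bar>x\<bar> * \<bar>poly p x\<bar>"
      by (simp add: abs_mult[symmetric] abs_triangle_ineq)
    also have "\<dots> \<le> (\<bar>a\<bar> + 2 / c * C) * exp (c * \<bar>x\<bar>)" using 1 2 by (simp add: distrib_right)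
    finally show ?thesis .
  qed
  then show ?case using C(1) pCons.prems by (intro exI[of _ "\<bar>a\<bar> + 2 / c * C"]) auto
qed

lemma gauss_poly_bounded: "\<exists>C. \<forall>x. cmod (gauss_poly p x) \<le> C"
proof -
  obtain C where C: "0 \<le> C" "\<And>x. \<bar>poly p x\<bar> \<le> C * exp (1 * \<bar>x\<bar>)"
    using poly_exp_bound[of 1 p] by auto
  have "cmod (gauss_poly p x) \<le> C * exp 1" for x
  proof -
    have "\<bar>x\<bar> \<le> 1 + x\<^sup>2" using sum_squares_bound[of 1 "\<bar>x\<bar>"] by (simp add: power2_eq_square)
    moreover have "x\<^sup>2 \<le> pi * x\<^sup>2" using pi_ge_two mult_right_mono[of 1 pi "x\<^sup>2"] by simp
    ultimately have "\<bar>x\<bar> - pi * x\<^sup>2 \<le> 1" by linarith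
    then have "exp (1 * \<bar>x\<bar>) * exp (- pi * x\<^sup>2) \<le> exp 1" by (simp add: exp_add[symmetric])
    then have "C * (exp (1 * \<bar>x\<bar>) * exp (- pi * x\<^sup>2)) \<le> C * exp 1" using C(1) by (intro mult_left_mono)
    moreover have "cmod (gauss_poly p x) \<le> C * exp (1 * \<bar>x\<bar>) * exp (- pi * x\<^sup>2)"
      unfolding gauss_poly_def norm_of_real abs_mult abs_exp_cancel using C(2) by (intro mult_right_mono) auto
    ultimately show ?thesis by (simp add: mult.assoc)
  qed
  then show ?thesis by blast
qed

lemma schwartz_gauss_poly: "schwartz (gauss_poly p)"
proof -
  have "\<exists>q. (D ^^ n) (gauss_poly p) = gauss_poly q" for n
    by (induction n) (auto simp: D_gauss_poly)
  then obtain q where q: "\<And>n. (D ^^ n) (gauss_poly p) = gauss_poly (q n)" by metis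
  have "complex_of_real (x ^ m) * gauss_poly r x = gauss_poly (monom 1 m * r) x" for m r x
    by (simp add: gauss_poly_def poly_monom)
  then show ?thesis
    unfolding schwartz_def q using gauss_poly_bounded gauss_poly_differentiable
    by (auto simp: bounded_iff)
qed

text \<open>Conjugation by the ground state: the terms in \<pi>^2 x^2 cancel, and a Hermite operator
  with ground energy \<pi> / 2 remains.\<close>

lemma oscillator_gauss_poly:
  "oscillator_expr (gauss_poly p)
    = gauss_poly (Polynomial.smult (- 1/4) (pderiv (pderiv p)) + [:0, pi:] * pderiv p + Polynomial.smult (pi / 2) p)"
proof
  fix x
  have "oscillator_expr (gauss_poly p) x = gauss_poly (Polynomial.smult (- 1/4)
      (pderiv (pderiv p - [:0, 2 * pi:] * p) - [:0, 2 * pi:] * (pderiv p - [:0, 2 * pi:] * p)) + [:0, 0, pi\<^sup>2:] * p) x"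
    unfolding oscillator_expr_def D_gauss_poly gauss_poly_def
    by (simp add: algebra_simps power2_eq_square)
  also have "Polynomial.smult (- 1/4)
      (pderiv (pderiv p - [:0, 2 * pi:] * p) - [:0, 2 * pi:] * (pderiv p - [:0, 2 * pi:] * p)) + [:0, 0, pi\<^sup>2:] * p
      = Polynomial.smult (- 1/4) (pderiv (pderiv p)) + [:0, pi:] * pderiv p + Polynomial.smult (pi / 2) p"
    by (rule poly_ext) (simp add: pderiv_diff pderiv_mult pderiv_smult pderiv_pCons algebra_simps power2_eq_square)
  finally show "oscillator_expr (gauss_poly p) x
    = gauss_poly (Polynomial.smult (- 1/4) (pderiv (pderiv p)) + [:0, pi:] * pderiv p + Polynomial.smult (pi / 2) p) x" .
qed

text \<open>The physicists' Hermite polynomials H_j up to scaling: (\<pi> / 2)^(j / 2) H_j (sqrt (2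
  \<pi>) x).\<close>

fun hermite_poly :: "nat \<Rightarrow> real poly" where
  "hermite_poly 0 = 1"
| "hermite_poly (Suc j) = [:0, 2 * pi:] * hermite_poly j - Polynomial.smult (1/2) (pderiv (hermite_poly j))"

definition osc_eigenvalue :: "nat \<Rightarrow> real" where
  "osc_eigenvalue j = (2 * real j + 1) * pi / 2"

text \<open>The creation operator \<open>p \<mapsto> 2\<pi> x p - p'/2\<close> raises the energy by \<open>\<pi>\<close>.\<close>

lemma hermite_poly_ode:
  "Polynomial.smult (- 1/4) (pderiv (pderiv (hermite_poly j))) + [:0, pi:] * pderiv (hermite_poly j)
    + Polynomial.smult (pi / 2) (hermite_poly j) = Polynomial.smult (osc_eigenvalue j) (hermite_poly j)"
proof (induction j)
  case 0
  then show ?case by (simp add: osc_eigenvalue_def)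
next
  case (Suc j)
  define H where "H p = Polynomial.smult (- 1/4) (pderiv (pderiv p)) + [:0, pi:] * pderiv p + Polynomial.smult (pi / 2) p"
    for p :: "real poly"
  define C where "C p = [:0, 2 * pi:] * p - Polynomial.smult (1/2) (pderiv p)" for p :: "real poly"
  have "H (C p) = C (H p) + Polynomial.smult pi (C p)" for p
    unfolding H_def C_def
    by (rule poly_ext) (simp add: pderiv_diff pderiv_add pderiv_mult pderiv_smult pderiv_pCons algebra_simps power2_eq_square)
  moreover have "C (Polynomial.smult a p) = Polynomial.smult a (C p)" for a p
    unfolding C_def by (simp add: pderiv_smult smult_diff_right mult.commute)
  ultimately have "H (C (hermite_poly j)) = Polynomial.smult (osc_eigenvalue j + pi) (C (hermite_poly j))"
    using Suc.IH unfolding H_def[symmetric] by (simp add: smult_add_left)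
  moreover have "osc_eigenvalue j + pi = osc_eigenvalue (Suc j)" by (simp add: osc_eigenvalue_def field_simps)
  ultimately show ?case unfolding H_def C_def by simp
qed

lemma degree_hermite_poly: "degree (hermite_poly j) = j \<and> hermite_poly j \<noteq> 0"
proof (induction j)
  case (Suc j)
  have d: "degree ([:0, 2 * pi:] * hermite_poly j) = Suc j"
    using Suc by (subst degree_mult_eq) auto
  have s: "degree (- Polynomial.smult (1/2) (pderiv (hermite_poly j))) < Suc j"
    using Suc degree_pderiv_le[of "hermite_poly j"] by (simp add: degree_minus) 
  have "degree (hermite_poly (Suc j)) = Suc j"
    using degree_add_eq_left[of "- Polynomial.smult (1/2) (pderiv (hermite_poly j))" "[:0, 2 * pi:] * hermite_poly j"] d s
    by (simp only: hermite_poly.simps diff_conv_add_uminus)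
  then show ?case by (metis degree_0 nat.distinct(1))
qed simp

lemma oscillator_hermite:
  "oscillator_expr (gauss_poly (hermite_poly j))
    = (\<lambda>x. complex_of_real (osc_eigenvalue j) * gauss_poly (hermite_poly j) x)"
  unfolding oscillator_gauss_poly hermite_poly_ode by (simp add: gauss_poly_def fun_eq_iff)

section \<open>Completeness of the Hermite functions\<close>

text \<open>The partial sums of the exponential series integrate to zero by the moment condition and
  are dominated by exp (|t| |x|) |g x|, so dominated convergence applies.\<close>

lemma fourier_zero_of_moments_zero:
  fixes g :: "real \<Rightarrow> real"
  assumes g: "g \<in> borel_measurable lborel"
    and exp: "\<And>c. integrable lborel (\<lambda>x. exp (c * \<bar>x\<bar>) * \<bar>g x\<bar>)"
    and mom: "\<And>k::nat. (LINT x|lborel. x ^ k * g x) = 0"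
  shows "(LINT x|lborel. complex_of_real (g x) * iexp (t * x)) = 0"
proof -
  define s where "s N x = (\<Sum>k<N. complex_of_real (g x) * ((\<i> * complex_of_real (t * x)) ^ k /\<^sub>R fact k))" for N :: nat and x
  have int: "integrable lborel (\<lambda>x. x ^ k * g x)" for k
  proof -
    obtain C where C: "\<And>x. \<bar>poly (monom 1 k) x\<bar> \<le> C * exp (1 * \<bar>x::real\<bar>)"
      using poly_exp_bound[of 1 "monom 1 k"] by auto
    show ?thesis
    proof (rule Bochner_Integration.integrable_bound)
      show "integrable lborel (\<lambda>x. C * (exp (1 * \<bar>x\<bar>) * \<bar>g x\<bar>))" using exp by (rule integrable_mult_right)
      show "(\<lambda>x. x ^ k * g x) \<in> borel_measurable lborel" using g by simp
      have "\<bar>x ^ k\<bar> * \<bar>g x\<bar> \<le> C * exp (1 * \<bar>x\<bar>) * \<bar>g x\<bar>" for x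
        using C[of x] by (intro mult_right_mono) (auto simp: poly_monom)
      moreover have "C * (exp (1 * \<bar>x\<bar>) * \<bar>g x\<bar>) \<le> norm (C * (exp (1 * \<bar>x\<bar>) * \<bar>g x\<bar>))" for x by simp
      ultimately show "AE x in lborel. norm (x ^ k * g x) \<le> norm (C * (exp (1 * \<bar>x\<bar>) * \<bar>g x\<bar>))"
        by (intro AE_I2) (metis (no_types, lifting) abs_mult mult.assoc order_trans real_norm_def)
    qed
  qed
  have sN: "(LINT x|lborel. s N x) = 0" for N
  proof -
    have eq: "complex_of_real (g x) * ((\<i> * complex_of_real (t * x)) ^ k /\<^sub>R fact k)
        = (\<i> * complex_of_real t) ^ k / fact k * complex_of_real (x ^ k * g x)" for k x
      by (simp add: scaleR_conv_of_real power_mult_distrib field_simps)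
    have "(LINT x|lborel. s N x) = (\<Sum>k<N. LINT x|lborel. (\<i> * complex_of_real t) ^ k / fact k * complex_of_real (x ^ k * g x))"
      unfolding s_def eq using int by (intro Bochner_Integration.integral_sum integrable_mult_right integrable_of_real)
    also have "\<dots> = 0" using mom by (simp del: of_real_mult of_real_power add: integral_complex_of_real)
    finally show ?thesis .
  qed
  have "(\<lambda>N. LINT x|lborel. s N x) \<longlonglongrightarrow> (LINT x|lborel. complex_of_real (g x) * iexp (t * x))"
  proof (rule integral_dominated_convergence)
    show "(\<lambda>x. complex_of_real (g x) * iexp (t * x)) \<in> borel_measurable lborel" using g by simp
    show "s N \<in> borel_measurable lborel" for N unfolding s_def using g by simp
    show "integrable lborel (\<lambda>x. exp (\<bar>t\<bar> * \<bar>x\<bar>) * \<bar>g x\<bar>)" by (rule exp)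
    show "AE x in lborel. (\<lambda>N. s N x) \<longlonglongrightarrow> complex_of_real (g x) * iexp (t * x)"
    proof (intro AE_I2)
      fix x
      have "(\<lambda>k. (\<i> * complex_of_real (t * x)) ^ k /\<^sub>R fact k) sums iexp (t * x)" by (rule exp_converges)
      then have "(\<lambda>k. complex_of_real (g x) * ((\<i> * complex_of_real (t * x)) ^ k /\<^sub>R fact k)) sums (complex_of_real (g x) * iexp (t * x))"
        by (rule sums_mult)
      then show "(\<lambda>N. s N x) \<longlonglongrightarrow> complex_of_real (g x) * iexp (t * x)" unfolding sums_def s_def .
    qed
    show "AE x in lborel. norm (s N x) \<le> exp (\<bar>t\<bar> * \<bar>x\<bar>) * \<bar>g x\<bar>" for N
    proof (intro AE_I2)
      fix x
      have "norm (s N x) \<le> (\<Sum>k<N. \<bar>g x\<bar> * ((\<bar>t\<bar> * \<bar>x\<bar>) ^ k /\<^sub>R fact k))"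
        unfolding s_def
        by (rule order_trans[OF norm_sum]) (simp add: norm_mult norm_power abs_mult power_mult_distrib ac_simps)
      also have "\<dots> = \<bar>g x\<bar> * (\<Sum>k<N. (\<bar>t\<bar> * \<bar>x\<bar>) ^ k /\<^sub>R fact k)" by (simp add: sum_distrib_left)
      also have "\<dots> \<le> \<bar>g x\<bar> * exp (\<bar>t\<bar> * \<bar>x\<bar>)"
        unfolding exp_def by (intro mult_left_mono sum_le_suminf[OF summable_exp_generic]) auto
      finally show "norm (s N x) \<le> exp (\<bar>t\<bar> * \<bar>x\<bar>) * \<bar>g x\<bar>" by (simp add: mult.commute)
    qed
  qed
  then have "(\<lambda>N. 0) \<longlonglongrightarrow> (LINT x|lborel. complex_of_real (g x) * iexp (t * x))" unfolding sN .
  then show ?thesis by (simp add: tendsto_const_iff LIMSEQ_const_iff)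
qed

text \<open>The positive and negative parts of \<open>g\<close>, normalized to probability densities, have the same
  characteristic function.\<close>

lemma AE_zero_of_fourier_zero:
  fixes g :: "real \<Rightarrow> real"
  assumes g: "integrable lborel g"
    and ft: "\<And>t. (LINT x|lborel. complex_of_real (g x) * iexp (t * x)) = 0"
  shows "AE x in lborel. g x = 0"
proof -
  define p where "p x = max 0 (g x)" for x
  define q where "q x = max 0 (- g x)" for x
  have gm: "g \<in> borel_measurable lborel" using g by auto
  have gpq: "g x = p x - q x" for x by (auto simp: p_def q_def)
  have pm: "p \<in> borel_measurable lborel" "q \<in> borel_measurable lborel" unfolding p_def q_def using gm by auto
  have nn: "0 \<le> p x" "0 \<le> q x" for x by (simp_all add: p_def q_def)
  have pi: "integrable lborel p" "integrable lborel q" unfolding p_def q_def using g by auto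
  define c where "c = integral\<^sup>L lborel p"
  have expi: "integrable lborel (\<lambda>x. complex_of_real (f x) * iexp (t * x))" if "integrable lborel f" for f t
    using that by (intro Bochner_Integration.integrable_bound[OF that]) (auto simp: norm_mult)
  have split: "(LINT x|lborel. complex_of_real (p x) * iexp (t * x)) = (LINT x|lborel. complex_of_real (q x) * iexp (t * x))" for t
  proof -
    have "(LINT x|lborel. complex_of_real (p x) * iexp (t * x)) - (LINT x|lborel. complex_of_real (q x) * iexp (t * x))
        = (LINT x|lborel. complex_of_real (g x) * iexp (t * x))"
      by (subst Bochner_Integration.integral_diff[symmetric]) (use expi pi in \<open>auto simp: gpq left_diff_distrib\<close>)
    then show ?thesis using ft by simp
  qed
  \<comment> \<open>The transform at t = 0: both parts have the same total mass, so one constant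
    normalizes both. If it is zero, both parts vanish almost everywhere and no normalization is
    required.\<close>
  have cq: "integral\<^sup>L lborel q = c"
    using split[of 0] unfolding c_def by (simp add: integral_complex_of_real)
  show ?thesis
  proof (cases "c = 0")
    case True
    then have "AE x in lborel. p x = 0" "AE x in lborel. q x = 0"
      using integral_nonneg_eq_0_iff_AE[OF pi(1)] integral_nonneg_eq_0_iff_AE[OF pi(2)] nn cq by (auto simp: c_def)
    then show ?thesis by eventually_elim (simp add: gpq)
  next
    case False
    then have c: "0 < c" unfolding c_def using nn by (metis Bochner_Integration.integral_nonneg less_eq_real_def)
    have dist: "real_distribution (density lborel (\<lambda>x. ennreal (f x / c)))"
      and ch: "char (density lborel (\<lambda>x. ennreal (f x / c))) t = (LINT x|lborel. complex_of_real (f x) * iexp (t * x)) / c"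
      if f: "integrable lborel f" "\<And>x. 0 \<le> f x" "integral\<^sup>L lborel f = c" for f :: "real \<Rightarrow> real" and t
    proof -
      have fm: "f \<in> borel_measurable lborel" using f(1) by auto
      have "emeasure (density lborel (\<lambda>x. ennreal (f x / c))) UNIV = (\<integral>\<^sup>+x. ennreal (f x / c) \<partial>lborel)"
        using fm by (subst emeasure_density) auto
      also have "\<dots> = ennreal (LINT x|lborel. f x / c)"
        using f c by (intro nn_integral_eq_integral) auto
      also have "\<dots> = 1" using f(3) c by simp
      finally show "real_distribution (density lborel (\<lambda>x. ennreal (f x / c)))"
        by (intro real_distribution.intro prob_spaceI real_distribution_axioms.intro) auto
      have "char (density lborel (\<lambda>x. ennreal (f x / c))) t = (LINT x|lborel. (f x / c) *\<^sub>R iexp (t * x))"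
        unfolding char_def using fm f(2) c by (intro integral_density) auto
      also have "\<dots> = (LINT x|lborel. complex_of_real (f x) * iexp (t * x) / c)"
        by (simp add: scaleR_conv_of_real)
      also have "\<dots> = (LINT x|lborel. complex_of_real (f x) * iexp (t * x)) / c" by simp
      finally show "char (density lborel (\<lambda>x. ennreal (f x / c))) t
        = (LINT x|lborel. complex_of_real (f x) * iexp (t * x)) / c" .
    qed
    have "density lborel (\<lambda>x. ennreal (p x / c)) = density lborel (\<lambda>x. ennreal (q x / c))"
      using dist[OF pi(1) nn(1) c_def[symmetric]] dist[OF pi(2) nn(2) cq]
      by (rule Levy_uniqueness)
        (rule ext, simp only: ch[OF pi(1) nn(1) c_def[symmetric]] ch[OF pi(2) nn(2) cq] split)
    then have "AE x in lborel. ennreal (p x / c) = ennreal (q x / c)"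
      using pm by (subst (asm) sigma_finite_measure.density_unique_iff[OF lborel.sigma_finite_measure_axioms]) auto
    then show ?thesis
      by eventually_elim (use c nn in \<open>simp add: gpq\<close>)
  qed
qed

text \<open>Completing the square gives c |x| - x^2 \<le> c^2 / 2 - x^2 / 2, so a multiple of the
  standard normal density dominates.\<close>

lemma integrable_exp_abs_gaussian: "integrable lborel (\<lambda>x::real. exp (c * \<bar>x\<bar>) * exp (- x\<^sup>2))"
proof (rule Bochner_Integration.integrable_bound)
  let ?C = "exp (c\<^sup>2 / 2) * sqrt (2 * pi)"
  show "integrable lborel (\<lambda>x. ?C * normal_density 0 1 x)" by (intro integrable_mult_right) simp
  have "exp (c * \<bar>x\<bar>) * exp (- x\<^sup>2) \<le> ?C * normal_density 0 1 x" for x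
  proof -
    have "0 \<le> (\<bar>x\<bar> - c)\<^sup>2" by simp
    then have "c * \<bar>x\<bar> - x\<^sup>2 \<le> c\<^sup>2 / 2 - x\<^sup>2 / 2" by (simp add: power2_diff algebra_simps)
    then have "exp (c * \<bar>x\<bar> - x\<^sup>2) \<le> exp (c\<^sup>2 / 2 - x\<^sup>2 / 2)" by simp
    then show ?thesis by (simp add: normal_density_def exp_add[symmetric])
  qed
  then show "AE x in lborel. norm (exp (c * \<bar>x\<bar>) * exp (- x\<^sup>2)) \<le> norm (?C * normal_density 0 1 x)" by simp
qed simp

text \<open>Multiplied by the Gaussian, the real and imaginary parts of \<open>f\<close> have all
  exponential moments although \<open>f\<close> is only square integrable. Orthogonality to
  monomials kills their moments and hence their Fourier transforms.\<close>

lemma gauss_poly_complete: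
  assumes f: "square_integrable f" and orth: "\<And>p. (LINT x|lborel. f x * gauss_poly p x) = 0"
  shows "AE x in lborel. f x = 0"
proof -
  have fm: "f \<in> borel_measurable lborel" and fi: "integrable lborel (\<lambda>x. (cmod (f x))\<^sup>2)"
    using f unfolding square_integrable_def by auto
  have part: "AE x in lborel. P (f x) = 0"
    if P: "P = Re \<or> P = Im" for P :: "complex \<Rightarrow> real"
  proof -
    define g where "g x = P (f x) * exp (- pi * x\<^sup>2)" for x
    have Pm: "(\<lambda>x. P (f x)) \<in> borel_measurable lborel" using P fm by auto
    then have gm: "g \<in> borel_measurable lborel" unfolding g_def by simp
    have Ple: "\<bar>P z\<bar> \<le> cmod z" for z using P abs_Re_le_cmod abs_Im_le_cmod by auto
    have ge: "integrable lborel (\<lambda>x. exp (c * \<bar>x\<bar>) * \<bar>g x\<bar>)" for c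
    proof (rule Bochner_Integration.integrable_bound)
      show "integrable lborel (\<lambda>x. (cmod (f x))\<^sup>2 + exp ((2 * c) * \<bar>x\<bar>) * exp (- x\<^sup>2))"
        using fi integrable_exp_abs_gaussian by (rule Bochner_Integration.integrable_add)
      show "(\<lambda>x. exp (c * \<bar>x\<bar>) * \<bar>g x\<bar>) \<in> borel_measurable lborel" using gm by simp
      have "exp (c * \<bar>x\<bar>) * \<bar>g x\<bar> \<le> (cmod (f x))\<^sup>2 + exp ((2 * c) * \<bar>x\<bar>) * exp (- x\<^sup>2)" for x
      proof -
        define a where "a = exp (c * \<bar>x\<bar>) * exp (- pi * x\<^sup>2)"
        have a: "0 \<le> a" by (simp add: a_def)
        have "exp (c * \<bar>x\<bar>) * \<bar>g x\<bar> \<le> cmod (f x) * a"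
          using mult_right_mono[OF Ple[of "f x"] a] by (simp add: g_def a_def abs_mult algebra_simps)
        also have "\<dots> \<le> (cmod (f x))\<^sup>2 + a\<^sup>2"
        proof -
          have "2 * (cmod (f x) * a) \<le> (cmod (f x))\<^sup>2 + a\<^sup>2"
            using sum_squares_bound[of "cmod (f x)" a] by (simp add: mult.assoc)
          moreover have "0 \<le> cmod (f x) * a" using a by simp
          ultimately show ?thesis by linarith
        qed
        also have "a\<^sup>2 \<le> exp ((2 * c) * \<bar>x\<bar>) * exp (- x\<^sup>2)"
        proof -
          have "x\<^sup>2 \<le> 2 * pi * x\<^sup>2" using pi_ge_two mult_right_mono[of 1 "2 * pi" "x\<^sup>2"] by simp
          then have "2 * (c * \<bar>x\<bar> + - pi * x\<^sup>2) \<le> 2 * c * \<bar>x\<bar> + - x\<^sup>2" by (simp add: algebra_simps)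
          then show ?thesis unfolding a_def exp_add[symmetric] exp_double[symmetric] by simp
        qed
        finally show ?thesis by simp
      qed
      then show "AE x in lborel. norm (exp (c * \<bar>x\<bar>) * \<bar>g x\<bar>)
          \<le> norm ((cmod (f x))\<^sup>2 + exp ((2 * c) * \<bar>x\<bar>) * exp (- x\<^sup>2))" by (simp add: abs_mult)
    qed
    have "(LINT x|lborel. x ^ k * g x) = 0" for k
    proof -
      have int: "integrable lborel (\<lambda>x. f x * gauss_poly (monom 1 k) x)"
        using schwartz_square_integrable[OF schwartz_gauss_poly, of 0] by (intro square_integrable_mult f) simp
      have "x ^ k * g x = P (f x * gauss_poly (monom 1 k) x)" for x
        using P by (auto simp: g_def gauss_poly_def poly_monom algebra_simps simp del: of_real_mult of_real_power)
      then have "(LINT x|lborel. x ^ k * g x) = (LINT x|lborel. P (f x * gauss_poly (monom 1 k) x))" by metis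
      also have "\<dots> = P (LINT x|lborel. f x * gauss_poly (monom 1 k) x)"
        using P int by (elim disjE) (simp_all only: integral_Re integral_Im)
      finally have "(LINT x|lborel. x ^ k * g x) = P (LINT x|lborel. f x * gauss_poly (monom 1 k) x)" .
      then show ?thesis using orth P by auto
    qed
    from fourier_zero_of_moments_zero[OF gm ge this]
    have "AE x in lborel. g x = 0"
      using ge[of 0] gm by (intro AE_zero_of_fourier_zero) (simp_all add: integrable_abs_iff)
    then show ?thesis by (simp add: g_def)
  qed
  from part[of Re] part[of Im] show ?thesis
    by (auto elim!: eventually_elim2 simp: complex_eq_iff)
qed

text \<open>Since \<open>hermite_poly n\<close> has degree exactly n, subtracting a multiple of it
  lowers the degree; so orthogonality extends to all polynomials by induction on the degree.\<close>

lemma hermite_complete: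
  assumes f: "square_integrable f" and orth: "\<And>j. (LINT x|lborel. f x * gauss_poly (hermite_poly j) x) = 0"
  shows "AE x in lborel. f x = 0"
proof (rule gauss_poly_complete[OF f])
  have int: "integrable lborel (\<lambda>x. f x * gauss_poly p x)" for p
    using schwartz_square_integrable[OF schwartz_gauss_poly, of 0] by (intro square_integrable_mult f) simp
  have "degree p < n \<Longrightarrow> (LINT x|lborel. f x * gauss_poly p x) = 0" for n p
  proof (induction n arbitrary: p)
    case (Suc n)
    let ?h = "hermite_poly n"
    define c where "c = coeff p n / lead_coeff ?h"
    define r where "r = p - Polynomial.smult c ?h"
    have h: "degree ?h = n" "?h \<noteq> 0" using degree_hermite_poly by auto
    have "coeff ?h n \<noteq> 0" using h by (metis leading_coeff_0_iff)
    then have "coeff r n = 0" using h by (simp add: r_def c_def)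
    moreover have "degree r \<le> n" unfolding r_def using Suc.prems h by (intro degree_diff_le) auto
    ultimately have r: "r = 0 \<or> degree r < n"
      by (metis le_neq_implies_less leading_coeff_0_iff)
    have r0: "(LINT x|lborel. f x * gauss_poly r x) = 0"
      using r
    proof
      assume "r = 0"
      then show ?thesis by (simp add: gauss_poly_def)
    qed (rule Suc.IH)
    have "f x * gauss_poly p x = f x * gauss_poly r x + complex_of_real c * (f x * gauss_poly ?h x)" for x
      by (simp add: gauss_poly_def r_def algebra_simps)
    then have "(LINT x|lborel. f x * gauss_poly p x)
        = (LINT x|lborel. f x * gauss_poly r x) + complex_of_real c * (LINT x|lborel. f x * gauss_poly ?h x)"
      using int by simp
    then show ?case using r0 orth by simp
  qed simp
  then show "(LINT x|lborel. f x * gauss_poly p x) = 0" for p by blast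
qed

section \<open>Eigenvalues and multiplicities of the oscillator\<close>

text \<open>The weak form of the eigenvalue equation gives e I = \<open>osc_eigenvalue j\<close> I
  for the integral I, without any regularity of \<open>f\<close>.\<close>

lemma eigenfunction_orthogonal:
  assumes f: "(f, \<lambda>x. complex_of_real e * f x) \<in> harmonic_oscillator" and e: "e \<noteq> osc_eigenvalue j"
  shows "(LINT x|lborel. f x * gauss_poly (hermite_poly j) x) = 0"
proof -
  have "complex_of_real e * (LINT x|lborel. f x * gauss_poly (hermite_poly j) x)
      = (LINT x|lborel. (complex_of_real e * f x) * gauss_poly (hermite_poly j) x)"
    by (simp add: mult.assoc)
  also have "\<dots> = (LINT x|lborel. f x * oscillator_expr (gauss_poly (hermite_poly j)) x)"
    by (rule harmonic_oscillator_weak[OF f schwartz_gauss_poly])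
  also have "\<dots> = (LINT x|lborel. complex_of_real (osc_eigenvalue j) * (f x * gauss_poly (hermite_poly j) x))"
    unfolding oscillator_hermite by (intro Bochner_Integration.integral_cong refl) (simp add: algebra_simps)
  also have "\<dots> = complex_of_real (osc_eigenvalue j) * (LINT x|lborel. f x * gauss_poly (hermite_poly j) x)"
    by simp
  finally show ?thesis using e by simp
qed

text \<open>The function is itself Schwartz, so a constant approximating sequence places it in the
  closure.\<close>

lemma hermite_eigenfunction:
  "(gauss_poly (hermite_poly j), \<lambda>x. complex_of_real (osc_eigenvalue j) * gauss_poly (hermite_poly j) x) \<in> harmonic_oscillator"
proof -
  have "square_integrable (gauss_poly (hermite_poly j))"
    using schwartz_square_integrable[OF schwartz_gauss_poly, of 0] by simp
  then show ?thesis
    unfolding harmonic_oscillator_def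
    by (auto simp: square_integrable_cmult schwartz_gauss_poly L2_tendsto_def oscillator_hermite
        intro!: exI[of _ "\<lambda>_. gauss_poly (hermite_poly j)"])
qed

lemma hermite_nonzero: "\<not> (AE x in lborel. gauss_poly (hermite_poly j) x = 0)"
proof
  assume "AE x in lborel. gauss_poly (hermite_poly j) x = 0"
  then have "AE x in lborel. x \<in> {x. poly (hermite_poly j) x = 0}" by (simp add: gauss_poly_def)
  moreover have fin: "finite {x. poly (hermite_poly j) x = 0}"
    using degree_hermite_poly[of j] by (intro poly_roots_finite) auto
  have "AE x in lborel. x \<notin> {x. poly (hermite_poly j) x = 0}"
    using countable_imp_null_set_lborel[OF countable_finite[OF fin]] by (rule AE_not_in)
  ultimately have "AE x::real in lborel. False" by eventually_elim simp
  then show False by (simp add: trivial_limit_def[symmetric] ae_filter_eq_bot_iff)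
qed

lemma op_eigenvalue_harmonic_oscillator:
  "op_eigenvalue harmonic_oscillator e \<longleftrightarrow> (\<exists>j. e = osc_eigenvalue j)"
proof
  assume "op_eigenvalue harmonic_oscillator e"
  then obtain f where f: "(f, \<lambda>x. complex_of_real e * f x) \<in> harmonic_oscillator" "\<not> (AE x in lborel. f x = 0)"
    unfolding op_eigenvalue_def by blast
  have "square_integrable f" using f(1) unfolding harmonic_oscillator_def by simp
  then show "\<exists>j. e = osc_eigenvalue j" using hermite_complete eigenfunction_orthogonal f by metis
qed (use hermite_eigenfunction hermite_nonzero in \<open>auto simp: op_eigenvalue_def\<close>)

text \<open>Two eigenfunctions for the same value have a nontrivial combination orthogonal to the
  j-th Hermite function; to all other Hermite functions it is orthogonal anyway, so by completeness
  it vanishes almost everywhere.\<close>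

lemma op_multiplicity_harmonic_oscillator:
  "op_multiplicity harmonic_oscillator (osc_eigenvalue j) = 1"
proof -
  let ?H = "harmonic_oscillator" and ?e = "osc_eigenvalue j" and ?h = "gauss_poly (hermite_poly j)"
  let ?X = "{enat m | m. \<exists>f. (\<forall>i<m. (f i, \<lambda>x. complex_of_real ?e * f i x) \<in> ?H) \<and> L2_independent m f}"
  have inj: "osc_eigenvalue i = osc_eigenvalue j \<longleftrightarrow> i = j" for i j by (auto simp: osc_eigenvalue_def)
  have "m \<le> 1" if f: "\<forall>i<m. (f i, \<lambda>x. complex_of_real ?e * f i x) \<in> ?H" and ind: "L2_independent m f" for m f
  proof (rule ccontr)
    assume "\<not> m \<le> 1"
    then have m: "2 \<le> m" by simp
    define a where "a i = (LINT x|lborel. f i x * ?h x)" for i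
    \<comment> \<open>The combination is a 1 f 0 - a 0 f 1; if both integrals are zero this would be
      trivial, and f 0 alone is taken.\<close>
    define c where "c i = (if i = 0 then (if a 0 = 0 \<and> a 1 = 0 then 1 else a 1) else if i = 1 then - a 0 else 0)" for i :: nat
    have sq: "square_integrable (f i)" if "i < m" for i using f that unfolding harmonic_oscillator_def by auto
    define g where "g x = c 0 * f 0 x + c 1 * f 1 x" for x
    have g: "square_integrable g"
      unfolding g_def using m by (intro square_integrable_add square_integrable_cmult sq) auto
    have int: "integrable lborel (\<lambda>x. f i x * gauss_poly p x)" if "i < m" for i p
      using schwartz_square_integrable[OF schwartz_gauss_poly, of 0] by (intro square_integrable_mult sq that) simp
    have gi: "(LINT x|lborel. g x * gauss_poly p x)
        = c 0 * (LINT x|lborel. f 0 x * gauss_poly p x) + c 1 * (LINT x|lborel. f 1 x * gauss_poly p x)" for p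
      using int[of 0 p] int[of 1 p] m by (simp add: g_def distrib_right mult.assoc)
    have "(LINT x|lborel. g x * gauss_poly (hermite_poly i) x) = 0" for i
    proof (cases "i = j")
      case True
      then show ?thesis unfolding gi a_def[symmetric] True by (simp add: c_def)
    next
      case False
      then have "?e \<noteq> osc_eigenvalue i" by (simp add: inj)
      then have "(LINT x|lborel. f l x * gauss_poly (hermite_poly i) x) = 0" if "l < m" for l
        using eigenfunction_orthogonal f that by blast
      then show ?thesis using m by (simp add: gi)
    qed
    then have "AE x in lborel. g x = 0" by (rule hermite_complete[OF g])
    moreover have "(\<Sum>i<m. c i * f i x) = g x" for x
    proof -
      have "(\<Sum>i<m. c i * f i x) = (\<Sum>i\<in>{0, 1}. c i * f i x)"
        using m by (intro sum.mono_neutral_right) (auto simp: c_def)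
      then show ?thesis by (simp add: g_def)
    qed
    ultimately have "AE x in lborel. (\<Sum>i<m. c i * f i x) = 0" by simp
    then have "\<forall>i<m. c i = 0" using ind unfolding L2_independent_def by blast
    then have "c 0 = 0" "c 1 = 0" using m by auto
    then show False by (auto simp: c_def split: if_splits)
  qed
  then have "Sup ?X \<le> 1" by (intro Sup_least) (auto simp: one_enat_def)
  moreover have "L2_independent 1 (\<lambda>_. ?h)"
    unfolding L2_independent_def
  proof (intro allI impI)
    fix c :: "nat \<Rightarrow> complex" and i :: nat
    assume c: "AE x in lborel. (\<Sum>i<1. c i * ?h x) = 0" and i: "i < 1"
    show "c i = 0"
    proof (rule ccontr)
      assume "c i \<noteq> 0"
      then have "AE x in lborel. ?h x = 0" using c i by simp
      then show False using hermite_nonzero by blast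
    qed
  qed
  then have "enat 1 \<in> ?X" using hermite_eigenfunction[of j] by (intro CollectI exI[of _ 1]) auto
  then have "1 \<le> Sup ?X" unfolding one_enat_def by (rule Sup_upper)
  ultimately show ?thesis unfolding op_multiplicity_def by (rule antisym)
qed

text \<open>The eigenvalues are simple and numbered from j = 0, so position k is j = k - 1: there
  are k - 1 eigenvalues strictly below it and k up to and including it.\<close>

lemma kth_smallest_harmonic_oscillator:
  assumes "1 \<le> k"
  shows "kth_smallest_op_eigenvalue harmonic_oscillator k ((2 * real k - 1) * pi / 2)"
proof -
  have e: "(2 * real k - 1) * pi / 2 = osc_eigenvalue (k - 1)"
    using assms by (simp add: osc_eigenvalue_def of_nat_diff)
  have mono: "osc_eigenvalue i < osc_eigenvalue j \<longleftrightarrow> i < j" "osc_eigenvalue i \<le> osc_eigenvalue j \<longleftrightarrow> i \<le> j" for i j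
    by (simp_all add: osc_eigenvalue_def)
  have inj: "inj_on osc_eigenvalue A" for A by (auto simp: inj_on_def osc_eigenvalue_def)
  have lt: "{e'. op_eigenvalue harmonic_oscillator e' \<and> e' < osc_eigenvalue (k - 1)} = osc_eigenvalue ` {..<k - 1}"
    and le: "{e'. op_eigenvalue harmonic_oscillator e' \<and> e' \<le> osc_eigenvalue (k - 1)} = osc_eigenvalue ` {..k - 1}"
    by (auto simp: op_eigenvalue_harmonic_oscillator mono)
  have sum: "(\<Sum>e'\<in>osc_eigenvalue ` A. op_multiplicity harmonic_oscillator e') = enat (card A)" for A
    by (simp add: sum.reindex[OF inj] op_multiplicity_harmonic_oscillator of_nat_eq_enat)
  show ?thesis
    unfolding kth_smallest_op_eigenvalue_def e lt le sum
    using assms by (auto simp: op_eigenvalue_harmonic_oscillator)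
qed

theorem theorem2:
  fixes k :: nat
  assumes "k \<ge> 1"
  shows "kth_smallest_op_eigenvalue harmonic_oscillator k ((2 * real k - 1) * pi / 2) \<and>
    (\<lambda>n :: nat. kth_largest_eigenvalue (M n) k
        - (1 - ((2 * real k - 1) * pi / 2) / real n)) \<in> o(\<lambda>n. 1 / real n)"
  using kth_smallest_harmonic_oscillator[OF assms] kth_largest_eigenvalue_M_asymptotics[OF assms] by blast

end
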